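(* Let $G$ be a torus acting smoothly on a manifold $M$, and let $\eta\in\mathfrak g$. For every $\eta$-polarized assignment $X\mapsto A(X)$ on $M$ there exists an $\eta$-polarized abstract moment map $\Psi\colon M\to\mathfrak g^*$ whose assignment is $A$.
   Context: $\mathfrak g$ is the Lie algebra of $G$, and $\xi_M$ is the vector field on $M$ generated by $\xi\in\mathfrak g$. For a subgroup $H\subseteq G$ with Lie algebra $\mathfrak h$ and a map $\Psi\colon M\to\mathfrak g^*$, both $\Psi^H$ and $\Psi^{\mathfrak h}$ denote the composition of $\Psi$ with the restriction map $\mathfrak g^*\to\mathfrak h^*$, and $\Psi^\xi=\langle\Psi,\xi\rangle\colon M\to\mathbb R$ for $\xi\in\mathfrak g$. An abstract moment map on $M$ is a smooth $G$-equivariant map $\Psi\colon M\to\mathfrak g^*$ such that for every (Lie) subgroup $H\subseteq G$ the map $\Psi^H$ is locally constant on the fixed point set $M^H$. The infinitesimal stabilizer of $m\in M$ is $\mathfrak g_m=\{\xi\in\mathfrak g : \xi_M|_m=0\}$. The infinitesimal orbit type strata of $M$ are the connected components of the sets $\{m\in M:\mathfrak g_m=\mathfrak h\}$, for subalgebras $\mathfrak h\subseteq\mathfrak g$; $\mathfrak g_X$ denotes the common infinitesimal stabilizer of the points of a stratum $X$. An assignment on $M$ is a function $A$ associating to each infinitesimal orbit type stratum $X$ an element $A(X)\in\mathfrak g_X^*$ such that, whenever $X$ is contained in the closure of $Y$, $A(Y)$ is the image of $A(X)$ under the restriction map $\mathfrak g_X^*\to\mathfrak g_Y^*$. The assignment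 of an abstract moment map $\Psi$ is $X\mapsto\Psi^{\mathfrak g_X}(X)$, the constant value of $\Psi^{\mathfrak g_X}$ on $X$. A function $\Psi\colon M\to\mathfrak g^*$ is $\eta$-polarized if $\Psi^\eta\colon M\to\mathbb R$ is proper and bounded from below. Let $M^\eta$ be the zero set of $\eta_M$, i.e. the set of points $m$ with $\eta\in\mathfrak g_m$. An assignment $A$ has a well-defined $\eta$-component $A^\eta\colon M^\eta\to\mathbb R$, $A^\eta(m)=\langle A(X),\eta\rangle$ for $m\in X$. The assignment $A$ is $\eta$-polarized if $A^\eta\colon M^\eta\to\mathbb R$ is proper and bounded from below. *)

theory Defs
  imports "HOL-Analysis.Analysis" "HOL-Algebra.Group_Action"
begin

section \<open>Smooth maps between subsets of Euclidean spaces\<close>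

primrec Ck_on :: "nat \<Rightarrow> 'a::euclidean_space set \<Rightarrow> ('a \<Rightarrow> 'b::euclidean_space) \<Rightarrow> bool" where
  "Ck_on 0 W f \<longleftrightarrow> continuous_on W f"
| "Ck_on (Suc k) W f \<longleftrightarrow>
     (\<forall>x\<in>W. f differentiable (at x)) \<and> (\<forall>v. Ck_on k W (\<lambda>x. frechet_derivative f (at x) v))"

text \<open>
  On a set that need not be open, smoothness means that the map extends locally to a smooth map
  on an open subset of the ambient space. On open sets, and more generally on embedded
  submanifolds, this is the usual notion.
\<close>

definition smooth_on :: "'a::euclidean_space set \<Rightarrow> ('a \<Rightarrow> 'b::euclidean_space) \<Rightarrow> bool" where
  "smooth_on S f \<longleftrightarrow>
     (\<forall>x\<in>S. \<exists>W F. open W \<and> x \<in> W \<and> (\<forall>k. Ck_on k W F) \<and> (\<forall>y\<in>W \<inter> S. F y = f y))"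


section \<open>Smooth manifolds\<close>

text \<open>
  The Euclidean space with coordinates indexed by the set \<open>I\<close>. Working inside a fixed type
  \<open>real ^ 'n\<close> with \<open>I\<close> a possibly empty set of indices includes dimension 0.
\<close>

definition coord_space :: "'n::finite set \<Rightarrow> (real ^ 'n) set" where
  "coord_space I = {x. \<forall>i. i \<notin> I \<longrightarrow> x $ i = 0}"

text \<open>
  A chart is a pair of its domain and its coordinate map; only the values of the coordinate map
  on the domain matter. The dimension may vary from component to component.
\<close>

type_synonym ('m, 'd) chart = "'m set \<times> ('m \<Rightarrow> real ^ 'd)"

definition is_chart :: "'m topology \<Rightarrow> ('m, 'd::finite) chart \<Rightarrow> bool" where
  "is_chart M c \<longleftrightarrow> (case c of (U, \<phi>) \<Rightarrow>
     openin M U \<and>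
     (\<exists>J. openin (top_of_set (coord_space J)) (\<phi> ` U)) \<and>
     homeomorphic_map (subtopology M U) (top_of_set (\<phi> ` U)) \<phi>)"

text \<open>The atlas need not be maximal; it determines the smooth structure.\<close>

definition smooth_manifold :: "'m topology \<Rightarrow> ('m, 'd::finite) chart set \<Rightarrow> bool" where
  "smooth_manifold M \<C> \<longleftrightarrow>
     Hausdorff_space M \<and> second_countable M \<and>
     (\<forall>c\<in>\<C>. is_chart M c) \<and>
     (\<Union>(U, \<phi>)\<in>\<C>. U) = topspace M \<and>
     (\<forall>(U, \<phi>)\<in>\<C>. \<forall>(V, \<psi>)\<in>\<C>. smooth_on (\<phi> ` (U \<inter> V)) (\<psi> \<circ> inv_into U \<phi>))"

definition smooth_function :: "('m, 'd::finite) chart set \<Rightarrow> ('m \<Rightarrow> real) \<Rightarrow> bool" where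
  "smooth_function \<C> f \<longleftrightarrow> (\<forall>(U, \<phi>)\<in>\<C>. smooth_on (\<phi> ` U) (f \<circ> inv_into U \<phi>))"


section \<open>Tori and their smooth actions\<close>

text \<open>
  The torus with one circle factor for every index in \<open>I\<close>. Multiplication on
  \<open>complex ^ 'n\<close> is componentwise. The Lie algebra, a product of copies of the
  imaginary axis, is identified with \<open>coord_space I\<close>; its bracket is zero.
\<close>

definition torus :: "'n::finite set \<Rightarrow> (complex ^ 'n) monoid" where
  "torus I = \<lparr>carrier = {z. \<forall>i. if i \<in> I then cmod (z $ i) = 1 else z $ i = 1},
              monoid.mult = (*), one = 1\<rparr>"

definition torus_exp :: "real ^ 'n::finite \<Rightarrow> complex ^ 'n" where
  "torus_exp \<xi> = (\<chi> i. cis (\<xi> $ i))"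

definition lie_algebra :: "'n::finite set \<Rightarrow> (complex ^ 'n) set \<Rightarrow> (real ^ 'n) set" where
  "lie_algebra I H = {\<xi> \<in> coord_space I. \<forall>t. torus_exp (t *\<^sub>R \<xi>) \<in> H}"

definition smooth_torus_action ::
    "'m topology \<Rightarrow> ('m, 'd::finite) chart set \<Rightarrow> 'n::finite set \<Rightarrow> (complex ^ 'n \<Rightarrow> 'm \<Rightarrow> 'm) \<Rightarrow> bool"
  where
  "smooth_torus_action M \<C> I \<rho> \<longleftrightarrow>
     group_action (torus I) (topspace M) \<rho> \<and>
     continuous_map (prod_topology (top_of_set (carrier (torus I))) M) M (\<lambda>(g, m). \<rho> g m) \<and>
     (\<forall>(U, \<phi>)\<in>\<C>. \<forall>(V, \<psi>)\<in>\<C>.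
        smooth_on {(g, x). g \<in> carrier (torus I) \<and> x \<in> \<phi> ` U \<and> \<rho> g (inv_into U \<phi> x) \<in> V}
                  (\<lambda>(g, x). \<psi> (\<rho> g (inv_into U \<phi> x))))"

definition fixed_points ::
    "'m topology \<Rightarrow> (complex ^ 'n::finite \<Rightarrow> 'm \<Rightarrow> 'm) \<Rightarrow> (complex ^ 'n) set \<Rightarrow> 'm set" where
  "fixed_points M \<rho> H = {m \<in> topspace M. \<forall>g\<in>H. \<rho> g m = m}"

text \<open>
  The value at \<open>m\<close> of the vector field generated by \<open>\<xi>\<close>, in the coordinates of a chart
  around \<open>m\<close>.
\<close>

definition generating_field ::
    "(complex ^ 'n::finite \<Rightarrow> 'm \<Rightarrow> 'm) \<Rightarrow> ('m, 'd::finite) chart \<Rightarrow> real ^ 'n \<Rightarrow> 'm \<Rightarrow> real ^ 'd" where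
  "generating_field \<rho> c \<xi> m =
     vector_derivative (\<lambda>t. snd c (\<rho> (torus_exp (t *\<^sub>R \<xi>)) m)) (at 0)"

definition inf_stabilizer ::
    "('m, 'd::finite) chart set \<Rightarrow> 'n::finite set \<Rightarrow> (complex ^ 'n \<Rightarrow> 'm \<Rightarrow> 'm) \<Rightarrow> 'm \<Rightarrow> (real ^ 'n) set"
  where
  "inf_stabilizer \<C> I \<rho> m =
     {\<xi> \<in> coord_space I. \<forall>c\<in>\<C>. m \<in> fst c \<longrightarrow> generating_field \<rho> c \<xi> m = 0}"

text \<open>Since the Lie algebra is abelian, its subalgebras are its linear subspaces.\<close>

definition inf_strata ::
    "'m topology \<Rightarrow> ('m, 'd::finite) chart set \<Rightarrow> 'n::finite set \<Rightarrow> (complex ^ 'n \<Rightarrow> 'm \<Rightarrow> 'm) \<Rightarrow> 'm set set"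
  where
  "inf_strata M \<C> I \<rho> =
     (\<Union>\<hh>\<in>{\<hh>. subspace \<hh> \<and> \<hh> \<subseteq> coord_space I}.
        connected_components_of (subtopology M {m \<in> topspace M. inf_stabilizer \<C> I \<rho> m = \<hh>}))"

definition stratum_stabilizer ::
    "('m, 'd::finite) chart set \<Rightarrow> 'n::finite set \<Rightarrow> (complex ^ 'n \<Rightarrow> 'm \<Rightarrow> 'm) \<Rightarrow> 'm set \<Rightarrow> (real ^ 'n) set"
  where
  "stratum_stabilizer \<C> I \<rho> X = (THE \<hh>. \<forall>m\<in>X. inf_stabilizer \<C> I \<rho> m = \<hh>)"

definition stratum_of ::
    "'m topology \<Rightarrow> ('m, 'd::finite) chart set \<Rightarrow> 'n::finite set \<Rightarrow> (complex ^ 'n \<Rightarrow> 'm \<Rightarrow> 'm) \<Rightarrow> 'm \<Rightarrow> 'm set"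
  where
  "stratum_of M \<C> I \<rho> m = (THE X. X \<in> inf_strata M \<C> I \<rho> \<and> m \<in> X)"


section \<open>Assignments and abstract moment maps\<close>

text \<open>
  Elements of the dual of a subspace \<open>V\<close> are functions that are linear on \<open>V\<close> and
  \<open>undefined\<close> outside, so that the restriction map between duals is \<open>restrict\<close>.
\<close>

definition dual_space :: "'a::real_vector set \<Rightarrow> ('a \<Rightarrow> real) set" where
  "dual_space V = {f \<in> extensional V.
     (\<forall>x\<in>V. \<forall>y\<in>V. f (x + y) = f x + f y) \<and> (\<forall>c. \<forall>x\<in>V. f (c *\<^sub>R x) = c * f x)}"

definition assignment ::
    "'m topology \<Rightarrow> ('m, 'd::finite) chart set \<Rightarrow> 'n::finite set \<Rightarrow> (complex ^ 'n \<Rightarrow> 'm \<Rightarrow> 'm)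
      \<Rightarrow> ('m set \<Rightarrow> real ^ 'n \<Rightarrow> real) \<Rightarrow> bool"
  where
  "assignment M \<C> I \<rho> A \<longleftrightarrow>
     (\<forall>X\<in>inf_strata M \<C> I \<rho>. A X \<in> dual_space (stratum_stabilizer \<C> I \<rho> X)) \<and>
     (\<forall>X\<in>inf_strata M \<C> I \<rho>. \<forall>Y\<in>inf_strata M \<C> I \<rho>.
        X \<subseteq> M closure_of Y \<longrightarrow> A Y = restrict (A X) (stratum_stabilizer \<C> I \<rho> Y))"

definition locally_constant :: "'m topology \<Rightarrow> ('m \<Rightarrow> 'b) \<Rightarrow> bool" where
  "locally_constant Y f \<longleftrightarrow> (\<forall>y\<in>topspace Y. \<exists>U. openin Y U \<and> y \<in> U \<and> f constant_on U)"

text \<open>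
  A map into the finite-dimensional space \<open>dual_space (coord_space I)\<close> is smooth iff its pairing
  with every element of \<open>coord_space I\<close> is. The coadjoint action of a torus is trivial, so
  equivariance is invariance. The last condition ranges over all abstract subgroups, hence over
  all Lie subgroups, closed or only immersed; for these \<open>lie_algebra\<close> is the usual Lie algebra.
\<close>

definition abstract_moment_map ::
    "'m topology \<Rightarrow> ('m, 'd::finite) chart set \<Rightarrow> 'n::finite set \<Rightarrow> (complex ^ 'n \<Rightarrow> 'm \<Rightarrow> 'm)
      \<Rightarrow> ('m \<Rightarrow> real ^ 'n \<Rightarrow> real) \<Rightarrow> bool"
  where
  "abstract_moment_map M \<C> I \<rho> \<Psi> \<longleftrightarrow>
     (\<forall>m\<in>topspace M. \<Psi> m \<in> dual_space (coord_space I)) \<and>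
     (\<forall>\<xi>\<in>coord_space I. smooth_function \<C> (\<lambda>m. \<Psi> m \<xi>)) \<and>
     (\<forall>g\<in>carrier (torus I). \<forall>m\<in>topspace M. \<Psi> (\<rho> g m) = \<Psi> m) \<and>
     (\<forall>H. subgroup H (torus I) \<longrightarrow>
        locally_constant (subtopology M (fixed_points M \<rho> H))
          (\<lambda>m. restrict (\<Psi> m) (lie_algebra I H)))"

definition has_assignment ::
    "'m topology \<Rightarrow> ('m, 'd::finite) chart set \<Rightarrow> 'n::finite set \<Rightarrow> (complex ^ 'n \<Rightarrow> 'm \<Rightarrow> 'm)
      \<Rightarrow> ('m \<Rightarrow> real ^ 'n \<Rightarrow> real) \<Rightarrow> ('m set \<Rightarrow> real ^ 'n \<Rightarrow> real) \<Rightarrow> bool"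
  where
  "has_assignment M \<C> I \<rho> \<Psi> A \<longleftrightarrow>
     (\<forall>X\<in>inf_strata M \<C> I \<rho>. \<forall>m\<in>X. restrict (\<Psi> m) (stratum_stabilizer \<C> I \<rho> X) = A X)"


section \<open>Polarization\<close>

definition proper_bounded_below :: "'m topology \<Rightarrow> ('m \<Rightarrow> real) \<Rightarrow> bool" where
  "proper_bounded_below Y f \<longleftrightarrow> proper_map Y euclideanreal f \<and> bdd_below (f ` topspace Y)"

definition polarized_map ::
    "'m topology \<Rightarrow> real ^ 'n::finite \<Rightarrow> ('m \<Rightarrow> real ^ 'n \<Rightarrow> real) \<Rightarrow> bool" where
  "polarized_map M \<eta> \<Psi> \<longleftrightarrow> proper_bounded_below M (\<lambda>m. \<Psi> m \<eta>)"

definition zero_set ::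
    "'m topology \<Rightarrow> ('m, 'd::finite) chart set \<Rightarrow> 'n::finite set \<Rightarrow> (complex ^ 'n \<Rightarrow> 'm \<Rightarrow> 'm)
      \<Rightarrow> real ^ 'n \<Rightarrow> 'm set"
  where
  "zero_set M \<C> I \<rho> \<eta> = {m \<in> topspace M. \<eta> \<in> inf_stabilizer \<C> I \<rho> m}"

definition polarized_assignment ::
    "'m topology \<Rightarrow> ('m, 'd::finite) chart set \<Rightarrow> 'n::finite set \<Rightarrow> (complex ^ 'n \<Rightarrow> 'm \<Rightarrow> 'm)
      \<Rightarrow> real ^ 'n \<Rightarrow> ('m set \<Rightarrow> real ^ 'n \<Rightarrow> real) \<Rightarrow> bool"
  where
  "polarized_assignment M \<C> I \<rho> \<eta> A \<longleftrightarrow>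
     assignment M \<C> I \<rho> A \<and>
     proper_bounded_below (subtopology M (zero_set M \<C> I \<rho> \<eta>))
       (\<lambda>m. A (stratum_of M \<C> I \<rho> m) \<eta>)"

end

theory Submission
  imports Defs
begin

text \<open>
  The map is glued from constants. Near the orbit of a point \<open>p\<close> every infinitesimal stabilizer is
  contained in that of \<open>p\<close>, and the values of the assignment \<open>A\<close> are the restrictions of its value at
  \<open>p\<close> (\<open>assignment_local\<close>). So every linear functional on the Lie algebra that extends the value of
  \<open>A\<close> at \<open>p\<close> is, as a constant map, a moment map with the right assignment near the orbit of \<open>p\<close>. The
  condition to restrict to \<open>A\<close> at every point is convex, so that the constants can be
  glued with an invariant partition of unity (\<open>partition_of_unity_exists\<close>, \<open>glue_eq\<close>); and an invariant
  smooth map that restricts to \<open>A\<close> is an abstract moment map (\<open>abstract_moment_mapI\<close>).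

  For the polarization, let \<open>f\<close> be a nonnegative invariant exhaustion of \<open>M\<close>. Where \<open>\<eta>\<close> is not in the
  infinitesimal stabilizer of \<open>p\<close>, the extension is chosen to have the value \<open>f p\<close> at \<open>\<eta>\<close>; elsewhere it
  has the value of \<open>A\<^sup>\<eta>\<close> at \<open>p\<close>. The neighbourhoods are so small that \<open>f\<close> exceeds its
  value at the centre by less than 1. If \<open>\<Psi>\<^sup>\<eta>\<close> is at most \<open>r\<close> at \<open>x\<close>, then one of the glued constants is, and \<open>f\<close>
  is bounded at its centre, either by \<open>r\<close> or because the centre is in the compact set where \<open>A\<^sup>\<eta> \<le> r\<close>.
  So \<open>f\<close> is bounded on the sublevel sets of \<open>\<Psi>\<^sup>\<eta>\<close>, which are therefore compact.

  The compatibility condition on \<open>A\<close> compares strata of which one is as a whole contained in the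
  closure of the other. To use it near \<open>p\<close> one has to know that the stratum of every point near \<open>p\<close>
  accumulates at all points of the stratum of \<open>p\<close> (\<open>stratum_closure\<close>). By connectedness this follows
  from a local statement: each point has a neighbourhood in which the points with a given infinitesimal
  stabilizer \<open>k\<close>, if there are any, form a connected set that is dense among the points fixed
  by \<open>k\<close> (\<open>local_strata\<close>). The action of the infinitesimal stabilizer of a point is
  linearized near the point by averaging a chart over circles (\<open>linear_model\<close>). In the linear model
  the points in question are the complement, in the subspace fixed by \<open>k\<close>, of countably many
  subspaces; these have codimension at least two, because a circle cannot act on a line other than
  trivially (\<open>circle_fixed_space_codim\<close>, \<open>connected_complement_codim2\<close>).

  Countability and the reduction to circles rest on the fact that the infinitesimal stabilizers are
  spanned by periods of the exponential map (\<open>lineality_rational\<close>). This and the semicontinuity of the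
  infinitesimal stabilizer (\<open>lstab_semicontinuous\<close>) are properties of closed subgroups of \<open>real ^ 'n\<close>,
  applied to the preimages of the stabilizers under the exponential map.
\<close>

section \<open>Calculus of smooth maps between Euclidean spaces\<close>

text \<open>On an open set no local extensions are involved, and smoothness can be handled by calculus.\<close>

definition smooth_open :: "'a::euclidean_space set \<Rightarrow> ('a \<Rightarrow> 'b::euclidean_space) \<Rightarrow> bool" where
  "smooth_open W f \<longleftrightarrow> open W \<and> (\<forall>k. Ck_on k W f)"

lemma Ck_on_subset: "Ck_on k W f \<Longrightarrow> V \<subseteq> W \<Longrightarrow> Ck_on k V f"
proof (induction k arbitrary: f)
  case 0 then show ?case using continuous_on_subset by auto
next
  case (Suc k) then show ?case by (auto intro: Suc.IH)
qed

lemma Ck_on_imp_continuous_on: "Ck_on k W f \<Longrightarrow> continuous_on W f"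
  by (cases k)
    (auto intro!: continuous_at_imp_continuous_on dest: differentiable_imp_continuous_within)

lemma Ck_on_Suc_imp: "Ck_on (Suc k) W f \<Longrightarrow> Ck_on k W f"
proof (induction k arbitrary: f)
  case 0 show ?case
    using Ck_on_imp_continuous_on[OF 0] by simp
next
  case (Suc k)
  have "Ck_on k W (\<lambda>x. frechet_derivative f (at x) v)" for v
    using Suc.prems Suc.IH by (metis Ck_on.simps(2))
  moreover have "\<forall>x\<in>W. f differentiable at x"
    using Suc.prems by (metis Ck_on.simps(2))
  ultimately show ?case by (metis Ck_on.simps(2))
qed

lemma Ck_on_cong:
  assumes "open W" "Ck_on k W f" "\<And>x. x \<in> W \<Longrightarrow> f x = g x"
  shows "Ck_on k W g"
  using assms(2,3)
proof (induction k arbitrary: f g)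
  case 0 then show ?case using continuous_on_cong by (metis Ck_on.simps(1))
next
  case (Suc k)
  have 1: "g differentiable at x" if "x \<in> W" for x
    using Suc.prems that \<open>open W\<close> by (metis (mono_tags, lifting) Ck_on.simps(2)
        differentiable_def has_derivative_transform_within_open)
  have 2: "frechet_derivative f (at x) = frechet_derivative g (at x)" if "x \<in> W" for x
    using Suc.prems that \<open>open W\<close> by (intro frechet_derivative_transform_within_open) auto
  have "Ck_on k W (\<lambda>x. frechet_derivative g (at x) v)" for v
    by (rule Suc.IH[of "\<lambda>x. frechet_derivative f (at x) v"]) (use Suc.prems 2 in auto)
  with 1 show ?case by simp
qed

lemma Ck_on_local:
  assumes "\<And>x. x \<in> W \<Longrightarrow> \<exists>V. open V \<and> x \<in> V \<and> Ck_on k V f"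
  shows "Ck_on k W f"
  using assms
proof (induction k arbitrary: f)
  case 0
  have "isCont f x" if x: "x \<in> W" for x
  proof -
    obtain V where "open V" "x \<in> V" "Ck_on 0 V f" using "0.prems"[OF x] by blast
    then show ?thesis by (simp add: continuous_on_eq_continuous_at)
  qed
  then show ?case by (simp add: continuous_at_imp_continuous_on)
next
  case (Suc k)
  have "\<exists>V. open V \<and> x \<in> V \<and> Ck_on k V (\<lambda>x. frechet_derivative f (at x) v)" if "x \<in> W" for x v
    using Suc.prems[OF that] by (metis Ck_on.simps(2))
  then have "Ck_on k W (\<lambda>x. frechet_derivative f (at x) v)" for v
    by (intro Suc.IH) blast
  moreover have "f differentiable at x" if "x \<in> W" for x
    using Suc.prems[OF that] by auto
  ultimately show ?case by simp
qed

lemma Ck_on_SucI: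
  assumes "open W" "\<And>x. x \<in> W \<Longrightarrow> (f has_derivative f' x) (at x)"
    and "\<And>v. Ck_on k W (\<lambda>x. f' x v)"
  shows "Ck_on (Suc k) W f"
proof -
  have "frechet_derivative f (at x) = f' x" if "x \<in> W" for x
    using assms(2)[OF that] frechet_derivative_at by metis
  then have "Ck_on k W (\<lambda>x. frechet_derivative f (at x) v)" for v
    by (intro Ck_on_cong[OF assms(1) assms(3)[of v]]) simp
  then show ?thesis
    using assms(2) by (auto simp: differentiable_def)
qed

lemma Ck_on_SucE:
  assumes "Ck_on (Suc k) W f"
  shows "\<And>x. x \<in> W \<Longrightarrow> (f has_derivative frechet_derivative f (at x)) (at x)"
    and "\<And>v. Ck_on k W (\<lambda>x. frechet_derivative f (at x) v)"
  using assms by (auto simp: frechet_derivative_works[symmetric])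

lemma Ck_on_const: "Ck_on k W (\<lambda>x. c)"
  by (induction k arbitrary: c) auto

lemma Ck_on_linear:
  assumes "bounded_linear f" shows "Ck_on k W f"
proof (cases k)
  case 0 then show ?thesis using assms by (simp add: linear_continuous_on)
next
  case (Suc j)
  have "(f has_derivative f) (at x)" for x
    using assms bounded_linear_imp_has_derivative by blast
  then have "Ck_on (Suc j) UNIV f"
    by (intro Ck_on_SucI[where f' = "\<lambda>_. f"] Ck_on_const) auto
  then show ?thesis using Ck_on_subset Suc by blast
qed

lemma Ck_on_linear_comp:
  assumes "open W" "bounded_linear L" "Ck_on k W f" shows "Ck_on k W (\<lambda>x. L (f x))"
  using assms(3)
proof (induction k arbitrary: f)
  case 0 then show ?case using assms(2) by (simp add: bounded_linear.continuous_on)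
next
  case (Suc k)
  show ?case
  proof (rule Ck_on_SucI[OF \<open>open W\<close>])
    show "((\<lambda>x. L (f x)) has_derivative (\<lambda>v. L (frechet_derivative f (at x) v))) (at x)"
      if "x \<in> W" for x
      using bounded_linear.has_derivative[OF assms(2) Ck_on_SucE(1)[OF Suc.prems that]] .
    show "Ck_on k W (\<lambda>x. L (frechet_derivative f (at x) v))" for v
      by (intro Suc.IH Ck_on_SucE(2)[OF Suc.prems])
  qed
qed

lemma Ck_on_add:
  assumes "open W" "Ck_on k W f" "Ck_on k W g" shows "Ck_on k W (\<lambda>x. f x + g x)"
  using assms(2,3)
proof (induction k arbitrary: f g)
  case 0 then show ?case by (simp add: continuous_on_add)
next
  case (Suc k)
  show ?case
  proof (rule Ck_on_SucI[OF \<open>open W\<close>])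
    show "((\<lambda>x. f x + g x) has_derivative
        (\<lambda>v. frechet_derivative f (at x) v + frechet_derivative g (at x) v)) (at x)"
      if "x \<in> W" for x
      by (intro has_derivative_add Ck_on_SucE(1)[OF Suc.prems(1) that] Ck_on_SucE(1)[OF Suc.prems(2) that])
    show "Ck_on k W (\<lambda>x. frechet_derivative f (at x) v + frechet_derivative g (at x) v)" for v
      by (intro Suc.IH Ck_on_SucE(2)[OF Suc.prems(1)] Ck_on_SucE(2)[OF Suc.prems(2)])
  qed
qed

lemma Ck_on_sum:
  assumes "open W" "\<And>i. i \<in> S \<Longrightarrow> Ck_on k W (f i)" shows "Ck_on k W (\<lambda>x. \<Sum>i\<in>S. f i x)"
  using assms(2)
proof (induction S rule: infinite_finite_induct)
  case (insert i S) then show ?case by (simp add: Ck_on_add[OF \<open>open W\<close>])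
qed (auto intro: Ck_on_const)

lemma Ck_on_bilinear:
  assumes "open W" "bounded_bilinear b" "Ck_on k W f" "Ck_on k W g"
  shows "Ck_on k W (\<lambda>x. b (f x) (g x))"
  using assms(3,4)
proof (induction k arbitrary: f g)
  case 0 then show ?case by (simp add: bounded_bilinear.continuous_on[OF assms(2)])
next
  case (Suc k)
  note f = Ck_on_SucE[OF Suc.prems(1)] and g = Ck_on_SucE[OF Suc.prems(2)]
  show ?case
  proof (rule Ck_on_SucI[OF \<open>open W\<close>])
    show "((\<lambda>x. b (f x) (g x)) has_derivative
        (\<lambda>v. b (f x) (frechet_derivative g (at x) v) + b (frechet_derivative f (at x) v) (g x))) (at x)"
      if "x \<in> W" for x
      by (intro bounded_bilinear.FDERIV[OF assms(2)] f(1) g(1) that)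
    show "Ck_on k W (\<lambda>x. b (f x) (frechet_derivative g (at x) v) + b (frechet_derivative f (at x) v) (g x))" for v
      by (intro Ck_on_add[OF \<open>open W\<close>] Suc.IH f(2) g(2) Ck_on_Suc_imp[OF Suc.prems(1)]
          Ck_on_Suc_imp[OF Suc.prems(2)])
  qed
qed

lemmas Ck_on_scaleR = Ck_on_bilinear[OF _ bounded_bilinear_scaleR]
lemmas Ck_on_mult = Ck_on_bilinear[OF _ bounded_bilinear_mult]

text \<open>The derivative of a composition is expanded in a basis, so that the induction hypothesis
  applies to the directional derivatives of the outer map.\<close>

lemma Ck_on_compose:
  assumes "open W" "open V" "Ck_on k V g" "Ck_on k W f" "f ` W \<subseteq> V"
  shows "Ck_on k W (\<lambda>x. g (f x))"
  using assms(3,4,5)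
proof (induction k arbitrary: f g)
  case 0 then show ?case using continuous_on_compose2[of V g W f] by simp
next
  case (Suc k)
  note f = Ck_on_SucE[OF Suc.prems(2)] and g = Ck_on_SucE[OF Suc.prems(1)]
  let ?f' = "\<lambda>x. frechet_derivative f (at x)" and ?g' = "\<lambda>x. frechet_derivative g (at x)"
  have expand: "?g' (f x) (?f' x v) = (\<Sum>b\<in>Basis. (?f' x v \<bullet> b) *\<^sub>R ?g' (f x) b)" if "x \<in> W" for x v
  proof -
    have "linear (?g' (f x))"
      using g(1)[of "f x"] Suc.prems(3) that has_derivative_linear by blast
    then have "?g' (f x) (\<Sum>b\<in>Basis. (?f' x v \<bullet> b) *\<^sub>R b) = (\<Sum>b\<in>Basis. (?f' x v \<bullet> b) *\<^sub>R ?g' (f x) b)"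
      by (simp add: linear_sum linear_scale)
    then show ?thesis by (simp add: euclidean_representation)
  qed
  show ?case
  proof (rule Ck_on_SucI[OF \<open>open W\<close>])
    show "((\<lambda>x. g (f x)) has_derivative (\<lambda>v. ?g' (f x) (?f' x v))) (at x)" if "x \<in> W" for x
      using diff_chain_at[OF f(1)[OF that] g(1)[of "f x"]] that Suc.prems(3)
      by (auto simp: o_def)
    have "Ck_on k W (\<lambda>x. \<Sum>b\<in>Basis. (?f' x v \<bullet> b) *\<^sub>R ?g' (f x) b)" for v
    proof (intro Ck_on_sum[OF \<open>open W\<close>] Ck_on_scaleR[OF \<open>open W\<close>])
      show "Ck_on k W (\<lambda>x. ?f' x v \<bullet> b)" for b
        by (intro Ck_on_linear_comp[OF \<open>open W\<close> bounded_linear_inner_left] f(2))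
      show "Ck_on k W (\<lambda>x. ?g' (f x) b)" for b
        by (intro Suc.IH g(2) Ck_on_Suc_imp[OF Suc.prems(2)] Suc.prems(3))
    qed
    then show "Ck_on k W (\<lambda>x. ?g' (f x) (?f' x v))" for v
      by (rule Ck_on_cong[OF \<open>open W\<close>]) (simp add: expand)
  qed
qed

lemma Ck_on_Pair:
  assumes "open W" "Ck_on k W f" "Ck_on k W g" shows "Ck_on k W (\<lambda>x. (f x, g x))"
proof -
  have 1: "bounded_linear (\<lambda>a. (a, 0))" and 2: "bounded_linear (\<lambda>b. (0, b))"
    by (auto intro!: bounded_linear_Pair bounded_linear_ident bounded_linear_zero)
  have "Ck_on k W (\<lambda>x. (f x, 0) + (0, g x))"
    by (intro Ck_on_add assms Ck_on_linear_comp[OF \<open>open W\<close> 1] Ck_on_linear_comp[OF \<open>open W\<close> 2])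
  then show ?thesis by simp
qed

text \<open>Differentiation under the integral sign; each directional derivative of the integral is
  an integral of the same kind.\<close>

lemma has_derivative_param_integral:
  fixes f :: "real \<times> 'a::euclidean_space \<Rightarrow> 'b::euclidean_space"
  assumes "open W" "Ck_on (Suc 0) (UNIV \<times> W) f" "y \<in> W"
  shows "((\<lambda>y. integral {0..1} (\<lambda>t. f (t, y))) has_derivative
     (\<lambda>v. integral {0..1} (\<lambda>t. frechet_derivative f (at (t, y)) (0, v)))) (at y)"
proof -
  obtain r where r: "r > 0" "ball y r \<subseteq> W"
    using openE[OF assms(1,3)] by blast
  let ?f' = "\<lambda>t y. frechet_derivative f (at (t, y))"
  note f = Ck_on_SucE[OF assms(2)]
  define D where "D y t = Blinfun (\<lambda>v. ?f' t y (0, v))" for y t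
  have der: "((\<lambda>y. f (t, y)) has_derivative (\<lambda>v. ?f' t y (0, v))) (at y)" if "y \<in> W" for t y
  proof -
    have "((\<lambda>y. (t, y)) has_derivative (\<lambda>v. (0, v))) (at y)"
      by (intro derivative_eq_intros) auto
    then show ?thesis
      using diff_chain_at[of "\<lambda>y. (t, y)" "\<lambda>v. (0, v)" y f] f(1)[of "(t,y)"] that
      by (auto simp: o_def)
  qed
  have D: "blinfun_apply (D y t) = (\<lambda>v. ?f' t y (0, v))" if "y \<in> W" for y t
    unfolding D_def using der[OF that] by (intro bounded_linear_Blinfun_apply has_derivative_bounded_linear)
  have contD: "continuous_on (ball y r \<times> cbox 0 1) (\<lambda>(y, t). D y t)"
  proof (rule continuous_on_blinfun_componentwise)
    fix b :: 'a
    have "continuous_on (UNIV \<times> W) (\<lambda>x. frechet_derivative f (at x) (0, b))"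
      using f(2) by simp
    then have "continuous_on (ball y r \<times> cbox 0 1) (\<lambda>p. frechet_derivative f (at (snd p, fst p)) (0, b))"
      by (rule continuous_on_compose2[where f = "\<lambda>p. (snd p, fst p)"])
        (use r in \<open>auto intro!: continuous_intros\<close>)
    then show "continuous_on (ball y r \<times> cbox 0 1) (\<lambda>x. blinfun_apply (case x of (y, t) \<Rightarrow> D y t) b)"
      by (rule continuous_on_eq) (use r D in auto)
  qed
  have contf: "continuous_on (UNIV \<times> W) f"
    using Ck_on_imp_continuous_on assms(2) by blast
  have "((\<lambda>y. integral (cbox 0 1) (\<lambda>t. f (t, y))) has_derivative integral (cbox 0 1) (D y)) (at y within ball y r)"
  proof (rule leibniz_rule[OF _ _ contD])
    show "((\<lambda>y. f (t, y)) has_derivative blinfun_apply (D x t)) (at x within ball y r)"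
      if "x \<in> ball y r" for x t
      using der D that r by (metis has_derivative_at_withinI subsetD)
    show "(\<lambda>t. f (t, x)) integrable_on cbox 0 1" if "x \<in> ball y r" for x
      by (rule integrable_continuous, rule continuous_on_compose2[OF contf])
        (use that r in \<open>auto intro!: continuous_intros\<close>)
  qed (use r in auto)
  moreover have "blinfun_apply (integral (cbox 0 1) (D y)) = (\<lambda>v. integral {0..1} (\<lambda>t. ?f' t y (0, v)))"
  proof
    fix v
    have "continuous_on (cbox 0 1) (D y)"
      using continuous_on_compose2[OF contD, of "cbox 0 1" "\<lambda>t. (y, t)"] r
      by (force intro!: continuous_intros)
    then show "blinfun_apply (integral (cbox 0 1) (D y)) v = integral {0..1} (\<lambda>t. ?f' t y (0, v))"
      using D[OF assms(3)] by (simp add: blinfun_apply_integral integrable_continuous_real)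
  qed
  moreover have "at y within ball y r = at y"
    using r(1) by (intro at_within_open) auto
  ultimately show ?thesis
    by simp
qed

lemma Ck_on_param_integral:
  fixes f :: "real \<times> 'a::euclidean_space \<Rightarrow> 'b::euclidean_space"
  assumes "open W" "Ck_on k (UNIV \<times> W) f"
  shows "Ck_on k W (\<lambda>y. integral {0..1} (\<lambda>t. f (t, y)))"
  using assms(2)
proof (induction k arbitrary: f)
  case 0
  have "continuous_on (W \<times> cbox 0 1) (\<lambda>(y, t). f (t, y))"
    unfolding split_beta
    by (rule continuous_on_compose2[of "UNIV \<times> W" f]) (use 0 in \<open>auto intro!: continuous_intros\<close>)
  then show ?case
    using integral_continuous_on_param[of W 0 1 "\<lambda>y t. f (t, y)"] by simp
next
  case (Suc k)
  have "Ck_on (Suc 0) (UNIV \<times> W) f"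
  proof -
    have "Ck_on (Suc n) (UNIV \<times> W) f \<Longrightarrow> Ck_on (Suc 0) (UNIV \<times> W) f" for n
      by (induction n) (simp_all only: Ck_on_Suc_imp)
    then show ?thesis using Suc.prems by blast
  qed
  note der = has_derivative_param_integral[OF assms(1) this]
  show ?case
    by (rule Ck_on_SucI[OF assms(1) der]) (auto simp del: Ck_on.simps intro!: Suc.IH Ck_on_SucE(2)[OF Suc.prems])
qed

subsection \<open>Smooth maps on open sets\<close>

lemma smooth_open_imp_open: "smooth_open W f \<Longrightarrow> open W"
  by (simp add: smooth_open_def)

lemma smooth_open_compose:
  "smooth_open V g \<Longrightarrow> smooth_open W f \<Longrightarrow> f ` W \<subseteq> V \<Longrightarrow> smooth_open W (\<lambda>x. g (f x))"
  unfolding smooth_open_def using Ck_on_compose by blast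

lemma smooth_open_subset: "smooth_open W f \<Longrightarrow> open V \<Longrightarrow> V \<subseteq> W \<Longrightarrow> smooth_open V f"
  unfolding smooth_open_def using Ck_on_subset by blast

lemma smooth_open_cong: "smooth_open W f \<Longrightarrow> (\<And>x. x \<in> W \<Longrightarrow> f x = g x) \<Longrightarrow> smooth_open W g"
  unfolding smooth_open_def using Ck_on_cong by blast

lemma smooth_open_local:
  assumes "\<And>x. x \<in> W \<Longrightarrow> \<exists>V. x \<in> V \<and> V \<subseteq> W \<and> smooth_open V f"
  shows "smooth_open W f"
  unfolding smooth_open_def
proof (intro conjI allI)
  show "open W" using assms open_subopen smooth_open_def by metis
  show "Ck_on k W f" for k
    by (rule Ck_on_local) (use assms smooth_open_def in metis)
qed

lemma smooth_open_const: "open W \<Longrightarrow> smooth_open W (\<lambda>x. c)"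
  by (simp add: smooth_open_def Ck_on_const)

lemma smooth_open_linear: "open W \<Longrightarrow> bounded_linear f \<Longrightarrow> smooth_open W f"
  by (simp add: smooth_open_def Ck_on_linear)

lemma smooth_open_linear_comp: "bounded_linear L \<Longrightarrow> smooth_open W f \<Longrightarrow> smooth_open W (\<lambda>x. L (f x))"
  by (simp add: smooth_open_def Ck_on_linear_comp)

lemma smooth_open_Pair:
  "smooth_open W f \<Longrightarrow> smooth_open W g \<Longrightarrow> smooth_open W (\<lambda>x. (f x, g x))"
  by (simp add: smooth_open_def Ck_on_Pair)

lemma smooth_open_add:
  "smooth_open W f \<Longrightarrow> smooth_open W g \<Longrightarrow> smooth_open W (\<lambda>x. f x + g x)"
  by (simp add: smooth_open_def Ck_on_add)

lemma smooth_open_sum: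
  "open W \<Longrightarrow> (\<And>i. i \<in> S \<Longrightarrow> smooth_open W (f i)) \<Longrightarrow> smooth_open W (\<lambda>x. \<Sum>i\<in>S. f i x)"
  by (simp add: smooth_open_def Ck_on_sum)

lemma smooth_open_scaleR:
  "smooth_open W f \<Longrightarrow> smooth_open W g \<Longrightarrow> smooth_open W (\<lambda>x. f x *\<^sub>R g x)"
  by (simp add: smooth_open_def Ck_on_scaleR)

lemma smooth_open_mult:
  fixes f :: "'a::euclidean_space \<Rightarrow> 'b::{euclidean_space,real_normed_algebra}"
  shows "smooth_open W f \<Longrightarrow> smooth_open W g \<Longrightarrow> smooth_open W (\<lambda>x. f x * g x)"
  by (simp add: smooth_open_def Ck_on_mult)

lemma smooth_open_derivative:
  "smooth_open W f \<Longrightarrow> smooth_open W (\<lambda>x. frechet_derivative f (at x) v)"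
  unfolding smooth_open_def using Ck_on_SucE(2) by blast

lemma smooth_open_has_derivative:
  "smooth_open W f \<Longrightarrow> x \<in> W \<Longrightarrow> (f has_derivative frechet_derivative f (at x)) (at x)"
  unfolding smooth_open_def using Ck_on_SucE(1) by blast

lemma smooth_open_continuous_on: "smooth_open W f \<Longrightarrow> continuous_on W f"
  unfolding smooth_open_def using Ck_on_imp_continuous_on by blast

lemma smooth_open_param_integral:
  fixes f :: "real \<times> 'a::euclidean_space \<Rightarrow> 'b::euclidean_space"
  assumes "open W" "smooth_open (UNIV \<times> W) f"
  shows "smooth_open W (\<lambda>y. integral {0..1} (\<lambda>t. f (t, y)))"
  using assms by (simp add: smooth_open_def Ck_on_param_integral)

text \<open>For functions whose directional derivatives are again given by functions of the same form,
  one differentiation settles all orders.\<close>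

lemma smooth_openI_derivative:
  assumes "open W" "f \<in> S"
    and der: "\<And>f. f \<in> S \<Longrightarrow> \<exists>f'. (\<forall>x\<in>W. (f has_derivative f' x) (at x)) \<and> (\<forall>v. (\<lambda>x. f' x v) \<in> S)"
  shows "smooth_open W f"
proof -
  have "Ck_on k W f" if "f \<in> S" for k f
    using that
  proof (induction k arbitrary: f)
    case 0
    obtain f' where "\<forall>x\<in>W. (f has_derivative f' x) (at x)"
      using der[OF 0] by blast
    then show ?case
      by (metis Ck_on.simps(1) continuous_at_imp_continuous_on has_derivative_continuous)
  next
    case (Suc k)
    obtain f' where f': "\<forall>x\<in>W. (f has_derivative f' x) (at x)" "\<forall>v. (\<lambda>x. f' x v) \<in> S"
      using der[OF Suc.prems] by blast
    show ?case
      by (rule Ck_on_SucI[OF \<open>open W\<close>, where f' = f']) (use f' Suc.IH in simp_all)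
  qed
  then show ?thesis using assms by (simp add: smooth_open_def)
qed

lemma smooth_open_cis: "smooth_open UNIV cis"
proof (rule smooth_openI_derivative[where S = "range (\<lambda>c t. c * cis t)"])
  show "cis \<in> range (\<lambda>c t. c * cis t)" by (rule image_eqI[of _ _ 1]) auto
next
  fix f :: "real \<Rightarrow> complex" assume "f \<in> range (\<lambda>c t. c * cis t)"
  then obtain c where c: "f = (\<lambda>t. c * cis t)" by blast
  have cis': "(cis has_derivative (\<lambda>v. v *\<^sub>R (\<i> * cis x))) (at x)" for x
    using has_derivative_cis[OF has_derivative_ident] .
  show "\<exists>f'. (\<forall>x\<in>UNIV. (f has_derivative f' x) (at x)) \<and> (\<forall>v. (\<lambda>x. f' x v) \<in> range (\<lambda>c t. c * cis t))"
  proof (intro exI[of _ "\<lambda>x v. c * (v *\<^sub>R (\<i> * cis x))"] conjI ballI allI)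
    show "(f has_derivative (\<lambda>v. c * (v *\<^sub>R (\<i> * cis x)))) (at x)" for x
      unfolding c using has_derivative_mult_right[OF cis'] .
    show "(\<lambda>x. c * (v *\<^sub>R (\<i> * cis x))) \<in> range (\<lambda>c t. c * cis t)" for v
      by (rule image_eqI[of _ _ "v *\<^sub>R (c * \<i>)"]) (auto simp: mult.assoc)
  qed
qed auto

lemma smooth_on_pullback:
  assumes "smooth_on S f" "smooth_open V h" "h ` V \<subseteq> S"
  shows "smooth_open V (\<lambda>x. f (h x))"
proof (rule smooth_open_local)
  fix x assume x: "x \<in> V"
  then have "h x \<in> S" using assms(3) by auto
  then obtain W F where W: "open W" "h x \<in> W" "\<forall>k. Ck_on k W F" "\<forall>y\<in>W \<inter> S. F y = f y"
    using assms(1)[unfolded smooth_on_def, rule_format, of "h x"] by blast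
  have F: "smooth_open W F" using W(1,3) by (simp only: smooth_open_def simp_thms)
  let ?V = "V \<inter> h -` W"
  have "open ?V"
    using continuous_open_preimage[OF smooth_open_continuous_on[OF assms(2)] smooth_open_imp_open[OF assms(2)] W(1)] .
  then have "smooth_open ?V h"
    using smooth_open_subset[OF assms(2)] by blast
  then have "smooth_open ?V (\<lambda>x. F (h x))"
    by (rule smooth_open_compose[OF F]) auto
  then have "smooth_open ?V (\<lambda>x. f (h x))"
    by (rule smooth_open_cong) (use W(4) assms(3) in auto)
  then show "\<exists>U. x \<in> U \<and> U \<subseteq> V \<and> smooth_open U (\<lambda>x. f (h x))"
    by (intro exI[of _ ?V]) (simp add: x W(2))
qed

subsection \<open>A smooth step function\<close>

text \<open>The functions \<open>p(1/x) exp(-1/x)\<close>, extended by 0 to \<open>x \<le> 0\<close>, form a class that is closed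
  under differentiation.\<close>

definition flat :: "real poly \<Rightarrow> real \<Rightarrow> real" where
  "flat p x = (if x > 0 then poly p (inverse x) * exp (- inverse x) else 0)"

lemma poly_exp_tendsto_0: "((\<lambda>y::real. poly p y * exp (- y)) \<longlongrightarrow> 0) at_top"
proof -
  have "((\<lambda>y::real. \<Sum>i\<le>degree p. coeff p i * (y ^ i / exp y)) \<longlongrightarrow> (\<Sum>i\<le>degree p. coeff p i * 0)) at_top"
    by (intro tendsto_intros tendsto_power_div_exp_0)
  moreover have "(\<Sum>i\<le>degree p. coeff p i * (y ^ i / exp y)) = poly p y * exp (- y)" for y :: real
    by (simp add: poly_altdef sum_distrib_right exp_minus divide_inverse mult.assoc)
  ultimately show ?thesis by simp
qed

lemma has_derivative_flat:
  "(flat p has_derivative (\<lambda>v. v * flat (monom 1 2 * (p - pderiv p)) x)) (at x)"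
proof -
  let ?q = "monom 1 2 * (p - pderiv p)"
  have "(flat p has_field_derivative flat ?q x) (at x)"
  proof (cases x "0::real" rule: linorder_cases)
    case less
    have "((\<lambda>x. 0) has_field_derivative flat ?q x) (at x)"
      using less by (simp add: flat_def)
    then show ?thesis
      by (rule has_field_derivative_transform_within_open[where S = "{..<0}"]) (use less in \<open>auto simp: flat_def\<close>)
  next
    case greater
    have "((\<lambda>x. poly p (inverse x) * exp (- inverse x)) has_field_derivative flat ?q x) (at x)"
      using greater
      by (auto intro!: derivative_eq_intros poly_DERIV[THEN DERIV_chain2]
          simp: flat_def poly_monom power2_eq_square algebra_simps)
    then show ?thesis
      by (rule has_field_derivative_transform_within_open[where S = "{0<..}"]) (use greater in \<open>auto simp: flat_def\<close>)
  next
    case equal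
    have "((\<lambda>h. poly (pCons 0 p) (inverse h) * exp (- inverse h)) \<longlongrightarrow> 0) (at_right 0)"
      using filterlim_compose[OF poly_exp_tendsto_0 filterlim_inverse_at_top_right] .
    then have "((\<lambda>h. (flat p (0 + h) - flat p 0) / h) \<longlongrightarrow> 0) (at_right 0)"
      by (rule tendsto_cong[THEN iffD1, rotated])
        (auto simp: flat_def field_simps eventually_at_filter)
    moreover have "((\<lambda>h. (flat p (0 + h) - flat p 0) / h) \<longlongrightarrow> 0) (at_left 0)"
      by (rule tendsto_eventually) (auto simp: flat_def eventually_at_filter)
    ultimately show ?thesis
      using equal by (simp add: DERIV_def flat_def filterlim_split_at)
  qed
  then show ?thesis
    unfolding has_field_derivative_def mult.commute[of _ "flat ?q x"] .
qed

lemma smooth_open_flat: "smooth_open UNIV (flat p)"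
proof (rule smooth_openI_derivative[where S = "range flat"])
  fix f :: "real \<Rightarrow> real" assume "f \<in> range flat"
  then obtain p where f: "f = flat p" by blast
  have "(\<lambda>x. v * flat q x) = flat (smult v q)" for v q
    by (auto simp: flat_def)
  then show "\<exists>f'. (\<forall>x\<in>UNIV. (f has_derivative f' x) (at x)) \<and> (\<forall>v. (\<lambda>x. f' x v) \<in> range flat)"
    unfolding f using has_derivative_flat
    by (intro exI[of _ "\<lambda>x v. v * flat (monom 1 2 * (p - pderiv p)) x"]) auto
qed auto

lemma smooth_open_inverse: "smooth_open {0<..} (inverse :: real \<Rightarrow> real)"
proof (rule smooth_openI_derivative[where S = "range (\<lambda>p x. poly p (inverse x))"])
  show "inverse \<in> range (\<lambda>p x::real. poly p (inverse x))"
    by (rule image_eqI[of _ _ "[:0, 1:]"]) auto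
next
  fix f :: "real \<Rightarrow> real" assume "f \<in> range (\<lambda>p x. poly p (inverse x))"
  then obtain p where f: "f = (\<lambda>x. poly p (inverse x))" by blast
  show "\<exists>f'. (\<forall>x\<in>{0<..}. (f has_derivative f' x) (at x)) \<and> (\<forall>v. (\<lambda>x. f' x v) \<in> range (\<lambda>p x. poly p (inverse x)))"
  proof (intro exI[of _ "\<lambda>x v. v * poly (- monom 1 2 * pderiv p) (inverse x)"] conjI ballI allI)
    fix x :: real assume "x \<in> {0<..}"
    then have "(f has_field_derivative poly (- monom 1 2 * pderiv p) (inverse x)) (at x)"
      unfolding f by (auto intro!: derivative_eq_intros poly_DERIV[THEN DERIV_chain2]
          simp: poly_monom power2_eq_square algebra_simps)
    then show "(f has_derivative (\<lambda>v. v * poly (- monom 1 2 * pderiv p) (inverse x))) (at x)"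
      unfolding has_field_derivative_def mult.commute[of _ "poly _ _"] .
  next
    show "(\<lambda>x. v * poly (- monom 1 2 * pderiv p) (inverse x)) \<in> range (\<lambda>p x. poly p (inverse x))" for v
      by (rule image_eqI[of _ _ "smult v (- monom 1 2 * pderiv p)"]) (simp_all del: mult_minus_left)
  qed
qed auto

lemma flat_1: "flat 1 x = 0 \<longleftrightarrow> x \<le> 0" "0 \<le> flat 1 x"
  by (auto simp: flat_def)

definition step :: "real \<Rightarrow> real" where
  "step x = flat 1 x * inverse (flat 1 x + flat 1 (1 - x))"

lemma step_denominator_pos: "flat 1 x + flat 1 (1 - x) > 0"
  using flat_1[of x] flat_1[of "1 - x"] by (smt (verit))

lemma smooth_open_step: "smooth_open UNIV step"
proof -
  have 1: "smooth_open UNIV (\<lambda>x::real. flat 1 (1 - x))"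
  proof (rule smooth_open_compose[OF smooth_open_flat])
    have "smooth_open UNIV (\<lambda>x::real. 1 + - x)"
      by (intro smooth_open_add smooth_open_const smooth_open_linear bounded_linear_minus bounded_linear_ident) auto
    then show "smooth_open UNIV (\<lambda>x::real. 1 - x)" by simp
  qed auto
  show ?thesis
    unfolding step_def
    by (rule smooth_open_mult[OF smooth_open_flat smooth_open_compose[OF smooth_open_inverse
          smooth_open_add[OF smooth_open_flat 1]]]) (use step_denominator_pos in auto)
qed

lemma step_bounds: "0 \<le> step x" "step x \<le> 1"
  using step_denominator_pos[of x] flat_1(2)[of x] flat_1(2)[of "1 - x"]
  by (auto simp: step_def field_simps)

lemma step_eq_0: "x \<le> 0 \<Longrightarrow> step x = 0" and step_eq_1: "1 \<le> x \<Longrightarrow> step x = 1"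
  using step_denominator_pos[of x] by (auto simp: step_def flat_def)

subsection \<open>Coordinate spaces and the exponential map of the torus\<close>

definition proj :: "'n::finite set \<Rightarrow> real ^ 'n \<Rightarrow> real ^ 'n" where
  "proj J x = (\<chi> i. if i \<in> J then x $ i else 0)"

lemma bounded_linear_proj: "bounded_linear (proj J)"
  by (intro linear_conv_bounded_linear[THEN iffD1] linearI) (auto simp: proj_def vec_eq_iff)

lemmas linear_proj = bounded_linear.linear[OF bounded_linear_proj]

lemma proj_in [simp]: "proj J x \<in> coord_space J"
  by (simp add: proj_def coord_space_def)

lemma proj_id [simp]: "x \<in> coord_space J \<Longrightarrow> proj J x = x"
  by (auto simp: proj_def coord_space_def vec_eq_iff)

lemma proj_eq_iff: "proj J x = x \<longleftrightarrow> x \<in> coord_space J"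
  using proj_id proj_in by metis

lemma subspace_coord_space: "subspace (coord_space J)"
  by (auto simp: subspace_def coord_space_def)

lemma open_proj_vimage:
  assumes "openin (top_of_set (coord_space J)) S" shows "open {x. proj J x \<in> S}"
proof -
  obtain T where "open T" "S = coord_space J \<inter> T" using assms openin_open by metis
  then have "{x. proj J x \<in> S} = proj J -` T" by auto
  then show ?thesis
    using open_vimage[OF \<open>open T\<close> bounded_linear.continuous_on[OF bounded_linear_proj continuous_on_id]]
    by simp
qed

lemma smooth_on_iff_smooth_open:
  assumes "openin (top_of_set (coord_space J)) S"
  shows "smooth_on S f \<longleftrightarrow> smooth_open {x. proj J x \<in> S} (\<lambda>x. f (proj J x))"
proof
  assume "smooth_on S f"
  then show "smooth_open {x. proj J x \<in> S} (\<lambda>x. f (proj J x))"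
    by (rule smooth_on_pullback) (auto intro!: smooth_open_linear open_proj_vimage assms bounded_linear_proj)
next
  assume R: "smooth_open {x. proj J x \<in> S} (\<lambda>x. f (proj J x))"
  have "S \<subseteq> coord_space J" using assms openin_imp_subset by blast
  then have "\<forall>x\<in>S. proj J x = x" by auto
  then show "smooth_on S f"
    unfolding smooth_on_def
    using R by (intro ballI exI[of _ "{x. proj J x \<in> S}"] exI[of _ "\<lambda>x. f (proj J x)"])
      (auto simp: smooth_open_def)
qed

lemma smooth_open_torus_exp: "smooth_open UNIV (torus_exp :: real ^ 'b::finite \<Rightarrow> _)"
proof -
  have "torus_exp = (\<lambda>\<xi>::real ^ 'b. \<Sum>i\<in>UNIV. axis i (cis (\<xi> $ i)))"
    by (rule ext) (simp add: torus_exp_def vec_eq_iff axis_def)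
  moreover have "smooth_open UNIV (\<lambda>\<xi>::real ^ 'b. axis i (cis (\<xi> $ i)))" for i
  proof (rule smooth_open_linear_comp[where L = "axis i"])
    show "bounded_linear (axis i :: complex \<Rightarrow> complex ^ 'b)"
      by (intro linear_conv_bounded_linear[THEN iffD1] linearI) (simp_all add: axis_def vec_eq_iff)
    show "smooth_open UNIV (\<lambda>\<xi>::real ^ 'b. cis (\<xi> $ i))"
      by (rule smooth_open_compose[OF smooth_open_cis smooth_open_linear[OF open_UNIV bounded_linear_vec_nth]]) simp
  qed
  then have "smooth_open UNIV (\<lambda>\<xi>::real ^ 'b. \<Sum>i\<in>UNIV. axis i (cis (\<xi> $ i)))"
    by (intro smooth_open_sum) simp_all
  ultimately show ?thesis by (simp only:)
qed

lemma torus_exp_add: "torus_exp (\<sigma> + \<tau>) = torus_exp \<sigma> * torus_exp \<tau>"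
  by (simp add: torus_exp_def vec_eq_iff cis_mult)

section \<open>Closed subgroups of Euclidean space\<close>

definition closed_subgroup :: "'a::euclidean_space set \<Rightarrow> bool" where
  "closed_subgroup L \<longleftrightarrow> closed L \<and> 0 \<in> L \<and> (\<forall>x\<in>L. \<forall>y\<in>L. x + y \<in> L) \<and> (\<forall>x\<in>L. - x \<in> L)"

text \<open>The largest linear subspace contained in \<open>L\<close>. If \<open>L\<close> is the preimage of a closed subgroup of a
  torus under the exponential map, it is the Lie algebra of that subgroup.\<close>

definition lineality :: "'a::euclidean_space set \<Rightarrow> 'a set" where
  "lineality L = {v. \<forall>t. t *\<^sub>R v \<in> L}"

lemma lineality_subset: "lineality L \<subseteq> L"
  by (auto simp: lineality_def dest: spec[of _ 1])

lemma subspace_lineality: "closed_subgroup L \<Longrightarrow> subspace (lineality L)"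
  by (auto simp: subspace_def lineality_def closed_subgroup_def scaleR_add_right)

lemma closed_subgroup_of_nat: "closed_subgroup L \<Longrightarrow> x \<in> L \<Longrightarrow> of_nat k *\<^sub>R x \<in> L"
  by (induction k) (auto simp: closed_subgroup_def scaleR_add_left)

lemma closed_subgroup_of_int:
  assumes "closed_subgroup L" "x \<in> L" shows "of_int k *\<^sub>R x \<in> L"
proof (cases k)
  case (nonneg n) then show ?thesis using closed_subgroup_of_nat[OF assms] by simp
next
  case (neg n)
  have "- (of_nat (Suc n) *\<^sub>R x) \<in> L"
    using closed_subgroup_of_nat[OF assms, of "Suc n"] assms(1) unfolding closed_subgroup_def by blast
  then show ?thesis using neg by (simp add: scaleR_minus_left[symmetric] del: scaleR_minus_left)
qed

text \<open>Otherwise there are elements of \<open>L\<close> orthogonal to the lineality space that tend to 0. Their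
  directions accumulate at a unit vector \<open>u\<close>, and integer multiples of them approximate every
  multiple of \<open>u\<close>; hence \<open>u\<close> is in the lineality space, to which it is orthogonal.\<close>

lemma closed_subgroup_near_0:
  fixes L :: "'a::euclidean_space set"
  assumes L: "closed_subgroup L"
  obtains \<epsilon> where "\<epsilon> > 0" "\<And>l. l \<in> L \<Longrightarrow> norm l < \<epsilon> \<Longrightarrow> l \<in> lineality L"
proof -
  let ?V = "lineality L"
  have sub: "subspace ?V" using subspace_lineality[OF L] .
  have "\<exists>\<epsilon>>0. \<forall>l\<in>L. norm l < \<epsilon> \<longrightarrow> l \<in> ?V"
  proof (rule ccontr)
    assume neg: "\<not> ?thesis"
    have "\<exists>l\<in>L. l \<noteq> 0 \<and> norm l < inverse (real (Suc n)) \<and> (\<forall>v\<in>?V. orthogonal l v)" for n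
    proof -
      obtain l where l: "l \<in> L" "norm l < inverse (real (Suc n))" "l \<notin> ?V"
        using neg by (metis inverse_positive_iff_positive of_nat_0_less_iff zero_less_Suc)
      obtain y z where yz: "y \<in> span ?V" "\<And>w. w \<in> span ?V \<Longrightarrow> orthogonal z w" "l = y + z"
        using orthogonal_subspace_decomp_exists[of ?V l] by blast
      have y: "y \<in> ?V" using yz(1) sub span_eq_iff by blast
      have "z = l + - y" using yz(3) by simp
      then have "z \<in> L"
        using L l(1) y lineality_subset[of L] unfolding closed_subgroup_def by blast
      moreover have "z \<noteq> 0" using yz(3) y l(3) by auto
      moreover have "norm z \<le> norm l"
      proof -
        have "orthogonal y z" using yz(1,2) orthogonal_commute by blast
        then have "norm l ^ 2 = norm y ^ 2 + norm z ^ 2"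
          using yz(3) norm_add_Pythagorean by blast
        then show ?thesis by (simp add: norm_le_square dot_square_norm)
      qed
      ultimately show ?thesis
        using yz(2) l(2) by (intro bexI[of _ z]) (auto intro: span_base)
    qed
    then obtain l where l: "\<And>n. l n \<in> L" "\<And>n. l n \<noteq> 0" "\<And>n. norm (l n) < inverse (real (Suc n))"
      "\<And>n v. v \<in> ?V \<Longrightarrow> orthogonal (l n) v"
      by metis
    define u where "u n = (1 / norm (l n)) *\<^sub>R l n" for n
    have "\<forall>n. u n \<in> sphere 0 1" using l(2) by (simp add: u_def)
    then obtain a r where ar: "a \<in> sphere 0 1" "strict_mono r" "(u \<circ> r) \<longlonglongrightarrow> a"
      using compact_sphere[of "0::'a" 1] unfolding compact_def by metis
    have l0: "(\<lambda>n. norm (l n)) \<longlonglongrightarrow> 0"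
      by (rule tendsto_sandwich[OF _ _ tendsto_const LIMSEQ_inverse_real_of_nat])
        (simp_all add: l(3)[THEN less_imp_le, simplified])
    have l0r: "(\<lambda>n. norm (l (r n))) \<longlonglongrightarrow> 0"
      using LIMSEQ_subseq_LIMSEQ[OF l0 ar(2)] unfolding o_def .
    have "a \<in> ?V"
      unfolding lineality_def
    proof (intro CollectI allI)
      fix t :: real
      define k where "k n = \<lfloor>t / norm (l (r n))\<rfloor>" for n
      have "(\<lambda>n. of_int (k n) * norm (l (r n))) \<longlonglongrightarrow> t"
      proof (rule LIM_zero_cancel, rule Lim_null_comparison[OF _ l0r], rule always_eventually, rule allI)
        fix n
        have p: "norm (l (r n)) > 0" using l(2) by simp
        have "of_int (k n) \<le> t / norm (l (r n))" "t / norm (l (r n)) < of_int (k n) + 1"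
          unfolding k_def by linarith+
        then have "of_int (k n) * norm (l (r n)) \<le> t" "t < (of_int (k n) + 1) * norm (l (r n))"
          using p by (simp_all add: field_simps)
        then show "norm (of_int (k n) * norm (l (r n)) - t) \<le> norm (l (r n))"
          by (simp add: algebra_simps)
      qed
      then have "(\<lambda>n. (of_int (k n) * norm (l (r n))) *\<^sub>R (u \<circ> r) n) \<longlonglongrightarrow> t *\<^sub>R a"
        using ar(3) by (rule tendsto_scaleR)
      moreover have "(of_int (k n) * norm (l (r n))) *\<^sub>R (u \<circ> r) n = of_int (k n) *\<^sub>R l (r n)" for n
        using l(2) by (simp add: u_def)
      ultimately have "(\<lambda>n. of_int (k n) *\<^sub>R l (r n)) \<longlonglongrightarrow> t *\<^sub>R a" by simp
      then show "t *\<^sub>R a \<in> L"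
        using closed_sequentially[of L "\<lambda>n. of_int (k n) *\<^sub>R l (r n)"] closed_subgroup_of_int[OF L l(1)] L
        by (simp add: closed_subgroup_def)
    qed
    then have "(u \<circ> r) n \<bullet> a = 0" for n
      using l(4) by (simp add: u_def orthogonal_def)
    then have "(\<lambda>n. 0) \<longlonglongrightarrow> a \<bullet> a"
      using tendsto_inner[OF ar(3) tendsto_const[of a]] by simp
    then have "a \<bullet> a = 0" using LIMSEQ_unique tendsto_const by blast
    then show False using ar(1) by simp
  qed
  then show thesis using that by blast
qed

text \<open>The kernel of the exponential map of the torus.\<close>

definition period_lattice :: "(real ^ 'n::finite) set" where
  "period_lattice = {x. \<forall>i. \<exists>k::int. x $ i = 2 * pi * of_int k}"

lemma countable_period_lattice: "countable (period_lattice :: (real ^ 'n::finite) set)"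
proof -
  have "period_lattice \<subseteq> range (\<lambda>k::'n \<Rightarrow> int. \<chi> i. 2 * pi * of_int (k i))"
  proof
    fix x :: "real ^ 'n" assume "x \<in> period_lattice"
    then obtain k where "\<And>i. x $ i = 2 * pi * of_int (k i :: int)"
      unfolding period_lattice_def by simp metis
    then have "x = (\<chi> i. 2 * pi * of_int (k i))" by (simp add: vec_eq_iff)
    then show "x \<in> range (\<lambda>k::'n \<Rightarrow> int. \<chi> i. 2 * pi * of_int (k i))" by blast
  qed
  moreover have "countable (UNIV :: ('n \<Rightarrow> int) set)"
    using countable_PiE[of "UNIV :: 'n set" "\<lambda>_. UNIV :: int set"] by (simp add: PiE_UNIV_domain)
  ultimately show ?thesis by (meson countable_subset countable_image)
qed

text \<open>By simultaneous Diophantine approximation, a vector of the lineality space has a multiple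
  that is arbitrarily close to the lattice; the small difference is in \<open>L\<close>, hence in the lineality
  space.\<close>

lemma lineality_rational:
  fixes L :: "(real ^ 'n::finite) set"
  assumes L: "closed_subgroup L" and "period_lattice \<subseteq> L"
  shows "lineality L = span (lineality L \<inter> period_lattice)"
proof
  let ?V = "lineality L"
  have sub: "subspace ?V" using subspace_lineality[OF L] .
  show "span (?V \<inter> period_lattice) \<subseteq> ?V"
    using sub by (simp add: span_minimal)
  obtain \<epsilon> where \<epsilon>: "\<epsilon> > 0" "\<And>l. l \<in> L \<Longrightarrow> norm l < \<epsilon> \<Longrightarrow> l \<in> ?V"
    using closed_subgroup_near_0[OF L] by blast
  obtain h :: "nat \<Rightarrow> 'n" where h: "bij_betw h {0..<CARD('n)} UNIV"
    using ex_bij_betw_nat_finite[of "UNIV :: 'n set"] by auto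
  show "?V \<subseteq> span (?V \<inter> period_lattice)"
  proof
    fix \<xi> assume \<xi>: "\<xi> \<in> ?V"
    have "\<exists>y\<in>span (?V \<inter> period_lattice). dist y \<xi> < e" if e: "e > 0" for e
    proof -
      define d where "d = min e \<epsilon>"
      have d: "d > 0" using e \<epsilon>(1) by (simp add: d_def)
      \<comment> \<open>With \<open>N\<close> this large, an error below \<open>2 \<pi> / N\<close> in every coordinate has norm below \<open>d\<close>.\<close>
      obtain N :: nat where N: "real N > 2 * pi * CARD('n) / d" using reals_Archimedean2 by blast
      have Npos: "real N > 0" using N d by (smt (verit) divide_nonneg_pos mult_nonneg_nonneg of_nat_0_le_iff pi_ge_zero)
      obtain q p where q: "0 < q"
        and p: "\<And>i. i < CARD('n) \<Longrightarrow> \<bar>of_int q * (\<xi> $ h i / (2 * pi)) - of_int (p i)\<bar> < 1 / real N"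
        using Dirichlet_approx_simult[of N "CARD('n)" "\<lambda>i. \<xi> $ h i / (2 * pi)"] Npos
        by (metis of_nat_0_less_iff)
      define g where "g = the_inv_into {0..<CARD('n)} h"
      have g: "g i < CARD('n)" "h (g i) = i" for i
        using h unfolding g_def bij_betw_def
        by (metis UNIV_I atLeastLessThan_iff order_refl the_inv_into_into,
            metis UNIV_I f_the_inv_into_f)
      define z :: "real ^ 'n" where "z = (\<chi> i. 2 * pi * of_int (p (g i)))"
      have z: "z \<in> period_lattice" by (auto simp: z_def period_lattice_def)
      define \<delta> where "\<delta> = of_int q *\<^sub>R \<xi> + - z"
      have comp: "\<bar>\<delta> $ i\<bar> \<le> 2 * pi / real N" for i
      proof -
        have "\<delta> $ i = 2 * pi * (of_int q * (\<xi> $ i / (2 * pi)) - of_int (p (g i)))"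
          by (simp add: \<delta>_def z_def algebra_simps)
        then have "\<bar>\<delta> $ i\<bar> = 2 * pi * \<bar>of_int q * (\<xi> $ i / (2 * pi)) - of_int (p (g i))\<bar>"
          by (simp add: abs_mult)
        also have "\<dots> \<le> 2 * pi * (1 / real N)"
          using p[OF g(1)[of i]] g(2)[of i] by (intro mult_left_mono) auto
        finally show ?thesis by simp
      qed
      have "norm \<delta> \<le> (\<Sum>i\<in>UNIV. \<bar>\<delta> $ i\<bar>)" by (rule norm_le_l1_cart)
      also have "\<dots> \<le> CARD('n) * (2 * pi / real N)" using sum_bounded_above[OF comp] by simp
      also have "\<dots> < d" using N d Npos by (simp add: field_simps)
      finally have small: "norm \<delta> < d" .
      have q\<xi>: "of_int q *\<^sub>R \<xi> \<in> ?V" using \<xi> sub by (simp add: subspace_scale)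
      have "\<delta> \<in> L"
        using q\<xi> lineality_subset[of L] z assms(2) L unfolding \<delta>_def closed_subgroup_def by blast
      then have "\<delta> \<in> ?V" using small \<epsilon>(2) d_def by simp
      then have "z \<in> ?V"
        using subspace_diff[OF sub q\<xi>, of \<delta>] by (simp add: \<delta>_def)
      then have "(1 / of_int q) *\<^sub>R z \<in> span (?V \<inter> period_lattice)"
        using z by (intro span_scale span_base) auto
      moreover have "dist ((1 / of_int q) *\<^sub>R z) \<xi> < e"
      proof -
        have "(1 / of_int q) *\<^sub>R z - \<xi> = (- 1 / of_int q) *\<^sub>R \<delta>"
          using q by (simp add: \<delta>_def algebra_simps)
        then have "dist ((1 / of_int q) *\<^sub>R z) \<xi> = norm \<delta> / of_int q"
          using q by (simp add: dist_norm)
        also have "\<dots> \<le> norm \<delta>" using q mult_right_mono[of 1 "of_int q" "norm \<delta>"] by (simp add: field_simps)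
        finally show ?thesis using small d_def by simp
      qed
      ultimately show ?thesis by blast
    qed
    then have "\<xi> \<in> closure (span (?V \<inter> period_lattice))"
      unfolding closure_approachable by blast
    then show "\<xi> \<in> span (?V \<inter> period_lattice)"
      using closure_closed[OF closed_subspace[OF subspace_span]] by blast
  qed
qed

section \<open>Removing subspaces of codimension two\<close>

lemma proper_subspace_complement_dense:
  fixes F :: "'a::euclidean_space set"
  assumes "subspace F" "subspace P" "P \<subset> F"
  shows "F \<subseteq> closure (F - P)"
proof
  fix x assume x: "x \<in> F"
  obtain w where w: "w \<in> F" "w \<notin> P" using assms(3) by blast
  show "x \<in> closure (F - P)"
  proof (cases "x \<in> P")
    case False then show ?thesis using x closure_subset by blast
  next
    case True
    have "x + inverse (real (Suc n)) *\<^sub>R w \<in> F - P" for n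
    proof
      show "x + inverse (real (Suc n)) *\<^sub>R w \<in> F"
        by (rule subspace_add[OF assms(1) x subspace_scale[OF assms(1) w(1)]])
      show "x + inverse (real (Suc n)) *\<^sub>R w \<notin> P"
      proof
        assume "x + inverse (real (Suc n)) *\<^sub>R w \<in> P"
        then have "inverse (real (Suc n)) *\<^sub>R w \<in> P"
          using subspace_diff[OF assms(2) _ True] by (metis add_diff_cancel_left')
        then have "real (Suc n) *\<^sub>R (inverse (real (Suc n)) *\<^sub>R w) \<in> P"
          using assms(2) subspace_scale by blast
        then show False using w(2) by (simp del: of_nat_Suc)
      qed
    qed
    moreover have "(\<lambda>n. x + inverse (real (Suc n)) *\<^sub>R w) \<longlonglongrightarrow> x + 0 *\<^sub>R w"
      by (intro tendsto_add tendsto_scaleR tendsto_const LIMSEQ_inverse_real_of_nat)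
    ultimately show ?thesis
      unfolding closure_sequential by (intro exI[of _ "\<lambda>n. x + inverse (real (Suc n)) *\<^sub>R w"]) simp
  qed
qed

text \<open>Baire's theorem, applied within the closed set \<open>F\<close>, allows for countably many subspaces.\<close>

lemma subspaces_complement_dense:
  fixes F :: "'a::euclidean_space set"
  assumes F: "subspace F" and "countable Q" and Q: "\<And>P. P \<in> Q \<Longrightarrow> subspace P \<and> P \<subset> F"
  shows "ball 0 r \<inter> F \<subseteq> closure (ball 0 r \<inter> F - \<Union>Q)"
proof -
  have "F \<subseteq> closure (\<Inter>((\<lambda>P. F - P) ` Q))"
  proof (rule Baire)
    show "closed F" using F closed_subspace by blast
    fix T assume "T \<in> (\<lambda>P. F - P) ` Q"
    then obtain P where P: "P \<in> Q" "T = F - P" by blast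
    have "closed P" using Q[OF P(1)] closed_subspace by blast
    then have "openin (top_of_set F) (F - P)"
      by (metis Diff_Int2 Int_commute closed_closedin closedin_closed_Int inf.idem openin_diff openin_topspace topspace_euclidean_subtopology)
    then show "openin (top_of_set F) T \<and> F \<subseteq> closure T"
      using proper_subspace_complement_dense[OF F] Q[OF P(1)] P(2) by blast
  qed (use assms(2) in auto)
  then have "ball 0 r \<inter> F \<subseteq> ball 0 r \<inter> closure (\<Inter>((\<lambda>P. F - P) ` Q) \<inter> F)"
    using closure_mono by (cases "Q = {}") (auto intro: closure_subset[THEN subsetD] simp: Int_absorb2 INF_lower2)
  also have "\<dots> \<subseteq> closure (ball 0 r \<inter> (\<Inter>((\<lambda>P. F - P) ` Q) \<inter> F))"
    by (intro open_Int_closure_subset) auto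
  also have "\<dots> \<subseteq> closure (ball 0 r \<inter> F - \<Union>Q)"
    by (intro closure_mono) auto
  finally show ?thesis .
qed

text \<open>Any two points of the complement are joined by a broken line through a third point that
  avoids the countably many proper subspaces spanned by one of the removed subspaces and one of
  the two points.\<close>

lemma connected_complement_codim2:
  fixes F :: "'a::euclidean_space set"
  assumes F: "subspace F" and cQ: "countable Q" and Q: "\<And>P. P \<in> Q \<Longrightarrow> subspace P \<and> P \<subset> F"
    and codim: "\<And>P y. P \<in> Q \<Longrightarrow> y \<in> F - P \<Longrightarrow> span (insert y P) \<noteq> F"
  shows "connected (ball 0 r \<inter> F - \<Union>Q)"
proof -
  let ?S = "ball 0 r \<inter> F - \<Union>Q"
  have cvx: "convex (ball 0 r \<inter> F)" by (intro convex_Int convex_ball subspace_imp_convex F)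
  have seg: "closed_segment y w \<subseteq> ?S"
    if y: "y \<in> ?S" and w: "w \<in> ?S" and gen: "\<And>P. P \<in> Q \<Longrightarrow> w \<notin> span (insert y P)" for y w
  proof
    fix v assume v: "v \<in> closed_segment y w"
    then have "v \<in> ball 0 r \<inter> F"
      using cvx y w closed_segment_subset[of y "ball 0 r \<inter> F" w] by blast
    moreover have "v \<notin> P" if P: "P \<in> Q" for P
    proof
      assume vP: "v \<in> P"
      obtain s where s: "v = (1 - s) *\<^sub>R y + s *\<^sub>R w" using v by (auto simp: in_segment)
      have "s \<noteq> 0" using s vP y P by auto
      then have "w = (1 / s) *\<^sub>R (v - (1 - s) *\<^sub>R y)" using s by simp
      moreover have "(1 / s) *\<^sub>R (v - (1 - s) *\<^sub>R y) \<in> span (insert y P)"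
        using vP by (intro span_scale span_diff) (auto intro: span_base)
      ultimately show False using gen[OF P] by simp
    qed
    ultimately show "v \<in> ?S" by blast
  qed
  show ?thesis
    unfolding connected_iff_connected_component
  proof (intro ballI)
    fix x y assume x: "x \<in> ?S" and y: "y \<in> ?S"
    define Q' where "Q' = Q \<union> (\<lambda>P. span (insert x P)) ` Q \<union> (\<lambda>P. span (insert y P)) ` Q"
    have sp: "subspace (span (insert z P)) \<and> span (insert z P) \<subset> F" if "P \<in> Q" "z \<in> ?S" for z P
    proof -
      have "insert z P \<subseteq> F" using that Q by blast
      then have "span (insert z P) \<subseteq> F" using F by (simp add: span_minimal)
      moreover have "span (insert z P) \<noteq> F" using codim[of P z] that by blast
      ultimately show ?thesis by auto
    qed
    have "ball 0 r \<inter> F \<subseteq> closure (ball 0 r \<inter> F - \<Union>Q')"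
    proof (rule subspaces_complement_dense[OF F])
      show "countable Q'" using cQ by (simp add: Q'_def)
      show "subspace P \<and> P \<subset> F" if "P \<in> Q'" for P
        using that Q sp x y unfolding Q'_def by blast
    qed
    moreover have "x \<in> ball 0 r \<inter> F" using x by blast
    ultimately have "ball 0 r \<inter> F - \<Union>Q' \<noteq> {}" by (metis closure_empty empty_iff subsetD)
    then obtain w where w: "w \<in> ball 0 r \<inter> F - \<Union>Q'" by blast
    have wS: "w \<in> ?S" using w by (auto simp: Q'_def)
    have "closed_segment x w \<subseteq> ?S" "closed_segment y w \<subseteq> ?S"
      by (rule seg[OF x wS], use w in \<open>simp add: Q'_def\<close>) (rule seg[OF y wS], use w in \<open>simp add: Q'_def\<close>)
    then have "connected_component ?S x w" "connected_component ?S w y"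
      unfolding connected_component_def
      by (metis connected_segment ends_in_segment, metis connected_segment ends_in_segment)
    then show "connected_component ?S x y" by (rule connected_component_trans)
  qed
qed

section \<open>Averages over a period\<close>

lemma integral_periodic_shift:
  fixes q :: "real \<Rightarrow> 'b::euclidean_space"
  assumes cont: "continuous_on UNIV q" and per: "\<And>u. q (u + 1) = q u"
  shows "integral {0..1} (\<lambda>u. q (u + t)) = integral {0..1} q"
proof -
  have per_nat: "q (u + of_nat n) = q u" for u n
    by (induction n) (use per in \<open>simp_all add: add.assoc[symmetric] add.commute[of 1]\<close>)
  have per_int: "q (u + of_int n) = q u" for u n
    using per_nat[of u "nat n"] per_nat[of "u + of_int n" "nat (- n)"] by (cases "n \<ge> 0") auto
  have int: "q integrable_on {a..b}" for a b
    using cont continuous_on_subset integrable_continuous_interval by blast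
  have shift: "integral {a..b} (\<lambda>u. q (u + c)) = integral {a + c..b + c} q" for a b c
    using integral_shift[of a c b q] cont continuous_on_subset by (auto simp: o_def)
  define s where "s = frac t"
  have s: "0 \<le> s" "s < 1" by (auto simp: s_def frac_lt_1)
  have "q (u + t) = q (u + s)" for u
    using per_int[of "u + s" "\<lfloor>t\<rfloor>"] by (simp add: s_def frac_def)
  then have "integral {0..1} (\<lambda>u. q (u + t)) = integral {s..1 + s} q"
    using shift[of 0 1 s] by simp
  also have "\<dots> = integral {s..1} q + integral {1..1 + s} q"
    using s int by (simp add: Henstock_Kurzweil_Integration.integral_combine)
  also have "integral {1..1 + s} q = integral {0..s} q"
    using shift[of 0 s 1] per by (simp add: add.commute)
  also have "integral {s..1} q + integral {0..s} q = integral {0..1} q"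
    using s int Henstock_Kurzweil_Integration.integral_combine[of 0 s 1 q] by (simp add: add.commute)
  finally show ?thesis .
qed

section \<open>Smooth torus actions in charts\<close>

lemma bounded_linear_pair_fst: "bounded_linear f \<Longrightarrow> bounded_linear (\<lambda>p. f (fst p))"
  by (rule bounded_linear_compose[OF _ bounded_linear_fst])

lemma bounded_linear_pair_snd: "bounded_linear f \<Longrightarrow> bounded_linear (\<lambda>p. f (snd p))"
  by (rule bounded_linear_compose[OF _ bounded_linear_snd])

locale torus_manifold =
  fixes M :: "'m topology"
    and \<C> :: "('m, 'd::finite) chart set"
    and I :: "'n::finite set"
    and \<rho> :: "complex ^ 'n \<Rightarrow> 'm \<Rightarrow> 'm"
  assumes manifold: "smooth_manifold M \<C>"
    and action: "smooth_torus_action M \<C> I \<rho>"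
begin

lemma Hausdorff: "Hausdorff_space M" and second_countable: "second_countable M"
  using manifold by (simp_all add: smooth_manifold_def)

text \<open>The action of the Lie algebra through the exponential map. Letting the coordinates outside \<open>I\<close>
  act trivially makes it an action of the whole vector space \<open>real ^ 'n\<close>, so that stabilizers are
  closed subgroups of Euclidean space.\<close>

definition act :: "real ^ 'n \<Rightarrow> 'm \<Rightarrow> 'm" where
  "act \<sigma> y = \<rho> (torus_exp (proj I \<sigma>)) y"

lemma torus_exp_proj_in: "torus_exp (proj I \<sigma>) \<in> carrier (torus I)"
  by (simp add: torus_def torus_exp_def proj_def)

lemma torus_exp_proj_surj:
  assumes "g \<in> carrier (torus I)" obtains \<sigma> where "g = torus_exp (proj I \<sigma>)"
proof
  have "g $ i = cis (if i \<in> I then Arg (g $ i) else 0)" for i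
    using assms by (auto simp: torus_def cis_Arg_unique split: if_splits)
      (metis cis_Arg div_by_1 norm_eq_zero of_real_1 sgn_eq zero_neq_one)
  moreover have "torus_exp (proj I (\<chi> i. Arg (g $ i))) $ i = cis (if i \<in> I then Arg (g $ i) else 0)" for i
    by (simp add: torus_exp_def proj_def)
  ultimately show "g = torus_exp (proj I (\<chi> i. Arg (g $ i)))"
    unfolding vec_eq_iff by presburger
qed

lemma group_action: "group_action (torus I) (topspace M) \<rho>"
  using action by (simp add: smooth_torus_action_def)

lemma act_in [simp]: "y \<in> topspace M \<Longrightarrow> act \<sigma> y \<in> topspace M"
  unfolding act_def using group_action.element_image[OF group_action torus_exp_proj_in] by blast

lemma act_add: "y \<in> topspace M \<Longrightarrow> act (\<sigma> + \<tau>) y = act \<sigma> (act \<tau> y)"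
proof -
  assume y: "y \<in> topspace M"
  have "torus_exp (proj I (\<sigma> + \<tau>)) = torus_exp (proj I \<sigma>) \<otimes>\<^bsub>torus I\<^esub> torus_exp (proj I \<tau>)"
    by (simp add: linear_add[OF linear_proj] torus_exp_add) (simp add: torus_def)
  then show ?thesis
    unfolding act_def
    using group_action.composition_rule[OF group_action y torus_exp_proj_in torus_exp_proj_in] by simp
qed

lemma act_period:
  assumes "z \<in> period_lattice" "y \<in> topspace M" shows "act z y = y"
proof -
  have "torus_exp (proj I z) $ i = 1" for i
  proof -
    obtain k :: int where k: "z $ i = 2 * pi * of_int k"
      using assms(1) by (auto simp: period_lattice_def)
    then show ?thesis by (simp add: torus_exp_def proj_def cis_multiple_2pi)
  qed
  then have "torus_exp (proj I z) = \<one>\<^bsub>torus I\<^esub>"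
    by (simp add: torus_def vec_eq_iff)
  then show ?thesis
    using group_action.id_eq_one[OF group_action] assms(2) unfolding act_def
    by (metis restrict_apply')
qed

lemma act_0 [simp]: "y \<in> topspace M \<Longrightarrow> act 0 y = y"
  by (rule act_period) (auto simp: period_lattice_def intro: exI[of _ 0])

lemma act_uminus [simp]:
  assumes "y \<in> topspace M" shows "act (- \<sigma>) (act \<sigma> y) = y" "act \<sigma> (act (- \<sigma>) y) = y"
  using assms act_add[of y "- \<sigma>" \<sigma>] act_add[of y \<sigma> "- \<sigma>"] by simp_all

lemma act_commute: "y \<in> topspace M \<Longrightarrow> act \<sigma> (act \<tau> y) = act \<tau> (act \<sigma> y)"
  by (metis act_add add.commute)

lemma continuous_act: "continuous_map (prod_topology euclidean M) M (\<lambda>(\<sigma>, y). act \<sigma> y)"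
proof -
  have "continuous_map euclidean (top_of_set (carrier (torus I))) (\<lambda>\<sigma>. torus_exp (proj I \<sigma>))"
    unfolding continuous_map_in_subtopology
  proof
    show "continuous_map euclidean euclidean (\<lambda>\<sigma>. torus_exp (proj I \<sigma>))"
      using smooth_open_compose[OF smooth_open_torus_exp smooth_open_linear[OF open_UNIV bounded_linear_proj]]
        smooth_open_continuous_on by auto
  qed (use torus_exp_proj_in in auto)
  then have "continuous_map (prod_topology euclidean M) (prod_topology (top_of_set (carrier (torus I))) M)
      (\<lambda>p. (torus_exp (proj I (fst p)), snd p))"
    by (intro continuous_map_pairedI continuous_map_snd continuous_map_compose[OF continuous_map_fst, unfolded o_def])
  moreover have "continuous_map (prod_topology (top_of_set (carrier (torus I))) M) M (\<lambda>(g, m). \<rho> g m)"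
    using action by (simp add: smooth_torus_action_def)
  ultimately have "continuous_map (prod_topology euclidean M) M
      ((\<lambda>(g, m). \<rho> g m) \<circ> (\<lambda>p. (torus_exp (proj I (fst p)), snd p)))"
    by (rule continuous_map_compose)
  then show ?thesis by (simp add: act_def o_def case_prod_unfold)
qed

lemma continuous_act_right: "continuous_map M M (act \<sigma>)"
proof -
  have "continuous_map M (prod_topology euclidean M) (\<lambda>y. (\<sigma>, y))"
    by (simp add: continuous_map_pairedI)
  from continuous_map_compose[OF this continuous_act] show ?thesis by (simp add: o_def)
qed

lemma continuous_act_left: "y \<in> topspace M \<Longrightarrow> continuous_map euclidean M (\<lambda>\<sigma>. act \<sigma> y)"
proof -
  assume "y \<in> topspace M"
  then have "continuous_map euclidean (prod_topology euclidean M) (\<lambda>\<sigma>. (\<sigma>, y))"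
    by (simp add: continuous_map_pairedI)
  from continuous_map_compose[OF this continuous_act] show ?thesis by (simp add: o_def)
qed

lemma openin_act_image:
  assumes "openin M U" shows "openin M (act \<sigma> ` U)"
proof -
  have U: "U \<subseteq> topspace M" using assms openin_subset by blast
  have "act \<sigma> ` U = {y \<in> topspace M. act (- \<sigma>) y \<in> U}"
    using U by (auto simp: image_iff) (metis act_uminus(2))
  then show ?thesis
    using openin_continuous_map_preimage[OF continuous_act_right[of "- \<sigma>"] assms] by simp
qed

text \<open>The projection along a compact set of group elements is a closed map, so that conditions that
  are closed (open) for each of these elements are closed (open) when one (all) of them has to satisfy
  them.\<close>

lemma closedin_act_exists:
  assumes "compact K" "closedin M S" shows "closedin M {y \<in> topspace M. \<exists>\<sigma>\<in>K. act \<sigma> y \<in> S}"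
proof -
  have "closedin (prod_topology (top_of_set K) M) {p \<in> topspace (prod_topology (top_of_set K) M). (\<lambda>(\<sigma>, y). act \<sigma> y) p \<in> S}"
  proof (rule closedin_continuous_map_preimage[OF _ assms(2)])
    have "continuous_map (prod_topology (top_of_set K) M) (prod_topology euclidean M) (\<lambda>p. p)"
      by (metis continuous_map_from_subtopology continuous_map_id id_apply prod_topology_subtopology(1)
          continuous_map_eq)
    from continuous_map_compose[OF this continuous_act]
    show "continuous_map (prod_topology (top_of_set K) M) M (\<lambda>(\<sigma>, y). act \<sigma> y)" by (simp add: o_def)
  qed
  moreover have "closed_map (prod_topology (top_of_set K) M) M snd"
    using assms(1) by (intro closed_map_snd) (simp add: compact_space_subtopology)
  ultimately have "closedin M (snd ` {p \<in> topspace (prod_topology (top_of_set K) M). (\<lambda>(\<sigma>, y). act \<sigma> y) p \<in> S})"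
    by (simp add: closed_map_def)
  moreover have "snd ` {p \<in> topspace (prod_topology (top_of_set K) M). (\<lambda>(\<sigma>, y). act \<sigma> y) p \<in> S}
      = {y \<in> topspace M. \<exists>\<sigma>\<in>K. act \<sigma> y \<in> S}"
    by (auto simp: image_iff)
  ultimately show ?thesis by simp
qed

lemma openin_act_forall:
  assumes "compact K" "openin M U" shows "openin M {y \<in> topspace M. \<forall>\<sigma>\<in>K. act \<sigma> y \<in> U}"
proof -
  have "closedin M {y \<in> topspace M. \<exists>\<sigma>\<in>K. act \<sigma> y \<in> topspace M - U}"
    using assms by (intro closedin_act_exists) auto
  then have "openin M (topspace M - {y \<in> topspace M. \<exists>\<sigma>\<in>K. act \<sigma> y \<in> topspace M - U})"
    by blast
  moreover have "topspace M - {y \<in> topspace M. \<exists>\<sigma>\<in>K. act \<sigma> y \<in> topspace M - U} =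
      {y \<in> topspace M. \<forall>\<sigma>\<in>K. act \<sigma> y \<in> U}" by auto
  ultimately show ?thesis by simp
qed

lemma openin_act_free:
  assumes "compact K" shows "openin M {y \<in> topspace M. \<forall>\<sigma>\<in>K. act \<sigma> y \<noteq> y}"
proof -
  let ?X = "prod_topology (top_of_set K) M"
  have cont: "continuous_map ?X M (\<lambda>(\<sigma>, y). act \<sigma> y)"
  proof -
    have "continuous_map ?X (prod_topology euclidean M) (\<lambda>p. p)"
      by (metis continuous_map_from_subtopology continuous_map_id id_apply prod_topology_subtopology(1)
          continuous_map_eq)
    from continuous_map_compose[OF this continuous_act] show ?thesis by (simp add: o_def)
  qed
  have "closedin ?X {p \<in> topspace ?X. (\<lambda>(\<sigma>, y). act \<sigma> y) p = snd p}"
    by (rule closedin_continuous_maps_eq[OF Hausdorff cont continuous_map_snd])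
  moreover have "closed_map ?X M snd"
    using assms(1) by (intro closed_map_snd) (simp add: compact_space_subtopology)
  ultimately have "closedin M (snd ` {p \<in> topspace ?X. (\<lambda>(\<sigma>, y). act \<sigma> y) p = snd p})"
    by (simp add: closed_map_def)
  then have "openin M (topspace M - snd ` {p \<in> topspace ?X. (\<lambda>(\<sigma>, y). act \<sigma> y) p = snd p})" by blast
  moreover have "topspace M - snd ` {p \<in> topspace ?X. (\<lambda>(\<sigma>, y). act \<sigma> y) p = snd p}
    = {y \<in> topspace M. \<forall>\<sigma>\<in>K. act \<sigma> y \<noteq> y}"
    by (auto simp: image_iff)
  ultimately show ?thesis by simp
qed

subsection \<open>Charts\<close>

text \<open>A chart with values in \<open>coord_space J\<close> is used through its inverse \<open>param U \<phi> J\<close>, precomposed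
  with the projection to \<open>coord_space J\<close>. It is defined on an open subset of the ambient space,
  so that smoothness can be expressed by derivatives in all directions.\<close>

definition chart :: "'m set \<Rightarrow> ('m \<Rightarrow> real ^ 'd) \<Rightarrow> 'd set \<Rightarrow> bool" where
  "chart U \<phi> J \<longleftrightarrow> (U, \<phi>) \<in> \<C> \<and> openin (top_of_set (coord_space J)) (\<phi> ` U)"

definition pdom :: "'m set \<Rightarrow> ('m \<Rightarrow> real ^ 'd) \<Rightarrow> 'd set \<Rightarrow> (real ^ 'd) set" where
  "pdom U \<phi> J = {x. proj J x \<in> \<phi> ` U}"

definition param :: "'m set \<Rightarrow> ('m \<Rightarrow> real ^ 'd) \<Rightarrow> 'd set \<Rightarrow> real ^ 'd \<Rightarrow> 'm" where
  "param U \<phi> J x = inv_into U \<phi> (proj J x)"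

lemma chart_ex: "(U, \<phi>) \<in> \<C> \<Longrightarrow> \<exists>J. chart U \<phi> J"
  using manifold unfolding smooth_manifold_def chart_def is_chart_def by fastforce

lemma chart_at: "y \<in> topspace M \<Longrightarrow> \<exists>U \<phi> J. chart U \<phi> J \<and> y \<in> U"
proof -
  assume "y \<in> topspace M"
  then have "y \<in> (\<Union>(U, \<phi>)\<in>\<C>. U)" using manifold by (simp add: smooth_manifold_def)
  then obtain U \<phi> where "(U, \<phi>) \<in> \<C>" "y \<in> U" by auto
  then show ?thesis using chart_ex by blast
qed

context
  fixes U \<phi> J assumes ch: "chart U \<phi> J"
begin

lemma chart_is_chart: "openin M U" "homeomorphic_map (subtopology M U) (top_of_set (\<phi> ` U)) \<phi>"
  using ch manifold unfolding smooth_manifold_def chart_def is_chart_def by fastforce+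

lemma chart_subset: "U \<subseteq> topspace M"
  using chart_is_chart(1) openin_subset by blast

lemma chart_inj: "inj_on \<phi> U"
  using chart_is_chart(2) chart_subset unfolding homeomorphic_eq_everything_map by (simp add: Int_absorb1)

lemma chart_coord [simp]: "y \<in> U \<Longrightarrow> \<phi> y \<in> coord_space J"
  using ch openin_imp_subset unfolding chart_def by blast

lemma chart_pdom [simp]: "y \<in> U \<Longrightarrow> \<phi> y \<in> pdom U \<phi> J"
  by (simp add: pdom_def)

lemma open_pdom: "open (pdom U \<phi> J)"
  using ch unfolding pdom_def chart_def by (intro open_proj_vimage) auto

lemma param_chart [simp]: "y \<in> U \<Longrightarrow> param U \<phi> J (\<phi> y) = y"
  by (simp add: param_def chart_inj)

lemma param_in [simp]: "x \<in> pdom U \<phi> J \<Longrightarrow> param U \<phi> J x \<in> U"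
  by (simp add: param_def pdom_def inv_into_into)

lemma param_in_topspace [simp]: "x \<in> pdom U \<phi> J \<Longrightarrow> param U \<phi> J x \<in> topspace M"
  using param_in chart_subset by blast

lemma chart_param [simp]: "x \<in> pdom U \<phi> J \<Longrightarrow> \<phi> (param U \<phi> J x) = proj J x"
  by (simp add: param_def pdom_def f_inv_into_f)

lemma param_proj [simp]: "param U \<phi> J (proj J x) = param U \<phi> J x"
  by (simp add: param_def)

lemma continuous_chart: "continuous_map (subtopology M U) euclidean \<phi>"
  using chart_is_chart(2) homeomorphic_imp_continuous_map continuous_map_in_subtopology by blast

lemma continuous_param: "continuous_map (top_of_set (pdom U \<phi> J)) M (param U \<phi> J)"
proof -
  obtain g where g: "homeomorphic_maps (subtopology M U) (top_of_set (\<phi> ` U)) \<phi> g"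
    using chart_is_chart(2) homeomorphic_map_maps by blast
  then have cg: "continuous_map (top_of_set (\<phi> ` U)) (subtopology M U) g"
    and inv: "\<And>y. y \<in> U \<Longrightarrow> g (\<phi> y) = y"
    using chart_subset by (auto simp: homeomorphic_maps_def)
  have "continuous_map (top_of_set (pdom U \<phi> J)) (top_of_set (\<phi> ` U)) (proj J)"
    using bounded_linear.continuous_on[OF bounded_linear_proj continuous_on_id]
    by (auto simp: continuous_map_in_subtopology pdom_def)
  from continuous_map_compose[OF this cg]
  have "continuous_map (top_of_set (pdom U \<phi> J)) M (g \<circ> proj J)"
    using continuous_map_in_subtopology by blast
  then show ?thesis
  proof (rule continuous_map_eq)
    fix x assume "x \<in> topspace (top_of_set (pdom U \<phi> J))"
    then obtain y where "y \<in> U" "proj J x = \<phi> y" by (auto simp: pdom_def)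
    then show "(g \<circ> proj J) x = param U \<phi> J x"
      using inv chart_inj by (simp add: param_def)
  qed
qed

lemma open_param_vimage:
  assumes "openin M W" shows "open {x \<in> pdom U \<phi> J. param U \<phi> J x \<in> W}"
  using openin_continuous_map_preimage[OF continuous_param assms] open_pdom
  by (simp add: openin_open_eq)

lemma openin_chart_vimage:
  assumes "open S" shows "openin M {y \<in> U. \<phi> y \<in> S}"
proof -
  have "openin (subtopology M U) {y \<in> topspace (subtopology M U). \<phi> y \<in> S}"
    using openin_continuous_map_preimage[OF continuous_chart] assms by auto
  then show ?thesis
    using chart_subset chart_is_chart(1) by (simp add: Int_absorb1 openin_open_subtopology)
qed

end

lemma smooth_function_iff:
  "smooth_function \<C> f \<longleftrightarrow> (\<forall>U \<phi> J. chart U \<phi> J \<longrightarrow> smooth_open (pdom U \<phi> J) (\<lambda>x. f (param U \<phi> J x)))"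
proof -
  have *: "smooth_on (\<phi> ` U) (f \<circ> inv_into U \<phi>) \<longleftrightarrow> smooth_open (pdom U \<phi> J) (\<lambda>x. f (param U \<phi> J x))"
    if "chart U \<phi> J" for U \<phi> J
    using that smooth_on_iff_smooth_open[of J "\<phi> ` U" "f \<circ> inv_into U \<phi>"]
    by (simp add: chart_def pdom_def param_def)
  show ?thesis
    unfolding smooth_function_def
  proof safe
    fix U \<phi> J assume "\<forall>(U, \<phi>)\<in>\<C>. smooth_on (\<phi> ` U) (f \<circ> inv_into U \<phi>)" "chart U \<phi> J"
    then show "smooth_open (pdom U \<phi> J) (\<lambda>x. f (param U \<phi> J x))" using * by (auto simp: chart_def)
  next
    fix U \<phi> assume "\<forall>U \<phi> J. chart U \<phi> J \<longrightarrow> smooth_open (pdom U \<phi> J) (\<lambda>x. f (param U \<phi> J x))" "(U, \<phi>) \<in> \<C>"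
    then show "smooth_on (\<phi> ` U) (f \<circ> inv_into U \<phi>)" using * chart_ex by blast
  qed
qed

lemma open_act_dom:
  assumes "chart U \<phi> J" "openin M W"
  shows "open {p. snd p \<in> pdom U \<phi> J \<and> act (fst p) (param U \<phi> J (snd p)) \<in> W}"
proof -
  have "continuous_map (prod_topology euclidean (top_of_set (pdom U \<phi> J))) (prod_topology euclidean M)
      (\<lambda>p. (fst p, param U \<phi> J (snd p)))"
    by (intro continuous_map_pairedI continuous_map_fst
        continuous_map_compose[OF continuous_map_snd continuous_param[OF assms(1)], unfolded o_def])
  from continuous_map_compose[OF this continuous_act]
  have "continuous_map (top_of_set (UNIV \<times> pdom U \<phi> J)) M (\<lambda>p. act (fst p) (param U \<phi> J (snd p)))"
    using prod_topology_subtopology_eu[of "UNIV :: (real ^ 'n) set" "pdom U \<phi> J"] by (simp add: o_def)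
  from openin_continuous_map_preimage[OF this assms(2)]
  have "open {p \<in> UNIV \<times> pdom U \<phi> J. act (fst p) (param U \<phi> J (snd p)) \<in> W}"
    using openin_open_trans[OF _ open_Times[OF open_UNIV open_pdom[OF assms(1)]]] by (simp add: Int_def)
  moreover have "{p \<in> UNIV \<times> pdom U \<phi> J. act (fst p) (param U \<phi> J (snd p)) \<in> W} =
      {p. snd p \<in> pdom U \<phi> J \<and> act (fst p) (param U \<phi> J (snd p)) \<in> W}" by auto
  ultimately show ?thesis by (simp only:)
qed

lemma smooth_act:
  assumes "chart U \<phi> J" "chart V \<psi> K"
  shows "smooth_open {p. snd p \<in> pdom U \<phi> J \<and> act (fst p) (param U \<phi> J (snd p)) \<in> V}
    (\<lambda>p. \<psi> (act (fst p) (param U \<phi> J (snd p))))"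
proof -
  let ?S = "{(g, x). g \<in> carrier (torus I) \<and> x \<in> \<phi> ` U \<and> \<rho> g (inv_into U \<phi> x) \<in> V}"
  let ?D = "{p. snd p \<in> pdom U \<phi> J \<and> act (fst p) (param U \<phi> J (snd p)) \<in> V}"
  let ?h = "\<lambda>p. (torus_exp (proj I (fst p)), proj J (snd p))"
  have sm: "smooth_on ?S (\<lambda>(g, x). \<psi> (\<rho> g (inv_into U \<phi> x)))"
    using assms action unfolding smooth_torus_action_def chart_def by fast
  have op: "open ?D"
    using open_act_dom[OF assms(1)] chart_is_chart(1)[OF assms(2)] by blast
  have "smooth_open ?D (\<lambda>p. torus_exp (proj I (fst p)))"
    by (rule smooth_open_compose[OF smooth_open_torus_exp])
      (simp_all add: smooth_open_linear[OF op bounded_linear_pair_fst[OF bounded_linear_proj]])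
  then have h: "smooth_open ?D ?h"
    by (rule smooth_open_Pair[OF _ smooth_open_linear[OF op bounded_linear_pair_snd[OF bounded_linear_proj]]])
  have "?h ` ?D \<subseteq> ?S"
    by (auto simp: torus_exp_proj_in pdom_def act_def param_def)
  from smooth_on_pullback[OF sm h this]
  show ?thesis
    by (simp only: act_def param_def prod.case)
qed

lemma smooth_transition:
  assumes "chart U \<phi> J" "chart V \<psi> K"
  shows "smooth_open {x \<in> pdom U \<phi> J. param U \<phi> J x \<in> V} (\<lambda>x. \<psi> (param U \<phi> J x))"
proof -
  let ?D = "{x \<in> pdom U \<phi> J. param U \<phi> J x \<in> V}"
  have op: "open ?D" using open_param_vimage[OF assms(1)] chart_is_chart(1)[OF assms(2)] by blast
  have "smooth_open ?D (\<lambda>x. (0, x))"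
    by (intro smooth_open_Pair smooth_open_const smooth_open_linear op bounded_linear_ident)
  from smooth_open_compose[OF smooth_act[OF assms] this]
  have "smooth_open ?D (\<lambda>x. \<psi> (act 0 (param U \<phi> J x)))"
    using assms(1) by (auto simp: image_subset_iff)
  then show ?thesis
    by (rule smooth_open_cong) (use assms(1) in auto)
qed

lemma smooth_function_continuous:
  assumes "smooth_function \<C> f" shows "continuous_map M euclidean f"
  unfolding continuous_map_eq_topcontinuous_at topcontinuous_at_def
proof (intro ballI conjI allI impI)
  fix y W assume y: "y \<in> topspace M" and W: "openin euclidean W \<and> f y \<in> W"
  obtain U \<phi> J where c: "chart U \<phi> J" "y \<in> U" using chart_at[OF y] by blast
  let ?f = "\<lambda>x. f (param U \<phi> J x)"
  have "continuous_on (pdom U \<phi> J) ?f"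
    using assms c(1) smooth_function_iff smooth_open_continuous_on by blast
  then have "open (pdom U \<phi> J \<inter> ?f -` W)"
    using W open_pdom[OF c(1)] continuous_open_preimage by auto
  from openin_chart_vimage[OF c(1) this]
  have "openin M {z \<in> U. \<phi> z \<in> pdom U \<phi> J \<inter> ?f -` W}" .
  then show "\<exists>V. openin M V \<and> y \<in> V \<and> (\<forall>x\<in>V. f x \<in> W)"
    by (intro exI[of _ "{z \<in> U. \<phi> z \<in> pdom U \<phi> J \<inter> ?f -` W}"]) (use c W in auto)
qed auto

end

section \<open>Infinitesimal stabilizers\<close>

lemma reduce_mod_periods:
  fixes \<sigma> :: "real ^ 'n::finite"
  obtains h where "h \<in> cbox 0 (\<chi> i. 2 * pi)" "\<sigma> - h \<in> period_lattice"
proof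
  define h :: "real ^ 'n" where "h = (\<chi> i. 2 * pi * frac (\<sigma> $ i / (2 * pi)))"
  show "h \<in> cbox 0 (\<chi> i. 2 * pi)"
    using frac_ge_0 frac_lt_1 by (auto simp: h_def mem_box_cart intro: less_imp_le)
  show "\<sigma> - h \<in> period_lattice"
    by (auto simp: h_def period_lattice_def frac_def algebra_simps)
qed

context torus_manifold
begin

definition stab :: "'m \<Rightarrow> (real ^ 'n) set" where
  "stab y = {\<sigma>. act \<sigma> y = y}"

definition lstab :: "'m \<Rightarrow> (real ^ 'n) set" where
  "lstab y = lineality (stab y)"

lemma lstab_iff: "\<xi> \<in> lstab y \<longleftrightarrow> (\<forall>t. act (t *\<^sub>R \<xi>) y = y)"
  by (simp add: lstab_def lineality_def stab_def)

lemma closed_subgroup_stab: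
  assumes y: "y \<in> topspace M" shows "closed_subgroup (stab y)"
proof -
  have "closedin M {y}"
    using Hausdorff y by (simp add: closedin_Hausdorff_sing_eq)
  from closedin_continuous_map_preimage[OF continuous_act_left[OF y] this]
  have "closed (stab y)" by (simp add: stab_def)
  then show ?thesis
    using y by (auto simp: closed_subgroup_def stab_def act_add) (metis act_uminus(1))
qed

lemma period_lattice_stab: "y \<in> topspace M \<Longrightarrow> period_lattice \<subseteq> stab y"
  using act_period by (auto simp: stab_def)

lemma subspace_lstab: "y \<in> topspace M \<Longrightarrow> subspace (lstab y)"
  unfolding lstab_def by (intro subspace_lineality closed_subgroup_stab)

lemma lstab_subset_stab: "lstab y \<subseteq> stab y"
  unfolding lstab_def by (rule lineality_subset)

lemma lstab_rational: "y \<in> topspace M \<Longrightarrow> lstab y = span (lstab y \<inter> period_lattice)"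
  unfolding lstab_def by (intro lineality_rational closed_subgroup_stab period_lattice_stab)

lemma lstab_act: "y \<in> topspace M \<Longrightarrow> lstab (act \<sigma> y) = lstab y"
proof -
  assume y: "y \<in> topspace M"
  have "act \<tau> (act \<sigma> y) = act \<sigma> y \<longleftrightarrow> act \<tau> y = y" for \<tau>
    using act_commute[OF y, of \<sigma> \<tau>] act_uminus(1)[of "act \<tau> y" \<sigma>] act_uminus(1)[of y \<sigma>] y
    by (metis act_in)
  then show ?thesis by (auto simp: lstab_iff)
qed

lemma act_scaled_coord:
  "\<xi> \<in> coord_space I \<Longrightarrow> \<rho> (torus_exp (t *\<^sub>R \<xi>)) y = act (t *\<^sub>R \<xi>) y"
  by (simp only: act_def proj_id[OF subspace_scale[OF subspace_coord_space]])

text \<open>If the generating field of \<open>\<xi>\<close> vanishes at \<open>y\<close>, then the curve \<open>t \<mapsto> exp(t \<xi>) y\<close> has derivative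
  0 at every time \<open>s\<close>, because it is mapped by \<open>exp(s \<xi>)\<close> to itself with the time shifted by
  \<open>s\<close>. So the set of times at which it returns to \<open>y\<close> is open; it is also closed.\<close>

lemma generating_field_0_imp_fixed:
  assumes y: "y \<in> topspace M" and c: "chart U \<phi> J" "y \<in> U" and \<xi>: "\<xi> \<in> coord_space I"
    and g0: "generating_field \<rho> (U, \<phi>) \<xi> y = 0"
  shows "act (t *\<^sub>R \<xi>) y = y"
proof -
  define h where "h t = \<phi> (act (t *\<^sub>R \<xi>) y)" for t
  have vd: "vector_derivative h (at 0) = 0"
    using g0 act_scaled_coord[OF \<xi>] by (simp add: generating_field_def h_def[abs_def])
  let ?D = "{p. snd p \<in> pdom U \<phi> J \<and> act (fst p) (param U \<phi> J (snd p)) \<in> U}"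
  note sm = smooth_act[OF c(1) c(1)]
  have "open {t. act (t *\<^sub>R \<xi>) y \<in> U}"
  proof -
    have "continuous_map euclidean M (\<lambda>t. act (t *\<^sub>R \<xi>) y)"
      by (rule continuous_map_compose[OF _ continuous_act_left[OF y], unfolded o_def])
        (auto intro!: continuous_intros)
    from openin_continuous_map_preimage[OF this chart_is_chart(1)[OF c(1)]]
    show ?thesis by simp
  qed
  note opS = this
  have der0: "(h has_derivative (\<lambda>v. 0)) (at 0)"
  proof -
    have "((\<lambda>t::real. (t *\<^sub>R \<xi>, \<phi> y)) has_derivative (\<lambda>v. (v *\<^sub>R \<xi>, 0))) (at 0)"
      by (intro derivative_eq_intros) auto
    from diff_chain_at[OF this smooth_open_has_derivative[OF sm]]
    have "h differentiable (at 0)"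
      using c y by (auto simp: o_def h_def[abs_def] differentiable_def chart_pdom param_chart)
    then have "(h has_vector_derivative 0) (at 0)"
      using vd vector_derivative_works by metis
    then show ?thesis by (simp add: has_vector_derivative_def)
  qed
  have der: "(h has_derivative (\<lambda>v. 0)) (at s)" if s: "act (s *\<^sub>R \<xi>) y \<in> U" for s
  proof -
    define \<Theta> where "\<Theta> x = \<phi> (act (s *\<^sub>R \<xi>) (param U \<phi> J x))" for x
    have "((\<lambda>x. (s *\<^sub>R \<xi>, x)) has_derivative (\<lambda>v. (0, v))) (at (\<phi> y))"
      by (intro derivative_eq_intros) auto
    from diff_chain_at[OF this smooth_open_has_derivative[OF sm]]
    obtain \<Theta>' where \<Theta>': "(\<Theta> has_derivative \<Theta>') (at (\<phi> y))"
      using c s by (auto simp: o_def \<Theta>_def[abs_def] chart_pdom param_chart)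
    have sh: "((\<lambda>t. t - s) has_derivative (\<lambda>v. v)) (at s)"
      by (intro derivative_eq_intros) auto
    have hs: "(h \<circ> (\<lambda>t. t - s) has_derivative (\<lambda>v. 0) \<circ> (\<lambda>v. v)) (at s)"
      by (rule diff_chain_at[OF sh]) (use der0 in simp)
    have "(h \<circ> (\<lambda>t. t - s)) s = \<phi> y" using y by (simp add: h_def)
    then have "(\<Theta> \<circ> (h \<circ> (\<lambda>t. t - s)) has_derivative \<Theta>' \<circ> ((\<lambda>v. 0) \<circ> (\<lambda>v. v))) (at s)"
      using \<Theta>' by (intro diff_chain_at[OF hs]) simp
    moreover have "\<Theta>' \<circ> ((\<lambda>v. 0) \<circ> (\<lambda>v::real. v)) = (\<lambda>v. 0)"
      using linear_0[OF has_derivative_linear[OF \<Theta>']] by auto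
    ultimately have "(\<Theta> \<circ> (h \<circ> (\<lambda>t. t - s)) has_derivative (\<lambda>v. 0)) (at s)" by (simp only:)
    then show ?thesis
    proof (rule has_derivative_transform_within_open)
      show "open ((\<lambda>t. t - s) -` {t. act (t *\<^sub>R \<xi>) y \<in> U})"
        by (rule open_vimage[OF opS]) (auto intro!: continuous_intros)
      show "s \<in> (\<lambda>t. t - s) -` {t. act (t *\<^sub>R \<xi>) y \<in> U}" using c(2) y by simp
      fix t assume "t \<in> (\<lambda>t. t - s) -` {t. act (t *\<^sub>R \<xi>) y \<in> U}"
      then have "(\<Theta> \<circ> (h \<circ> (\<lambda>t. t - s))) t = \<phi> (act (s *\<^sub>R \<xi>) (act ((t - s) *\<^sub>R \<xi>) y))"
        using c by (simp add: \<Theta>_def h_def param_chart)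
      also have "\<dots> = h t"
        using act_add[OF y, of "s *\<^sub>R \<xi>" "(t - s) *\<^sub>R \<xi>"] by (simp add: h_def scaleR_add_left[symmetric])
      finally show "(\<Theta> \<circ> (h \<circ> (\<lambda>t. t - s))) t = h t" .
    qed
  qed
  let ?T = "{t. act (t *\<^sub>R \<xi>) y = y}"
  have "closed ?T"
  proof -
    have "?T = (\<lambda>t. t *\<^sub>R \<xi>) -` stab y" by (auto simp: stab_def)
    moreover have "closed (stab y)" using closed_subgroup_stab[OF y] by (simp add: closed_subgroup_def)
    ultimately show ?thesis by (simp add: closed_vimage continuous_intros)
  qed
  moreover have "open ?T"
    unfolding open_contains_ball
  proof
    fix s assume s: "s \<in> ?T"
    then obtain e where e: "e > 0" "ball s e \<subseteq> {t. act (t *\<^sub>R \<xi>) y \<in> U}"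
      using openE[OF opS, of s] c(2) by auto
    have eq: "h t = h s" if "t \<in> ball s e" for t
    proof (rule has_derivative_zero_unique[of "ball s e" h])
      show "(h has_derivative (\<lambda>h. 0)) (at x within ball s e)" if "x \<in> ball s e" for x
        using der e(2) that has_derivative_at_withinI by blast
    qed (use e that in auto)
    have "act (t *\<^sub>R \<xi>) y = y" if t: "t \<in> ball s e" for t
    proof (rule inj_onD[OF chart_inj[OF c(1)]])
      show "\<phi> (act (t *\<^sub>R \<xi>) y) = \<phi> y" using eq[OF t] s by (simp add: h_def)
      show "act (t *\<^sub>R \<xi>) y \<in> U" using e(2) t by blast
    qed (rule c(2))
    then show "\<exists>e>0. ball s e \<subseteq> ?T" using e(1) by blast
  qed
  ultimately have "?T = {} \<or> ?T = UNIV" using clopen[of ?T] by (simp only: simp_thms)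
  moreover have "0 \<in> ?T" using y by simp
  ultimately have "t \<in> ?T" by (metis UNIV_I empty_iff)
  then show ?thesis by simp
qed

lemma inf_stabilizer_eq:
  assumes y: "y \<in> topspace M" shows "inf_stabilizer \<C> I \<rho> y = coord_space I \<inter> lstab y"
proof
  show "inf_stabilizer \<C> I \<rho> y \<subseteq> coord_space I \<inter> lstab y"
  proof
    fix \<xi> assume \<xi>: "\<xi> \<in> inf_stabilizer \<C> I \<rho> y"
    obtain U \<phi> J where c: "chart U \<phi> J" "y \<in> U" using chart_at[OF y] by blast
    then have "generating_field \<rho> (U, \<phi>) \<xi> y = 0" "\<xi> \<in> coord_space I"
      using \<xi> by (auto simp: inf_stabilizer_def chart_def)
    then show "\<xi> \<in> coord_space I \<inter> lstab y"
      using generating_field_0_imp_fixed[OF y c] by (simp add: lstab_iff)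
  qed
  show "coord_space I \<inter> lstab y \<subseteq> inf_stabilizer \<C> I \<rho> y"
    by (auto simp: inf_stabilizer_def generating_field_def act_scaled_coord lstab_iff)
qed

text \<open>The coordinates outside \<open>I\<close> act trivially, so \<open>lstab\<close> differs from the infinitesimal stabilizer
  by the same summand at all points, and the two are ordered in the same way.\<close>

lemma lstab_proj: "\<xi> \<in> lstab y \<longleftrightarrow> proj I \<xi> \<in> lstab y"
proof -
  have "proj I (t *\<^sub>R proj I \<xi>) = proj I (t *\<^sub>R \<xi>)" for t
    by (simp add: linear_scale[OF linear_proj])
  then show ?thesis by (simp add: lstab_iff act_def)
qed

lemma lstab_subset_iff:
  assumes "x \<in> topspace M" "y \<in> topspace M"
  shows "inf_stabilizer \<C> I \<rho> x \<subseteq> inf_stabilizer \<C> I \<rho> y \<longleftrightarrow> lstab x \<subseteq> lstab y"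
  using assms lstab_proj by (auto simp: inf_stabilizer_eq) (meson IntI proj_in subsetD IntD2)

text \<open>Semicontinuity: a one-parameter group that fixes a point near \<open>p\<close> without fixing \<open>p\<close> would
  move, modulo the stabilizer of \<open>p\<close>, through the small sphere in the orthogonal complement of the
  infinitesimal stabilizer. That sphere translated by the stabilizer is compact modulo periods and
  moves \<open>p\<close>, hence it moves every nearby point.\<close>

lemma lstab_semicontinuous:
  assumes p: "p \<in> topspace M"
  obtains W where "openin M W" "p \<in> W" "\<And>y. y \<in> W \<Longrightarrow> lstab y \<subseteq> lstab p"
proof -
  let ?V = "lstab p" and ?B = "cbox 0 (\<chi> i. 2 * pi) :: (real ^ 'n) set"
  have sub: "subspace ?V" using subspace_lstab[OF p] .
  have cl: "closed (stab p)" using closed_subgroup_stab[OF p] by (simp add: closed_subgroup_def)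
  obtain \<epsilon> where \<epsilon>: "\<epsilon> > 0" "\<And>l. l \<in> stab p \<Longrightarrow> norm l < \<epsilon> \<Longrightarrow> l \<in> ?V"
    using closed_subgroup_near_0[OF closed_subgroup_stab[OF p]] unfolding lstab_def by blast
  define S where "S = sphere 0 (\<epsilon> / 2) \<inter> {z. \<forall>v\<in>?V. orthogonal v z}"
  define C where "C = (\<Union>s\<in>S. \<Union>h\<in>stab p \<inter> ?B. {s + h})"
  have "compact S"
  proof -
    have "closed {z. \<forall>v\<in>?V. orthogonal v z}"
      by (rule closed_subspace[OF subspace_orthogonal_to_vectors])
    then show ?thesis unfolding S_def by (intro compact_Int_closed compact_sphere)
  qed
  moreover have "compact (stab p \<inter> ?B)" by (intro closed_Int_compact cl compact_cbox)
  ultimately have "compact C" unfolding C_def by (rule compact_sums')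
  define W where "W = {y \<in> topspace M. \<forall>\<sigma>\<in>C. act \<sigma> y \<noteq> y}"
  show thesis
  proof
    show "openin M W" unfolding W_def by (rule openin_act_free[OF \<open>compact C\<close>])
    have "act (s + h) p \<noteq> p" if s: "s \<in> S" and h: "h \<in> stab p" for s h
    proof
      assume "act (s + h) p = p"
      then have "s \<in> stab p" using act_add[OF p, of s h] h by (simp add: stab_def)
      moreover have "norm s < \<epsilon>" using s \<epsilon>(1) by (simp add: S_def)
      ultimately have "s \<in> ?V" using \<epsilon>(2) by blast
      then have "orthogonal s s" using s by (auto simp: S_def)
      then show False using s \<epsilon>(1) by (simp add: S_def orthogonal_self)
    qed
    then show "p \<in> W" using p by (auto simp: W_def C_def)
  next
    fix y assume y: "y \<in> W"
    then have yM: "y \<in> topspace M" by (simp add: W_def)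
    show "lstab y \<subseteq> ?V"
    proof (rule ccontr)
      assume "\<not> lstab y \<subseteq> ?V"
      then obtain \<xi> where \<xi>: "\<xi> \<in> lstab y" "\<xi> \<notin> ?V" by blast
      obtain v z where vz: "v \<in> span ?V" "\<And>w. w \<in> span ?V \<Longrightarrow> orthogonal z w" "\<xi> = v + z"
        using orthogonal_subspace_decomp_exists[of ?V \<xi>] by blast
      have v: "v \<in> ?V" using vz(1) sub span_eq_iff by blast
      have z0: "z \<noteq> 0" using vz(3) v \<xi>(2) by auto
      \<comment> \<open>At this time the component orthogonal to \<open>lstab p\<close> crosses the sphere.\<close>
      define t where "t = \<epsilon> / 2 / norm z"
      have tz: "t *\<^sub>R z \<in> S"
        using z0 \<epsilon>(1) vz(2) by (auto simp: S_def t_def orthogonal_clauses orthogonal_commute span_base)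
      have tv: "t *\<^sub>R v \<in> stab p" using v sub subspace_scale lstab_subset_stab by blast
      obtain h where h: "h \<in> ?B" "t *\<^sub>R v - h \<in> period_lattice"
        using reduce_mod_periods by blast
      have "act (t *\<^sub>R v - h) p = p" by (rule act_period[OF h(2) p])
      then have "h \<in> stab p"
        using act_add[OF p, of h "t *\<^sub>R v - h"] tv by (simp add: stab_def)
      then have "t *\<^sub>R z + h \<in> C" using tz h(1) by (auto simp: C_def)
      then have "act (t *\<^sub>R z + h) y \<noteq> y" using y by (auto simp: W_def)
      moreover have "act (t *\<^sub>R z + h) y = act (t *\<^sub>R z + h + (t *\<^sub>R v - h)) y"
        using act_add[OF yM, of "t *\<^sub>R z + h" "t *\<^sub>R v - h"] act_period[OF h(2) yM] by simp
      moreover have "t *\<^sub>R z + h + (t *\<^sub>R v - h) = t *\<^sub>R \<xi>"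
        using vz(3) by (simp add: scaleR_add_right)
      ultimately show False using \<xi>(1) by (simp add: lstab_iff)
    qed
  qed
qed

definition invariant :: "'m set \<Rightarrow> bool" where
  "invariant U \<longleftrightarrow> (\<forall>y\<in>U. \<forall>\<sigma>. act \<sigma> y \<in> U)"

definition saturation :: "'m set \<Rightarrow> 'm set" where
  "saturation W = (\<Union>\<sigma>. act \<sigma> ` W)"

lemma openin_saturation: "openin M W \<Longrightarrow> openin M (saturation W)"
  unfolding saturation_def using openin_act_image by blast

lemma subset_saturation: "W \<subseteq> topspace M \<Longrightarrow> W \<subseteq> saturation W"
  unfolding saturation_def by (force intro!: UN_I[of 0] image_eqI[of _ "act 0"])

lemma invariant_saturation: "W \<subseteq> topspace M \<Longrightarrow> invariant (saturation W)"
  unfolding saturation_def invariant_def by (force simp: act_add[symmetric])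

lemma compactin_saturation:
  assumes "compactin M K" shows "compactin M (saturation K)"
proof -
  let ?B = "cbox 0 (\<chi> i. 2 * pi) :: (real ^ 'n) set"
  have K: "K \<subseteq> topspace M" using assms compactin_subset_topspace by blast
  have "compactin (prod_topology euclidean M) (?B \<times> K)"
    using assms by (simp add: compactin_Times)
  from image_compactin[OF this continuous_act]
  have "compactin M ((\<lambda>(\<sigma>, y). act \<sigma> y) ` (?B \<times> K))" .
  moreover have "(\<lambda>(\<sigma>, y). act \<sigma> y) ` (?B \<times> K) = saturation K"
  proof
    show "saturation K \<subseteq> (\<lambda>(\<sigma>, y). act \<sigma> y) ` (?B \<times> K)"
    proof
      fix x assume "x \<in> saturation K"
      then obtain \<sigma> y where y: "y \<in> K" "x = act \<sigma> y" by (auto simp: saturation_def)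
      obtain h where h: "h \<in> ?B" "\<sigma> - h \<in> period_lattice" using reduce_mod_periods by blast
      have yM: "y \<in> topspace M" using y(1) K by blast
      have "act \<sigma> y = act h y"
        using act_add[OF yM, of h "\<sigma> - h"] act_period[OF h(2) yM] by simp
      then show "x \<in> (\<lambda>(\<sigma>, y). act \<sigma> y) ` (?B \<times> K)" using y h(1) by force
    qed
  qed (auto simp: saturation_def)
  ultimately show ?thesis by simp
qed

end

section \<open>Invariant smooth functions and partitions of unity\<close>

lemma sum_successive_products:
  fixes p :: "nat \<Rightarrow> real"
  shows "(\<Sum>i<n. p i * (\<Prod>j<i. 1 - p j)) = 1 - (\<Prod>j<n. 1 - p j)"
  by (induction n) (auto simp: algebra_simps)

context torus_manifold
begin

lemma smooth_function_local:
  assumes "\<And>y. y \<in> topspace M \<Longrightarrow> \<exists>N g. openin M N \<and> y \<in> N \<and> smooth_function \<C> g \<and> (\<forall>z\<in>N. f z = g z)"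
  shows "smooth_function \<C> f"
  unfolding smooth_function_iff
proof (intro allI impI)
  fix U \<phi> J assume c: "chart U \<phi> J"
  show "smooth_open (pdom U \<phi> J) (\<lambda>x. f (param U \<phi> J x))"
  proof (rule smooth_open_local)
    fix x assume x: "x \<in> pdom U \<phi> J"
    then obtain N g where N: "openin M N" "param U \<phi> J x \<in> N" "smooth_function \<C> g" "\<forall>z\<in>N. f z = g z"
      using assms[of "param U \<phi> J x"] c param_in_topspace by blast
    let ?V = "{x \<in> pdom U \<phi> J. param U \<phi> J x \<in> N}"
    have "smooth_open (pdom U \<phi> J) (\<lambda>x. g (param U \<phi> J x))"
      using N(3) c smooth_function_iff by blast
    from smooth_open_subset[OF this open_param_vimage[OF c N(1)]]
    have "smooth_open ?V (\<lambda>x. g (param U \<phi> J x))" by blast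
    then have "smooth_open ?V (\<lambda>x. f (param U \<phi> J x))"
      by (rule smooth_open_cong) (use N(4) in auto)
    then show "\<exists>V. x \<in> V \<and> V \<subseteq> pdom U \<phi> J \<and> smooth_open V (\<lambda>x. f (param U \<phi> J x))"
      by (intro exI[of _ ?V]) (use x N(2) in auto)
  qed
qed

lemma smooth_function_const: "smooth_function \<C> (\<lambda>y. c)"
  unfolding smooth_function_iff by (intro allI impI smooth_open_const open_pdom)

lemma smooth_function_mult:
  "smooth_function \<C> f \<Longrightarrow> smooth_function \<C> g \<Longrightarrow> smooth_function \<C> (\<lambda>y. f y * g y)"
  unfolding smooth_function_iff by (auto intro!: smooth_open_mult)

lemma smooth_function_add:
  "smooth_function \<C> f \<Longrightarrow> smooth_function \<C> g \<Longrightarrow> smooth_function \<C> (\<lambda>y. f y + g y)"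
  unfolding smooth_function_iff by (auto intro!: smooth_open_add)

lemma smooth_function_compose:
  assumes "smooth_open UNIV h" "smooth_function \<C> f" shows "smooth_function \<C> (\<lambda>y. h (f y))"
  unfolding smooth_function_iff
proof (intro allI impI)
  fix U \<phi> J assume "chart U \<phi> J"
  then have "smooth_open (pdom U \<phi> J) (\<lambda>x. f (param U \<phi> J x))"
    using assms(2) smooth_function_iff by blast
  from smooth_open_compose[OF assms(1) this]
  show "smooth_open (pdom U \<phi> J) (\<lambda>x. h (f (param U \<phi> J x)))" by simp
qed

lemma smooth_function_sum:
  "finite S \<Longrightarrow> (\<And>i. i \<in> S \<Longrightarrow> smooth_function \<C> (f i)) \<Longrightarrow> smooth_function \<C> (\<lambda>y. \<Sum>i\<in>S. f i y)"
  by (induction S rule: finite_induct) (simp_all add: smooth_function_const smooth_function_add)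

lemma smooth_function_prod:
  "finite S \<Longrightarrow> (\<And>i. i \<in> S \<Longrightarrow> smooth_function \<C> (f i)) \<Longrightarrow> smooth_function \<C> (\<lambda>y. \<Prod>i\<in>S. f i y)"
  by (induction S rule: finite_induct) (simp_all add: smooth_function_const smooth_function_mult)

text \<open>Near each pair of a group element and a point, a chart around the image point turns the
  composition into one of smooth maps between Euclidean spaces.\<close>

lemma smooth_function_act:
  assumes f: "smooth_function \<C> f" and c: "chart U \<phi> J"
  shows "smooth_open (UNIV \<times> pdom U \<phi> J) (\<lambda>p. f (act (fst p) (param U \<phi> J (snd p))))"
proof (rule smooth_open_local)
  fix p :: "(real ^ 'n) \<times> (real ^ 'd)" assume "p \<in> UNIV \<times> pdom U \<phi> J"
  then have p: "snd p \<in> pdom U \<phi> J" by auto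
  let ?a = "\<lambda>p. act (fst p) (param U \<phi> J (snd p))"
  obtain V \<psi> K where d: "chart V \<psi> K" "?a p \<in> V"
    using chart_at[of "?a p"] p c by auto
  let ?D = "{p. snd p \<in> pdom U \<phi> J \<and> ?a p \<in> V}"
  have "smooth_open (pdom V \<psi> K) (\<lambda>x. f (param V \<psi> K x))"
    using f d(1) smooth_function_iff by blast
  from smooth_open_compose[OF this smooth_act[OF c d(1)]]
  have "smooth_open ?D (\<lambda>p. f (param V \<psi> K (\<psi> (?a p))))"
    using d(1) by (auto simp: image_subset_iff)
  then have "smooth_open ?D (\<lambda>p. f (?a p))"
    by (rule smooth_open_cong) (use d(1) in auto)
  then show "\<exists>V. p \<in> V \<and> V \<subseteq> UNIV \<times> pdom U \<phi> J \<and> smooth_open V (\<lambda>p. f (?a p))"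
    by (intro exI[of _ ?D]) (use p d in auto)
qed

definition circle_average :: "real ^ 'n \<Rightarrow> ('m \<Rightarrow> real) \<Rightarrow> 'm \<Rightarrow> real" where
  "circle_average v f y = integral {0..1} (\<lambda>t. f (act (t *\<^sub>R v) y))"

lemma smooth_circle_average:
  assumes f: "smooth_function \<C> f" shows "smooth_function \<C> (circle_average v f)"
  unfolding smooth_function_iff circle_average_def
proof (intro allI impI)
  fix U \<phi> J assume c: "chart U \<phi> J"
  have op: "open (UNIV \<times> pdom U \<phi> J)" using open_Times[OF open_UNIV open_pdom[OF c]] .
  have "bounded_linear (\<lambda>p::real \<times> (real ^ 'd). (fst p *\<^sub>R v, snd p))"
    by (intro bounded_linear_Pair bounded_linear_pair_fst bounded_linear_scaleR_left bounded_linear_snd)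
  from smooth_open_compose[OF smooth_function_act[OF f c] smooth_open_linear[OF op this]]
  have "smooth_open (UNIV \<times> pdom U \<phi> J) (\<lambda>p::real \<times> _. f (act (fst p *\<^sub>R v) (param U \<phi> J (snd p))))"
    by (auto simp: image_subset_iff)
  from smooth_open_param_integral[OF open_pdom[OF c] this]
  show "smooth_open (pdom U \<phi> J) (\<lambda>x. integral {0..1} (\<lambda>t. f (act (t *\<^sub>R v) (param U \<phi> J x))))"
    by simp
qed

lemma continuous_along_circle:
  assumes "smooth_function \<C> f" "y \<in> topspace M"
  shows "continuous_on UNIV (\<lambda>t. f (act (t *\<^sub>R v) y))"
proof -
  have "continuous_map euclidean M (\<lambda>t. act (t *\<^sub>R v) y)"
    by (rule continuous_map_compose[OF _ continuous_act_left[OF assms(2)], unfolded o_def])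
      (auto intro!: continuous_intros)
  from continuous_map_compose[OF this smooth_function_continuous[OF assms(1)]]
  show ?thesis by (simp add: o_def)
qed

lemma circle_average_invariant:
  assumes f: "smooth_function \<C> f" and y: "y \<in> topspace M" and v: "v \<in> period_lattice"
  shows "circle_average v f (act (s *\<^sub>R v) y) = circle_average v f y"
proof -
  have "integral {0..1} (\<lambda>t. (\<lambda>t. f (act (t *\<^sub>R v) y)) (t + s)) = integral {0..1} (\<lambda>t. f (act (t *\<^sub>R v) y))"
  proof (rule integral_periodic_shift[OF continuous_along_circle[OF f y]])
    show "f (act ((u + 1) *\<^sub>R v) y) = f (act (u *\<^sub>R v) y)" for u
      using act_add[OF y, of "u *\<^sub>R v" v] act_period[OF v y] by (simp add: scaleR_add_left)
  qed
  moreover have "act ((t + s) *\<^sub>R v) y = act (t *\<^sub>R v) (act (s *\<^sub>R v) y)" for t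
    using act_add[OF y] by (simp add: scaleR_add_left)
  ultimately show ?thesis by (simp add: circle_average_def)
qed

lemma circle_average_pos:
  assumes f: "smooth_function \<C> f" and nn: "\<And>y. y \<in> topspace M \<Longrightarrow> 0 \<le> f y"
    and y: "y \<in> topspace M" "f y > 0"
  shows "circle_average v f y > 0"
proof -
  let ?g = "\<lambda>t. f (act (t *\<^sub>R v) y)"
  have cont: "continuous_on {0..1} ?g"
    using continuous_along_circle[OF f y(1)] continuous_on_subset by blast
  have "integral {0..1} ?g \<ge> 0"
    using nn y(1) by (intro integral_nonneg integrable_continuous_real cont) auto
  moreover have "integral {0..1} ?g \<noteq> 0"
  proof
    assume "integral {0..1} ?g = 0"
    then have "\<forall>t\<in>{0..1}. ?g t = 0"
      using integral_eq_0_iff[OF cont] nn y(1) by auto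
    then show False using y by (auto dest: bspec[of _ _ 0])
  qed
  ultimately show ?thesis by (simp add: circle_average_def)
qed

text \<open>Averaging over the coordinate circles one after the other keeps the invariance that has
  already been achieved, because the circles commute.\<close>

lemma invariant_average:
  assumes f: "smooth_function \<C> f" and nn: "\<And>y. y \<in> topspace M \<Longrightarrow> 0 \<le> f y"
    and m: "m \<in> topspace M" "f m > 0" and U: "invariant U"
    and off: "\<And>y. y \<in> topspace M \<Longrightarrow> y \<notin> U \<Longrightarrow> f y = 0"
  obtains F where "smooth_function \<C> F" "\<And>y. y \<in> topspace M \<Longrightarrow> 0 \<le> F y" "F m > 0"
    "\<And>y. y \<in> topspace M \<Longrightarrow> y \<notin> U \<Longrightarrow> F y = 0"
    "\<And>y \<sigma>. y \<in> topspace M \<Longrightarrow> F (act \<sigma> y) = F y"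
proof -
  define e :: "'n \<Rightarrow> real ^ 'n" where "e i = (2 * pi) *\<^sub>R axis i 1" for i
  have e: "e i \<in> period_lattice" for i
    by (auto simp: e_def period_lattice_def axis_def intro: exI[of _ 1] exI[of _ 0])
  have "\<exists>F. smooth_function \<C> F \<and> (\<forall>y\<in>topspace M. 0 \<le> F y) \<and> F m > 0 \<and>
      (\<forall>y\<in>topspace M. y \<notin> U \<longrightarrow> F y = 0) \<and> (\<forall>i\<in>S. \<forall>y\<in>topspace M. \<forall>s. F (act (s *\<^sub>R e i) y) = F y)"
    if "finite S" for S
    using that
  proof (induction S rule: finite_induct)
    case empty then show ?case using f nn m off by blast
  next
    case (insert i S)
    then obtain F where F: "smooth_function \<C> F" "\<forall>y\<in>topspace M. 0 \<le> F y" "F m > 0"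
      "\<forall>y\<in>topspace M. y \<notin> U \<longrightarrow> F y = 0" "\<forall>i\<in>S. \<forall>y\<in>topspace M. \<forall>s. F (act (s *\<^sub>R e i) y) = F y" by blast
    have nonneg: "0 \<le> circle_average (e i) F y" if "y \<in> topspace M" for y
      unfolding circle_average_def using F(2) that continuous_along_circle[OF F(1) that]
      by (intro integral_nonneg integrable_continuous_real) (auto intro: continuous_on_subset)
    have zero: "circle_average (e i) F y = 0" if y: "y \<in> topspace M" "y \<notin> U" for y
    proof -
      have "F (act (t *\<^sub>R e i) y) = 0" for t
      proof -
        have "act (t *\<^sub>R e i) y \<notin> U"
          using U y act_uminus(1)[OF y(1)] unfolding invariant_def by metis
        then show ?thesis using F(4) y(1) by simp
      qed
      then show ?thesis by (simp add: circle_average_def)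
    qed
    have inv: "circle_average (e i) F (act (s *\<^sub>R e j) y) = circle_average (e i) F y"
      if j: "j \<in> insert i S" and y: "y \<in> topspace M" for j y s
    proof (cases "j = i")
      case True then show ?thesis using circle_average_invariant[OF F(1) y e] by simp
    next
      case False
      then have "F (act (t *\<^sub>R e i) (act (s *\<^sub>R e j) y)) = F (act (t *\<^sub>R e i) y)" for t
        using F(5) j y act_commute[OF y, of "t *\<^sub>R e i" "s *\<^sub>R e j"] by simp
      then show ?thesis by (simp add: circle_average_def)
    qed
    show ?case
      using smooth_circle_average[OF F(1), of "e i"] nonneg zero inv
        circle_average_pos[OF F(1) _ m(1) F(3), of "e i"] F(2) by blast
  qed
  from this[OF finite_class.finite_UNIV] obtain F where F: "smooth_function \<C> F" "\<forall>y\<in>topspace M. 0 \<le> F y" "F m > 0"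
      "\<forall>y\<in>topspace M. y \<notin> U \<longrightarrow> F y = 0" "\<forall>i. \<forall>y\<in>topspace M. \<forall>s. F (act (s *\<^sub>R e i) y) = F y" by blast
  have "\<forall>y\<in>topspace M. F (act (\<Sum>i\<in>S. (\<sigma> $ i / (2 * pi)) *\<^sub>R e i) y) = F y" if "finite S" for S \<sigma>
    using that by (induction S rule: finite_induct) (auto simp: act_add F(5))
  note sums = this[OF finite_class.finite_UNIV]
  have "F (act \<sigma> y) = F y" if "y \<in> topspace M" for \<sigma> y
  proof -
    have "(\<Sum>i\<in>UNIV. (\<sigma> $ i / (2 * pi)) *\<^sub>R e i) = \<sigma>"
      using basis_expansion[of \<sigma>] by (simp add: e_def scalar_mult_eq_scaleR)
    then show ?thesis using sums[of \<sigma>] that by simp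
  qed
  then show thesis using that[of F] F by blast
qed

lemma chart_bump:
  assumes U0: "openin M U0" "m \<in> U0"
  obtains f where "smooth_function \<C> f" "\<And>y. 0 \<le> f y" "f m > 0" "\<And>y. y \<notin> U0 \<Longrightarrow> f y = 0"
proof -
  have m: "m \<in> topspace M" using U0 openin_subset by blast
  obtain U \<phi> J where c: "chart U \<phi> J" "m \<in> U" using chart_at[OF m] by blast
  have "open {x \<in> pdom U \<phi> J. param U \<phi> J x \<in> U0}"
    using open_param_vimage[OF c(1) U0(1)] .
  moreover have "\<phi> m \<in> {x \<in> pdom U \<phi> J. param U \<phi> J x \<in> U0}" using c U0 by simp
  ultimately obtain r where r: "r > 0" "cball (\<phi> m) r \<subseteq> {x \<in> pdom U \<phi> J. param U \<phi> J x \<in> U0}"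
    using open_contains_cball by blast
  define K where "K = param U \<phi> J ` cball (\<phi> m) r"
  have "compactin M K"
    unfolding K_def
  proof (rule image_compactin[OF _ continuous_param[OF c(1)]])
    show "compactin (top_of_set (pdom U \<phi> J)) (cball (\<phi> m) r)"
      using r(2) by (simp add: compactin_subtopology) blast
  qed
  have KU: "K \<subseteq> U"
    unfolding K_def using r(2) param_in[OF c(1)] by blast
  have "closedin M K" using \<open>compactin M K\<close> Hausdorff compactin_imp_closedin by blast
  define b where "b x = flat 1 (r\<^sup>2 - (x - \<phi> m) \<bullet> (x - \<phi> m))" for x
  define f where "f y = (if y \<in> U then b (\<phi> y) else 0)" for y
  have b0: "b x \<noteq> 0 \<Longrightarrow> x \<in> cball (\<phi> m) r" for x
    using r(1) power_strict_mono[of r "norm (x - \<phi> m)" 2]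
    by (force simp: b_def flat_1 dist_norm norm_minus_commute dot_square_norm not_le)
  have f0: "y \<in> K \<and> y \<in> U0" if "f y \<noteq> 0" for y
  proof -
    have y: "y \<in> U" "\<phi> y \<in> cball (\<phi> m) r" using that b0 by (auto simp: f_def split: if_splits)
    then have "param U \<phi> J (\<phi> y) \<in> K" "param U \<phi> J (\<phi> y) \<in> U0" using r(2) by (auto simp: K_def)
    then show ?thesis using c(1) y(1) by simp
  qed
  have sb: "smooth_open UNIV b"
  proof -
    have lin: "smooth_open UNIV (\<lambda>x. x + - \<phi> m)"
      by (intro smooth_open_add smooth_open_linear smooth_open_const bounded_linear_ident) auto
    have "smooth_open UNIV (\<lambda>x. (x + - \<phi> m) \<bullet> (x + - \<phi> m))"
      using lin Ck_on_bilinear[OF open_UNIV bounded_bilinear_inner]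
      unfolding smooth_open_def by blast
    from smooth_open_linear_comp[OF bounded_linear_minus[OF bounded_linear_ident] this]
    have "smooth_open UNIV (\<lambda>x. r\<^sup>2 + - ((x + - \<phi> m) \<bullet> (x + - \<phi> m)))"
      by (intro smooth_open_add smooth_open_const) auto
    from smooth_open_compose[OF smooth_open_flat[of 1] this]
    show ?thesis by (simp add: b_def[abs_def])
  qed
  have "smooth_function \<C> f"
    unfolding smooth_function_iff
  proof (intro allI impI)
    fix V \<psi> L assume d: "chart V \<psi> L"
    show "smooth_open (pdom V \<psi> L) (\<lambda>x. f (param V \<psi> L x))"
    proof (rule smooth_open_local)
      fix x assume x: "x \<in> pdom V \<psi> L"
      show "\<exists>W. x \<in> W \<and> W \<subseteq> pdom V \<psi> L \<and> smooth_open W (\<lambda>x. f (param V \<psi> L x))"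
      proof (cases "param V \<psi> L x \<in> U")
        case True
        let ?W = "{x \<in> pdom V \<psi> L. param V \<psi> L x \<in> U}"
        from smooth_open_compose[OF sb smooth_transition[OF d c(1)]]
        have "smooth_open ?W (\<lambda>x. b (\<phi> (param V \<psi> L x)))" by simp
        then have "smooth_open ?W (\<lambda>x. f (param V \<psi> L x))"
          by (rule smooth_open_cong) (simp add: f_def)
        then show ?thesis by (intro exI[of _ ?W]) (use x True in auto)
      next
        case False
        let ?W = "{x \<in> pdom V \<psi> L. param V \<psi> L x \<in> topspace M - K}"
        have "open ?W"
          using \<open>closedin M K\<close> by (intro open_param_vimage[OF d]) auto
        from smooth_open_const[OF this, of "0::real"]
        have "smooth_open ?W (\<lambda>x. f (param V \<psi> L x))"
          by (rule smooth_open_cong) (metis (no_types, lifting) DiffD2 f0 mem_Collect_eq)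
        moreover have "param V \<psi> L x \<notin> K"
          using False KU by blast
        ultimately show ?thesis by (intro exI[of _ ?W]) (use x d in auto)
      qed
    qed
  qed
  moreover have "0 \<le> f y" for y by (simp add: f_def b_def flat_1)
  moreover have "f m > 0" using c r(1) by (simp add: f_def b_def flat_def)
  ultimately show thesis using that f0 by blast
qed

text \<open>The average of a bump function is positive at \<open>m\<close>. Composing a multiple of it with the step
  function makes it equal to 1 near \<open>m\<close>.\<close>

lemma invariant_bump:
  assumes U: "openin M U" "invariant U" "m \<in> U"
  obtains \<psi> N where "smooth_function \<C> \<psi>" "\<And>y. 0 \<le> \<psi> y \<and> \<psi> y \<le> 1"
    "\<And>y. y \<in> topspace M \<Longrightarrow> y \<notin> U \<Longrightarrow> \<psi> y = 0" "\<And>y \<sigma>. y \<in> topspace M \<Longrightarrow> \<psi> (act \<sigma> y) = \<psi> y"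
    "openin M N" "m \<in> N" "\<And>y. y \<in> N \<Longrightarrow> \<psi> y = 1"
proof -
  have m: "m \<in> topspace M" using U openin_subset by blast
  obtain f where f: "smooth_function \<C> f" "\<And>y. 0 \<le> f y" "f m > 0" "\<And>y. y \<notin> U \<Longrightarrow> f y = 0"
    using chart_bump[OF U(1,3)] by blast
  obtain F where F: "smooth_function \<C> F" "\<And>y. y \<in> topspace M \<Longrightarrow> 0 \<le> F y" "F m > 0"
    "\<And>y. y \<in> topspace M \<Longrightarrow> y \<notin> U \<Longrightarrow> F y = 0"
    "\<And>y \<sigma>. y \<in> topspace M \<Longrightarrow> F (act \<sigma> y) = F y"
    using invariant_average[OF f(1) f(2) m f(3) U(2) f(4)] by blast
  define \<psi> where "\<psi> y = step (2 / F m * F y)" for y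
  define N where "N = {y \<in> topspace M. F y \<in> {F m / 2<..}}"
  show thesis
  proof
    show "smooth_function \<C> \<psi>"
      unfolding \<psi>_def by (intro smooth_function_compose[OF smooth_open_step] smooth_function_mult smooth_function_const F(1))
    show "0 \<le> \<psi> y \<and> \<psi> y \<le> 1" for y using step_bounds by (simp add: \<psi>_def)
    show "\<psi> y = 0" if "y \<in> topspace M" "y \<notin> U" for y using F(4) that by (simp add: \<psi>_def step_eq_0)
    show "\<psi> (act \<sigma> y) = \<psi> y" if "y \<in> topspace M" for y \<sigma> using F(5) that by (simp add: \<psi>_def)
    show "openin M N"
      unfolding N_def by (rule openin_continuous_map_preimage[OF smooth_function_continuous[OF F(1)]]) auto
    show "m \<in> N" using m F(3) by (simp add: N_def)
    show "\<psi> y = 1" if "y \<in> N" for y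
      using that F(3) by (auto simp: N_def \<psi>_def field_simps intro!: step_eq_1)
  qed
qed

text \<open>With bump functions \<open>\<psi>\<^sub>i\<close> whose sets \<open>{\<psi>\<^sub>i = 1}\<close> have interiors that cover \<open>M\<close>, the
  products \<open>\<psi>\<^sub>i \<Prod>j<i (1 - \<psi>\<^sub>j)\<close> are a locally finite partition of unity: where \<open>\<psi>\<^sub>i = 1\<close>,
  all later products vanish.\<close>

definition partition_of_unity :: "('m \<Rightarrow> 'm set) \<Rightarrow> (nat \<Rightarrow> 'm) \<Rightarrow> (nat \<Rightarrow> 'm \<Rightarrow> real) \<Rightarrow> bool" where
  "partition_of_unity U c R \<longleftrightarrow>
    (\<forall>i. smooth_function \<C> (R i)) \<and>
    (\<forall>i. \<forall>y\<in>topspace M. 0 \<le> R i y \<and> (\<forall>\<sigma>. R i (act \<sigma> y) = R i y) \<and>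
       (R i y \<noteq> 0 \<longrightarrow> c i \<in> topspace M \<and> y \<in> U (c i))) \<and>
    (\<forall>y\<in>topspace M. \<exists>N n. openin M N \<and> y \<in> N \<and> (\<forall>z\<in>N. (\<forall>i\<ge>n. R i z = 0) \<and> (\<Sum>i<n. R i z) = 1))"

lemma partition_of_unityD:
  assumes "partition_of_unity U c R" "y \<in> topspace M"
  shows "0 \<le> R i y" "R i y \<noteq> 0 \<Longrightarrow> c i \<in> topspace M" "R i y \<noteq> 0 \<Longrightarrow> y \<in> U (c i)"
  using assms by (simp_all add: partition_of_unity_def)

lemma partition_of_unity_exists:
  assumes U: "\<And>m. m \<in> topspace M \<Longrightarrow> openin M (U m) \<and> invariant (U m) \<and> m \<in> U m"
  obtains c R where "partition_of_unity U c R"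
proof (cases "topspace M = {}")
  case True
  then have "partition_of_unity U (\<lambda>_. undefined) (\<lambda>_ _. 0)"
    unfolding partition_of_unity_def True using smooth_function_const[of 0] by simp
  then show thesis using that by blast
next
  case False
  have "\<exists>\<psi> N. smooth_function \<C> \<psi> \<and> (\<forall>y. 0 \<le> \<psi> y \<and> \<psi> y \<le> 1) \<and>
    (\<forall>y\<in>topspace M. (y \<notin> U m \<longrightarrow> \<psi> y = 0) \<and> (\<forall>\<sigma>. \<psi> (act \<sigma> y) = \<psi> y)) \<and>
    openin M N \<and> m \<in> N \<and> (\<forall>y\<in>N. \<psi> y = 1)" if m: "m \<in> topspace M" for m
  proof -
    obtain \<psi> N where "smooth_function \<C> \<psi>" "\<And>y. 0 \<le> \<psi> y \<and> \<psi> y \<le> 1"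
      "\<And>y. y \<in> topspace M \<Longrightarrow> y \<notin> U m \<Longrightarrow> \<psi> y = 0" "\<And>y \<sigma>. y \<in> topspace M \<Longrightarrow> \<psi> (act \<sigma> y) = \<psi> y"
      "openin M N" "m \<in> N" "\<And>y. y \<in> N \<Longrightarrow> \<psi> y = 1"
      using invariant_bump[of "U m" m] U[OF m] by blast
    then show ?thesis by (intro exI[of _ \<psi>] exI[of _ N]) simp
  qed
  then obtain \<psi> N where \<psi>: "\<And>m. m \<in> topspace M \<Longrightarrow> smooth_function \<C> (\<psi> m) \<and> (\<forall>y. 0 \<le> \<psi> m y \<and> \<psi> m y \<le> 1) \<and>
    (\<forall>y\<in>topspace M. (y \<notin> U m \<longrightarrow> \<psi> m y = 0) \<and> (\<forall>\<sigma>. \<psi> m (act \<sigma> y) = \<psi> m y)) \<and>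
    openin M (N m) \<and> m \<in> N m \<and> (\<forall>y\<in>N m. \<psi> m y = 1)" by metis
  have N: "openin M (N m)" "m \<in> N m" if "m \<in> topspace M" for m
    using \<psi>[OF that] by simp_all
  have "N m \<subseteq> topspace M" if "m \<in> topspace M" for m
    using openin_subset[OF N(1)[OF that]] .
  then have "\<Union>(N ` topspace M) = topspace M" using N(2) by blast
  moreover have "\<forall>V\<in>N ` topspace M. openin M V" using N(1) by blast
  ultimately have "\<exists>\<V>. countable \<V> \<and> \<V> \<subseteq> N ` topspace M \<and> \<Union>\<V> = topspace M"
    using second_countable_imp_Lindelof_space[OF second_countable] unfolding Lindelof_space_def
    by (elim allE[of _ "N ` topspace M"]) simp
  then obtain \<V> where \<V>: "countable \<V>" "\<V> \<subseteq> N ` topspace M" "\<Union>\<V> = topspace M" by metis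
  obtain C where C: "countable C" "C \<subseteq> topspace M" "\<V> = N ` C"
    using \<V>(1,2) by (metis countable_subset_image)
  have "C \<noteq> {}" using False C(3) \<V>(3) by (metis Union_empty image_empty)
  define c where "c = from_nat_into C"
  have cC: "c i \<in> topspace M" for i using from_nat_into[OF \<open>C \<noteq> {}\<close>] C(2) by (auto simp: c_def)
  have rc: "range c = C" unfolding c_def by (rule range_from_nat_into[OF \<open>C \<noteq> {}\<close> C(1)])
  define R where "R i y = \<psi> (c i) y * (\<Prod>j<i. 1 - \<psi> (c j) y)" for i y
  have p: "smooth_function \<C> (\<psi> (c i))" "0 \<le> \<psi> (c i) y" "\<psi> (c i) y \<le> 1"
    "y \<in> topspace M \<Longrightarrow> y \<notin> U (c i) \<Longrightarrow> \<psi> (c i) y = 0" "y \<in> topspace M \<Longrightarrow> \<psi> (c i) (act \<sigma> y) = \<psi> (c i) y"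
    "openin M (N (c i))" "y \<in> N (c i) \<Longrightarrow> \<psi> (c i) y = 1" for i y \<sigma>
    using \<psi>[OF cC[of i]] by simp_all
  have comp: "smooth_open UNIV (\<lambda>x::real. 1 + - x)"
    by (intro smooth_open_add smooth_open_const smooth_open_linear bounded_linear_minus bounded_linear_ident) auto
  have sm1: "smooth_function \<C> (\<lambda>y. 1 - \<psi> (c j) y)" for j
    using smooth_function_compose[OF comp p(1)] by simp
  have "partition_of_unity U c R"
    unfolding partition_of_unity_def
  proof (intro conjI allI ballI)
    show "smooth_function \<C> (R i)" for i
      unfolding R_def by (intro smooth_function_mult p(1) smooth_function_prod sm1) auto
    show "0 \<le> R i y" for i y using p(2,3) by (simp add: R_def prod_nonneg)
    show "R i (act \<sigma> y) = R i y" if "y \<in> topspace M" for i \<sigma> y using p(5) that by (simp add: R_def)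
    show "R i y \<noteq> 0 \<longrightarrow> c i \<in> topspace M \<and> y \<in> U (c i)" if "y \<in> topspace M" for i y
      using p(4)[OF that] cC by (auto simp: R_def)
    fix y assume "y \<in> topspace M"
    then obtain k where k: "y \<in> N (c k)" using \<V>(3) C(3) rc by blast
    have "(\<forall>i\<ge>Suc k. R i z = 0) \<and> (\<Sum>i<Suc k. R i z) = 1" if z: "z \<in> N (c k)" for z
    proof
      have 1: "1 - \<psi> (c k) z = 0" using p(7)[OF z] by simp
      have 0: "(\<Prod>j<i. 1 - \<psi> (c j) z) = 0" if "i \<ge> Suc k" for i
        using 1 that by (intro prod_zero) auto
      then show "\<forall>i\<ge>Suc k. R i z = 0" by (simp add: R_def)
      show "(\<Sum>i<Suc k. R i z) = 1"
        unfolding R_def sum_successive_products using 0[of "Suc k"] by simp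
    qed
    then show "\<exists>N n. openin M N \<and> y \<in> N \<and> (\<forall>z\<in>N. (\<forall>i\<ge>n. R i z = 0) \<and> (\<Sum>i<n. R i z) = 1)"
      using p(6) k by blast
  qed
  then show thesis using that by blast
qed

text \<open>For a partition of unity the sum is finite near every point.\<close>

definition glue :: "(nat \<Rightarrow> 'm \<Rightarrow> real) \<Rightarrow> (nat \<Rightarrow> real) \<Rightarrow> 'm \<Rightarrow> real" where
  "glue R a y = (\<Sum>i. R i y * a i)"

lemma glue_local:
  assumes "partition_of_unity U c R" "y \<in> topspace M"
  obtains N n where "openin M N" "y \<in> N"
    "\<And>z a. z \<in> N \<Longrightarrow> glue R a z = (\<Sum>i<n. R i z * a i)" "\<And>z. z \<in> N \<Longrightarrow> (\<Sum>i<n. R i z) = 1"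
proof -
  obtain N n where N: "openin M N" "y \<in> N" "\<forall>z\<in>N. (\<forall>i\<ge>n. R i z = 0) \<and> (\<Sum>i<n. R i z) = 1"
    using assms unfolding partition_of_unity_def by blast
  have "glue R a z = (\<Sum>i<n. R i z * a i)" if "z \<in> N" for z a
    unfolding glue_def by (rule suminf_finite) (use N(3) that in auto)
  then show thesis using that N by blast
qed

lemma smooth_glue:
  assumes P: "partition_of_unity U c R" shows "smooth_function \<C> (glue R a)"
proof (rule smooth_function_local)
  fix y assume "y \<in> topspace M"
  then obtain N n where N: "openin M N" "y \<in> N" "\<And>z a. z \<in> N \<Longrightarrow> glue R a z = (\<Sum>i<n. R i z * a i)"
    using glue_local[OF P] by metis
  have "smooth_function \<C> (\<lambda>z. \<Sum>i<n. R i z * a i)"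
    using P unfolding partition_of_unity_def
    by (intro smooth_function_sum smooth_function_mult smooth_function_const) auto
  then show "\<exists>N g. openin M N \<and> y \<in> N \<and> smooth_function \<C> g \<and> (\<forall>z\<in>N. glue R a z = g z)"
    using N by blast
qed

lemma glue_act:
  "partition_of_unity U c R \<Longrightarrow> y \<in> topspace M \<Longrightarrow> glue R a (act \<sigma> y) = glue R a y"
  by (simp add: glue_def partition_of_unity_def)

text \<open>The glued value is a convex combination of the values attached to the sets that contain the
  point.\<close>

lemma glue_mono:
  assumes P: "partition_of_unity U c R" and y: "y \<in> topspace M"
    and le: "\<And>i. c i \<in> topspace M \<Longrightarrow> y \<in> U (c i) \<Longrightarrow> b \<le> a i"
  shows "b \<le> glue R a y"
proof -
  obtain N n where N: "y \<in> N" "\<And>z a. z \<in> N \<Longrightarrow> glue R a z = (\<Sum>i<n. R i z * a i)"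
    "\<And>z. z \<in> N \<Longrightarrow> (\<Sum>i<n. R i z) = 1"
    using glue_local[OF P y] by metis
  have "R i y * b \<le> R i y * a i" for i
    using partition_of_unityD[OF P y, of i] le[of i]
    by (cases "R i y = 0") (auto intro!: mult_left_mono)
  then have "(\<Sum>i<n. R i y * b) \<le> (\<Sum>i<n. R i y * a i)" by (intro sum_mono)
  then show ?thesis using N by (simp add: sum_distrib_right[symmetric])
qed

lemma glue_eq:
  assumes P: "partition_of_unity U c R" and y: "y \<in> topspace M"
    and eq: "\<And>i. c i \<in> topspace M \<Longrightarrow> y \<in> U (c i) \<Longrightarrow> a i = b"
  shows "glue R a y = b"
proof -
  obtain N n where N: "y \<in> N" "\<And>z a. z \<in> N \<Longrightarrow> glue R a z = (\<Sum>i<n. R i z * a i)"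
    "\<And>z. z \<in> N \<Longrightarrow> (\<Sum>i<n. R i z) = 1"
    using glue_local[OF P y] by metis
  have "R i y * a i = R i y * b" for i
    using partition_of_unityD[OF P y, of i] eq[of i] by (cases "R i y = 0") auto
  then have "(\<Sum>i<n. R i y * a i) = (\<Sum>i<n. R i y) * b" by (simp only: sum_distrib_right)
  then show ?thesis using N by simp
qed

lemma glue_le_imp_ex:
  assumes P: "partition_of_unity U c R" and y: "y \<in> topspace M" and le: "glue R a y \<le> b"
  obtains i where "c i \<in> topspace M" "y \<in> U (c i)" "a i \<le> b"
proof -
  obtain N n where N: "y \<in> N" "\<And>z a. z \<in> N \<Longrightarrow> glue R a z = (\<Sum>i<n. R i z * a i)"
    "\<And>z. z \<in> N \<Longrightarrow> (\<Sum>i<n. R i z) = 1"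
    using glue_local[OF P y] by metis
  have "\<exists>i. c i \<in> topspace M \<and> y \<in> U (c i) \<and> a i \<le> b"
  proof (rule ccontr)
    assume neg: "\<not> ?thesis"
    have pos: "R i y * (a i - b) > 0" if "R i y \<noteq> 0" for i
    proof -
      have "b < a i" using neg partition_of_unityD(2,3)[OF P y that] by (meson not_le)
      then show ?thesis using partition_of_unityD(1)[OF P y, of i] that by simp
    qed
    then have nn: "R i y * (a i - b) \<ge> 0" for i
      by (cases "R i y = 0") (simp_all add: less_imp_le)
    have "(\<Sum>i<n. R i y) \<noteq> 0" using N by simp
    then obtain k where "k < n" "R k y \<noteq> 0" by (meson lessThan_iff sum.neutral)
    then have sp: "(\<Sum>i<n. R i y * (a i - b)) > 0"
      using nn pos by (intro sum_pos2[of _ k]) simp_all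
    have "(\<Sum>i<n. R i y * (a i - b)) = (\<Sum>i<n. R i y * a i) - (\<Sum>i<n. R i y) * b"
      by (simp only: right_diff_distrib sum_subtractf sum_distrib_right)
    then have "glue R a y > b" using sp N by simp
    then show False using le by simp
  qed
  then show thesis using that by blast
qed

text \<open>For a partition of unity subordinate to relatively compact sets, \<open>\<Sum>i i R\<^sub>i\<close> is an exhaustion:
  where it is at most \<open>b\<close>, some \<open>R\<^sub>i\<close> with \<open>i \<le> b\<close> does not vanish.\<close>

lemma invariant_exhaustion:
  obtains f where "continuous_map M euclideanreal f" "\<And>y. y \<in> topspace M \<Longrightarrow> 0 \<le> f y"
    "\<And>y \<sigma>. y \<in> topspace M \<Longrightarrow> f (act \<sigma> y) = f y" "\<And>b. compactin M {y \<in> topspace M. f y \<le> b}"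
proof -
  have "\<exists>U K. openin M U \<and> invariant U \<and> m \<in> U \<and> U \<subseteq> K \<and> compactin M K" if m: "m \<in> topspace M" for m
  proof -
    obtain V \<phi> J where c: "chart V \<phi> J" "m \<in> V" using chart_at[OF m] by blast
    obtain r where r: "r > 0" "cball (\<phi> m) r \<subseteq> pdom V \<phi> J"
      using open_pdom[OF c(1)] chart_pdom[OF c] open_contains_cball by blast
    define K where "K = param V \<phi> J ` cball (\<phi> m) r"
    define W where "W = {y \<in> V. \<phi> y \<in> ball (\<phi> m) r}"
    have K: "compactin M K"
      unfolding K_def
    proof (rule image_compactin[OF _ continuous_param[OF c(1)]])
      show "compactin (top_of_set (pdom V \<phi> J)) (cball (\<phi> m) r)"
        using r(2) by (simp add: compactin_subtopology)
    qed
    have W: "openin M W" unfolding W_def by (rule openin_chart_vimage[OF c(1)]) auto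
    have WM: "W \<subseteq> topspace M" using W openin_subset by blast
    have "W \<subseteq> K"
      using param_chart[OF c(1)] by (force simp: W_def K_def image_iff intro: less_imp_le)
    then have "saturation W \<subseteq> saturation K" by (auto simp: saturation_def)
    moreover have "m \<in> saturation W" using subset_saturation[OF WM] c r by (auto simp: W_def)
    ultimately show ?thesis
      using openin_saturation[OF W] invariant_saturation[OF WM] compactin_saturation[OF K] by blast
  qed
  then obtain U K where UK: "\<And>m. m \<in> topspace M \<Longrightarrow> openin M (U m) \<and> invariant (U m) \<and> m \<in> U m \<and> U m \<subseteq> K m \<and> compactin M (K m)"
    by metis
  obtain c R where P: "partition_of_unity U c R"
    using partition_of_unity_exists[of U] UK by blast
  let ?f = "glue R real"
  have cont: "continuous_map M euclideanreal ?f" by (rule smooth_function_continuous[OF smooth_glue[OF P]])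
  show thesis
  proof
    show "0 \<le> ?f y" if "y \<in> topspace M" for y by (rule glue_mono[OF P that]) simp
    fix b
    have "{y \<in> topspace M. ?f y \<le> b} \<subseteq> \<Union>(K ` (c ` {i. real i \<le> b \<and> c i \<in> topspace M}))"
    proof
      fix y assume "y \<in> {y \<in> topspace M. ?f y \<le> b}"
      then obtain i where "c i \<in> topspace M" "y \<in> U (c i)" "real i \<le> b"
        using glue_le_imp_ex[OF P, of y real b] by blast
      then show "y \<in> \<Union>(K ` (c ` {i. real i \<le> b \<and> c i \<in> topspace M}))" using UK by blast
    qed
    moreover have "compactin M (\<Union>(K ` (c ` {i. real i \<le> b \<and> c i \<in> topspace M})))"
    proof (rule compactin_Union)
      have "{i. real i \<le> b \<and> c i \<in> topspace M} \<subseteq> {..nat \<lfloor>b\<rfloor>}" by (auto simp: le_nat_floor)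
      then have "finite {i. real i \<le> b \<and> c i \<in> topspace M}" by (rule finite_subset) simp
      then show "finite (K ` (c ` {i. real i \<le> b \<and> c i \<in> topspace M}))" by blast
    qed (use UK in auto)
    moreover have "closedin M {y \<in> topspace M. ?f y \<le> b}"
      using closedin_continuous_map_preimage[OF cont, of "{..b}"] by simp
    ultimately show "compactin M {y \<in> topspace M. ?f y \<le> b}"
      using closed_compactin by blast
  qed (use cont glue_act[OF P] in auto)
qed

end

section \<open>Linearization of the infinitesimal stabilizer\<close>

text \<open>Half of the inverse function theorem; invariance of domain will provide the other half, the
  continuity of the inverse.\<close>

lemma smooth_open_locally_injective:
  fixes f :: "'a::euclidean_space \<Rightarrow> 'a"
  assumes sm: "smooth_open W f" and x0: "x0 \<in> W" and id: "(f has_derivative (\<lambda>v. v)) (at x0)"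
  obtains r where "r > 0" "ball x0 r \<subseteq> W" "inj_on f (ball x0 r)"
proof -
  let ?f' = "\<lambda>x. frechet_derivative f (at x)"
  have op: "open W" using sm smooth_open_imp_open by blast
  have der: "(f has_derivative ?f' x) (at x)" if "x \<in> W" for x
    using smooth_open_has_derivative[OF sm that] .
  define D where "D x = Blinfun (?f' x)" for x
  have D: "blinfun_apply (D x) = ?f' x" if "x \<in> W" for x
    unfolding D_def using has_derivative_bounded_linear[OF der[OF that]] by (rule bounded_linear_Blinfun_apply)
  have "continuous_on W D"
  proof (rule continuous_on_blinfun_componentwise)
    fix b
    show "continuous_on W (\<lambda>x. blinfun_apply (D x) b)"
      by (rule continuous_on_eq[OF smooth_open_continuous_on[OF smooth_open_derivative[OF sm]]])
        (simp add: D)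
  qed
  then have cont: "\<exists>d>0. \<forall>x\<in>W. dist x x0 < d \<longrightarrow> dist (D x) (D x0) < e" if "e > 0" for e
    using x0 that unfolding continuous_on_iff by blast
  have f'x0: "?f' x0 = (\<lambda>v. v)" using frechet_derivative_at[OF id] by simp
  show thesis
  proof (rule has_derivative_locally_injective[where S = W and f = f and f' = ?f' and a = x0 and g' = "\<lambda>v. v"])
    show "\<exists>d>0. \<forall>x. dist x0 x < d \<longrightarrow> onorm (\<lambda>v. ?f' x v - ?f' x0 v) < e" if e: "e > 0" for e
    proof -
      obtain d1 where d1: "d1 > 0" "\<forall>x\<in>W. dist x x0 < d1 \<longrightarrow> dist (D x) (D x0) < e"
        using cont[OF e] by blast
      obtain d2 where d2: "d2 > 0" "ball x0 d2 \<subseteq> W" using openE[OF op x0] by blast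
      have "onorm (\<lambda>v. ?f' x v - ?f' x0 v) < e" if "dist x0 x < min d1 d2" for x
      proof -
        have xW: "x \<in> W" using that d2 by auto
        have "dist (D x) (D x0) < e" using d1(2)[rule_format, OF xW] that by (simp add: dist_commute)
        then have "onorm (blinfun_apply (D x - D x0)) < e"
          by (simp add: dist_norm norm_blinfun.rep_eq)
        moreover have "blinfun_apply (D x - D x0) = (\<lambda>v. ?f' x v - ?f' x0 v)"
          using D[OF xW] D[OF x0] by (auto simp: blinfun.diff_left)
        ultimately show ?thesis by simp
      qed
      then show ?thesis using d1(1) d2(1) by (intro exI[of _ "min d1 d2"]) simp
    qed
  qed (use x0 op der that f'x0 in \<open>auto simp: bounded_linear_ident o_def id_def\<close>)
qed

context torus_manifold
begin

text \<open>The stabilizer of \<open>p\<close> is not compact in \<open>real ^ 'n\<close>, but it is modulo periods, which act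
  trivially.\<close>

lemma openin_stab_core:
  assumes p: "p \<in> topspace M" and U: "openin M U"
  shows "openin M {y \<in> topspace M. \<forall>\<sigma>\<in>stab p. act \<sigma> y \<in> U}"
proof -
  let ?B = "cbox 0 (\<chi> i. 2 * pi) :: (real ^ 'n) set"
  have "closed (stab p)" using closed_subgroup_stab[OF p] by (simp add: closed_subgroup_def)
  then have "compact (stab p \<inter> ?B)" by (intro closed_Int_compact compact_cbox)
  from openin_act_forall[OF this U]
  have "openin M {y \<in> topspace M. \<forall>\<sigma>\<in>stab p \<inter> ?B. act \<sigma> y \<in> U}" .
  moreover have "act \<sigma> y \<in> U" if y: "y \<in> topspace M" "\<forall>\<sigma>\<in>stab p \<inter> ?B. act \<sigma> y \<in> U" and \<sigma>: "\<sigma> \<in> stab p" for \<sigma> y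
  proof -
    obtain h where h: "h \<in> ?B" "\<sigma> - h \<in> period_lattice" using reduce_mod_periods by blast
    have eq: "act \<sigma> z = act h z" if "z \<in> topspace M" for z
      using act_add[OF that, of h "\<sigma> - h"] act_period[OF h(2) that] by simp
    then have "h \<in> stab p" using \<sigma> p by (simp add: stab_def)
    then show ?thesis using eq[OF y(1)] y(2) h(1) by simp
  qed
  then have "{y \<in> topspace M. \<forall>\<sigma>\<in>stab p \<inter> ?B. act \<sigma> y \<in> U} = {y \<in> topspace M. \<forall>\<sigma>\<in>stab p. act \<sigma> y \<in> U}"
    by blast
  ultimately show ?thesis by simp
qed

end

locale torus_chart_at = torus_manifold M \<C> I \<rho>
  for M :: "'m topology" and \<C> :: "('m, 'd::finite) chart set"
    and I :: "'n::finite set" and \<rho> :: "complex ^ 'n \<Rightarrow> 'm \<Rightarrow> 'm" +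
  fixes p :: 'm and U :: "'m set" and \<phi> :: "'m \<Rightarrow> real ^ 'd" and J :: "'d set"
  assumes ch: "chart U \<phi> J" and pU: "p \<in> U"
begin

lemma pM: "p \<in> topspace M"
  using chart_subset[OF ch] pU by blast

text \<open>Only on points that the stabilizer of \<open>p\<close> does not move out of the chart can its action be
  written in the coordinates of the chart and averaged. The derivative \<open>B\<close> of this action at \<open>p\<close> is the
  isotropy representation.\<close>

definition core :: "'m set" where
  "core = {y \<in> topspace M. \<forall>\<sigma>\<in>stab p. act \<sigma> y \<in> U}"

definition coreD :: "(real ^ 'd) set" where
  "coreD = {x \<in> pdom U \<phi> J. param U \<phi> J x \<in> core}"

definition x0 :: "real ^ 'd" where "x0 = \<phi> p"

definition a :: "real ^ 'n \<Rightarrow> real ^ 'd \<Rightarrow> real ^ 'd" where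
  "a \<sigma> x = \<phi> (act \<sigma> (param U \<phi> J x))"

definition B :: "real ^ 'n \<Rightarrow> real ^ 'd \<Rightarrow> real ^ 'd" where
  "B \<sigma> = frechet_derivative (a \<sigma>) (at x0)"

lemma stab_group: "0 \<in> stab p" "\<sigma> \<in> stab p \<Longrightarrow> \<tau> \<in> stab p \<Longrightarrow> \<sigma> + \<tau> \<in> stab p"
  using closed_subgroup_stab[OF pM] by (simp_all add: closed_subgroup_def)

lemma lstab_stab: "\<xi> \<in> lstab p \<Longrightarrow> t *\<^sub>R \<xi> \<in> stab p"
  by (simp add: lstab_iff stab_def)

lemma openin_core: "openin M core"
  unfolding core_def by (rule openin_stab_core[OF pM chart_is_chart(1)[OF ch]])

lemma core_subset: "core \<subseteq> U"
proof
  fix y assume y: "y \<in> core"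
  then have "act 0 y \<in> U" using stab_group(1) unfolding core_def by blast
  then show "y \<in> U" using y by (simp add: core_def)
qed

lemma core_topspace: "y \<in> core \<Longrightarrow> y \<in> topspace M"
  by (simp add: core_def)

lemma p_core: "p \<in> core"
  using pM pU by (auto simp: core_def stab_def)

lemma act_core: "\<sigma> \<in> stab p \<Longrightarrow> y \<in> core \<Longrightarrow> act \<sigma> y \<in> core"
  using stab_group(2) by (auto simp: core_def act_add[symmetric])

lemma open_coreD: "open coreD"
  unfolding coreD_def by (rule open_param_vimage[OF ch openin_core])

lemma x0_coreD: "x0 \<in> coreD"
  using p_core pU ch by (simp add: coreD_def x0_def)

lemma x0_coord: "x0 \<in> coord_space J"
  using ch pU by (simp add: x0_def)

lemma chart_coreD: "y \<in> core \<Longrightarrow> \<phi> y \<in> coreD"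
  using core_subset ch by (auto simp: coreD_def)

lemma param_coreD: "x \<in> coreD \<Longrightarrow> param U \<phi> J x \<in> core"
  by (simp add: coreD_def)

lemma param_a: "\<sigma> \<in> stab p \<Longrightarrow> x \<in> coreD \<Longrightarrow> param U \<phi> J (a \<sigma> x) = act \<sigma> (param U \<phi> J x)"
  using act_core[of \<sigma>] core_subset param_coreD ch unfolding a_def by (blast intro: param_chart)

lemma a_coreD: "\<sigma> \<in> stab p \<Longrightarrow> x \<in> coreD \<Longrightarrow> a \<sigma> x \<in> coreD"
  unfolding a_def by (intro chart_coreD act_core param_coreD)

lemma a_add: "\<sigma> \<in> stab p \<Longrightarrow> \<tau> \<in> stab p \<Longrightarrow> x \<in> coreD \<Longrightarrow> a (\<sigma> + \<tau>) x = a \<sigma> (a \<tau> x)"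
  by (simp add: a_def[of "\<sigma> + \<tau>"] a_def[of \<sigma>] param_a act_add core_topspace param_coreD)

lemma a_0: "x \<in> coreD \<Longrightarrow> a 0 x = proj J x"
  using ch by (simp add: a_def core_topspace param_coreD) (simp add: coreD_def)

lemma a_proj: "a \<sigma> (proj J x) = a \<sigma> x"
  using ch by (simp add: a_def)

lemma a_x0: "\<sigma> \<in> stab p \<Longrightarrow> a \<sigma> x0 = x0"
  using ch pU by (simp add: a_def x0_def stab_def)

lemma a_period: "z \<in> period_lattice \<Longrightarrow> x \<in> coreD \<Longrightarrow> a (\<sigma> + z) x = a \<sigma> x"
  by (simp add: a_def act_add core_topspace param_coreD act_period)

lemma smooth_a_line:
  assumes "\<xi> \<in> lstab p" shows "smooth_open (UNIV \<times> coreD) (\<lambda>q. a (fst q *\<^sub>R \<xi>) (snd q))"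
proof -
  have op: "open (UNIV \<times> coreD)" using open_Times[OF open_UNIV open_coreD] .
  have "bounded_linear (\<lambda>q::real \<times> (real ^ 'd). (fst q *\<^sub>R \<xi>, snd q))"
    by (intro bounded_linear_Pair bounded_linear_pair_fst bounded_linear_scaleR_left bounded_linear_snd)
  note l = smooth_open_linear[OF op this]
  have "(\<lambda>q::real \<times> (real ^ 'd). (fst q *\<^sub>R \<xi>, snd q)) ` (UNIV \<times> coreD)
      \<subseteq> {q. snd q \<in> pdom U \<phi> J \<and> act (fst q) (param U \<phi> J (snd q)) \<in> U}"
    using lstab_stab[OF assms] act_core core_subset by (auto simp: coreD_def)
  from smooth_open_compose[OF smooth_act[OF ch ch] l this]
  show ?thesis by (simp add: a_def)
qed

lemma smooth_a:
  assumes "\<sigma> \<in> stab p" shows "smooth_open coreD (a \<sigma>)"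
proof -
  have l: "smooth_open coreD (\<lambda>x. (\<sigma>, x))"
    by (intro smooth_open_Pair smooth_open_const smooth_open_linear open_coreD bounded_linear_ident)
  have "(\<lambda>x. (\<sigma>, x)) ` coreD \<subseteq> {q. snd q \<in> pdom U \<phi> J \<and> act (fst q) (param U \<phi> J (snd q)) \<in> U}"
    using act_core[OF assms] core_subset by (auto simp: coreD_def)
  from smooth_open_compose[OF smooth_act[OF ch ch] l this]
  show ?thesis by (simp add: a_def[abs_def])
qed

lemma has_derivative_a: "\<sigma> \<in> stab p \<Longrightarrow> (a \<sigma> has_derivative B \<sigma>) (at x0)"
  unfolding B_def by (rule smooth_open_has_derivative[OF smooth_a x0_coreD])

lemma linear_B: "\<sigma> \<in> stab p \<Longrightarrow> linear (B \<sigma>)"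
  using has_derivative_a has_derivative_linear by blast

lemma has_derivative_eqI:
  assumes "(f has_derivative f') (at x0)" "(g has_derivative g') (at x0)" "\<And>x. x \<in> coreD \<Longrightarrow> f x = g x"
  shows "f' = g'"
  using has_derivative_transform_within_open[OF assms(1) open_coreD x0_coreD assms(3)] assms(2)
  by (rule has_derivative_unique)

lemma B_add: "\<sigma> \<in> stab p \<Longrightarrow> \<tau> \<in> stab p \<Longrightarrow> B (\<sigma> + \<tau>) v = B \<sigma> (B \<tau> v)"
proof -
  assume \<sigma>: "\<sigma> \<in> stab p" and \<tau>: "\<tau> \<in> stab p"
  have "(a \<sigma> \<circ> a \<tau> has_derivative B \<sigma> \<circ> B \<tau>) (at x0)"
    using \<sigma> \<tau> by (intro diff_chain_at) (simp_all add: has_derivative_a a_x0)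
  then have "B (\<sigma> + \<tau>) = B \<sigma> \<circ> B \<tau>"
    by (rule has_derivative_eqI[OF has_derivative_a[OF stab_group(2)[OF \<sigma> \<tau>]]]) (simp add: a_add \<sigma> \<tau>)
  then show ?thesis by simp
qed

lemma has_derivative_proj: "(proj J has_derivative proj J) F"
  using bounded_linear_imp_has_derivative[OF bounded_linear_proj] .

lemma B_0: "B 0 = proj J"
  by (rule has_derivative_eqI[OF has_derivative_a[OF stab_group(1)] has_derivative_proj a_0])

lemma B_proj: "\<sigma> \<in> stab p \<Longrightarrow> B \<sigma> (proj J v) = B \<sigma> v"
  using B_add[of \<sigma> 0 v] stab_group(1) by (simp add: B_0)

lemma B_coord: "\<sigma> \<in> stab p \<Longrightarrow> B \<sigma> v \<in> coord_space J"
  using B_add[of 0 \<sigma> v] stab_group(1) by (simp add: B_0 proj_eq_iff[symmetric])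

lemma B_period:
  assumes "z \<in> period_lattice" "\<sigma> \<in> stab p" shows "B (\<sigma> + z) = B \<sigma>"
proof (rule has_derivative_eqI[OF has_derivative_a has_derivative_a])
  show "\<sigma> + z \<in> stab p" using assms period_lattice_stab[OF pM] stab_group(2) by blast
qed (use assms a_period in auto)

lemma smooth_B_line:
  assumes \<xi>: "\<xi> \<in> lstab p" shows "smooth_open UNIV (\<lambda>t. B (t *\<^sub>R \<xi>) v)"
proof -
  let ?F = "\<lambda>q. a (fst q *\<^sub>R \<xi>) (snd q)"
  have "B (t *\<^sub>R \<xi>) v = frechet_derivative ?F (at (t, x0)) (0, v)" for t
  proof -
    have "((\<lambda>x. (t, x)) has_derivative (\<lambda>v. (0, v))) (at x0)"
      by (intro derivative_eq_intros) auto
    from diff_chain_at[OF this smooth_open_has_derivative[OF smooth_a_line[OF \<xi>]]]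
    have "((\<lambda>x. a (t *\<^sub>R \<xi>) x) has_derivative (\<lambda>v. frechet_derivative ?F (at (t, x0)) (0, v))) (at x0)"
      using x0_coreD by (simp add: o_def)
    from frechet_derivative_at[OF this, symmetric]
    have "B (t *\<^sub>R \<xi>) = (\<lambda>v. frechet_derivative ?F (at (t, x0)) (0, v))" unfolding B_def .
    then show ?thesis by simp
  qed
  moreover have "smooth_open UNIV (\<lambda>t. (t, x0))"
    by (intro smooth_open_Pair smooth_open_const smooth_open_linear bounded_linear_ident) auto
  from smooth_open_compose[OF smooth_open_derivative[OF smooth_a_line[OF \<xi>]] this]
  have "smooth_open UNIV (\<lambda>t. frechet_derivative ?F (at (t, x0)) (0, v))"
    using x0_coreD by auto
  ultimately show ?thesis by simp
qed

text \<open>Candidates for coordinates in which the action is linear. The derivative at \<open>p\<close> is the identity of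
  \<open>coord_space J\<close>, extended by the projection to all directions of the ambient space.\<close>

definition lin :: "(real ^ 'd \<Rightarrow> real ^ 'd) \<Rightarrow> bool" where
  "lin \<Phi> \<longleftrightarrow> smooth_open coreD \<Phi> \<and> \<Phi> x0 = 0 \<and> (\<Phi> has_derivative proj J) (at x0) \<and>
     (\<forall>x\<in>coreD. \<Phi> x \<in> coord_space J \<and> \<Phi> (proj J x) = \<Phi> x)"

definition eqv :: "(real ^ 'd \<Rightarrow> real ^ 'd) \<Rightarrow> real ^ 'n \<Rightarrow> bool" where
  "eqv \<Phi> \<sigma> \<longleftrightarrow> (\<forall>x\<in>coreD. \<Phi> (a \<sigma> x) = B \<sigma> (\<Phi> x))"

lemma lin_start: "lin (\<lambda>x. proj J x - x0)"
  unfolding lin_def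
proof (intro conjI ballI)
  have "smooth_open coreD (\<lambda>x. proj J x + - x0)"
    by (intro smooth_open_add smooth_open_linear smooth_open_const open_coreD bounded_linear_proj)
  then show "smooth_open coreD (\<lambda>x. proj J x - x0)" by simp
  show "((\<lambda>x. proj J x - x0) has_derivative proj J) (at x0)"
    using has_derivative_diff[OF has_derivative_proj has_derivative_const[of x0]] by simp
  show "proj J x - x0 \<in> coord_space J" for x
    using subspace_diff[OF subspace_coord_space proj_in x0_coord] .
qed (use x0_coord in auto)

text \<open>Averaging \<open>exp(-t \<xi>) \<circ> \<Phi> \<circ> exp(t \<xi>)\<close> over a circle makes \<open>\<Phi>\<close> equivariant under the circle, keeps
  the derivative at \<open>p\<close>, and keeps equivariance under everything that commutes with the circle.\<close>

lemma lin_average: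
  assumes \<Phi>: "lin \<Phi>" and \<xi>: "\<xi> \<in> lstab p" "\<xi> \<in> period_lattice"
  obtains \<Psi> where "lin \<Psi>" "\<And>s. eqv \<Psi> (s *\<^sub>R \<xi>)" "\<And>\<tau>. \<tau> \<in> stab p \<Longrightarrow> eqv \<Phi> \<tau> \<Longrightarrow> eqv \<Psi> \<tau>"
proof -
  have sm\<Phi>: "smooth_open coreD \<Phi>" and \<Phi>0: "\<Phi> x0 = 0" and der\<Phi>: "(\<Phi> has_derivative proj J) (at x0)"
    and \<Phi>c: "\<And>x. x \<in> coreD \<Longrightarrow> \<Phi> x \<in> coord_space J" and \<Phi>p: "\<And>x. x \<in> coreD \<Longrightarrow> \<Phi> (proj J x) = \<Phi> x"
    using \<Phi> unfolding lin_def by auto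
  have \<xi>': "- \<xi> \<in> lstab p" "- \<xi> \<in> period_lattice"
  proof -
    show "- \<xi> \<in> lstab p" using \<xi>(1) subspace_neg[OF subspace_lstab[OF pM]] by blast
    show "- \<xi> \<in> period_lattice"
      using \<xi>(2) unfolding period_lattice_def by simp (metis mult_minus_right of_int_minus)
  qed
  have tS: "t *\<^sub>R \<xi> \<in> stab p" "t *\<^sub>R (- \<xi>) \<in> stab p" for t using lstab_stab \<xi>(1) \<xi>'(1) by blast+
  define G where "G q = B (fst q *\<^sub>R (- \<xi>)) (\<Phi> (a (fst q *\<^sub>R \<xi>) (snd q)))" for q :: "real \<times> (real ^ 'd)"
  define \<Psi> where "\<Psi> x = integral {0..1} (\<lambda>t. G (t, x))" for x
  have op: "open (UNIV \<times> coreD)" using open_Times[OF open_UNIV open_coreD] .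
  have sG: "smooth_open (UNIV \<times> coreD) G"
  proof -
    have 1: "smooth_open (UNIV \<times> coreD) (\<lambda>q. \<Phi> (a (fst q *\<^sub>R \<xi>) (snd q)))"
      by (rule smooth_open_compose[OF sm\<Phi> smooth_a_line[OF \<xi>(1)]]) (use a_coreD[OF tS(1)] in auto)
    have 2: "smooth_open (UNIV \<times> coreD) (\<lambda>q::real \<times> (real ^ 'd). B (fst q *\<^sub>R (- \<xi>)) b)" for b
      by (rule smooth_open_compose[OF smooth_B_line[OF \<xi>'(1)] smooth_open_linear[OF op bounded_linear_fst]]) simp
    have "smooth_open (UNIV \<times> coreD) (\<lambda>q. \<Sum>b\<in>Basis. (\<Phi> (a (fst q *\<^sub>R \<xi>) (snd q)) \<bullet> b) *\<^sub>R B (fst q *\<^sub>R (- \<xi>)) b)"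
      by (intro smooth_open_sum op smooth_open_scaleR 2 smooth_open_linear_comp[OF bounded_linear_inner_left 1])
    then show ?thesis
    proof (rule smooth_open_cong)
      fix q :: "real \<times> (real ^ 'd)"
      note lin = linear_B[OF tS(2), of "fst q"]
      have "G q = B (fst q *\<^sub>R (- \<xi>)) (\<Sum>b\<in>Basis. (\<Phi> (a (fst q *\<^sub>R \<xi>) (snd q)) \<bullet> b) *\<^sub>R b)"
        by (simp only: G_def euclidean_representation)
      also have "\<dots> = (\<Sum>b\<in>Basis. (\<Phi> (a (fst q *\<^sub>R \<xi>) (snd q)) \<bullet> b) *\<^sub>R B (fst q *\<^sub>R (- \<xi>)) b)"
        by (simp only: linear_sum[OF lin] linear_scale[OF lin])
      finally show "(\<Sum>b\<in>Basis. (\<Phi> (a (fst q *\<^sub>R \<xi>) (snd q)) \<bullet> b) *\<^sub>R B (fst q *\<^sub>R (- \<xi>)) b) = G q" by simp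
    qed
  qed
  have contG: "continuous_on UNIV (\<lambda>t. G (t, x))" if "x \<in> coreD" for x
    by (rule continuous_on_compose2[OF smooth_open_continuous_on[OF sG]])
      (use that in \<open>auto intro!: continuous_intros\<close>)
  have intG: "(\<lambda>t. G (t, x)) integrable_on {0..1}" if "x \<in> coreD" for x
    by (rule integrable_continuous_real[OF continuous_on_subset[OF contG[OF that]]]) auto
  have lin_int: "L (\<Psi> x) = integral {0..1} (\<lambda>t. L (G (t, x)))" if "x \<in> coreD" "linear L" for L x
    using integral_linear[OF intG[OF that(1)], of L] that(2)
    by (simp add: \<Psi>_def o_def linear_conv_bounded_linear)
  have s\<Psi>: "smooth_open coreD \<Psi>"
    unfolding \<Psi>_def by (rule smooth_open_param_integral[OF open_coreD sG])
  have der\<Psi>: "(\<Psi> has_derivative proj J) (at x0)"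
  proof -
    have "frechet_derivative G (at (t, x0)) (0, v) = proj J v" for t v
    proof -
      have "((\<lambda>x. (t, x)) has_derivative (\<lambda>v. (0, v))) (at x0)"
        by (intro derivative_eq_intros) auto
      from diff_chain_at[OF this smooth_open_has_derivative[OF sG]]
      have 1: "((\<lambda>x. G (t, x)) has_derivative (\<lambda>v. frechet_derivative G (at (t, x0)) (0, v))) (at x0)"
        using x0_coreD by (simp add: o_def)
      have "(\<Phi> has_derivative proj J) (at (a (t *\<^sub>R \<xi>) x0))" using der\<Phi> a_x0[OF tS(1)] by simp
      from diff_chain_at[OF has_derivative_a[OF tS(1)] this]
      have "(\<Phi> \<circ> a (t *\<^sub>R \<xi>) has_derivative proj J \<circ> B (t *\<^sub>R \<xi>)) (at x0)" .
      from diff_chain_at[OF this linear_imp_has_derivative[OF linear_B[OF tS(2)]]]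
      have "((\<lambda>x. G (t, x)) has_derivative (\<lambda>v. B (t *\<^sub>R (- \<xi>)) (proj J (B (t *\<^sub>R \<xi>) v)))) (at x0)"
        by (simp add: o_def G_def)
      from has_derivative_unique[OF 1 this]
      have "frechet_derivative G (at (t, x0)) (0, v) = B (t *\<^sub>R (- \<xi>)) (proj J (B (t *\<^sub>R \<xi>) v))" by metis
      also have "\<dots> = B (t *\<^sub>R (- \<xi>) + t *\<^sub>R \<xi>) v" by (simp only: B_proj[OF tS(2)] B_add[OF tS(2) tS(1)])
      finally show ?thesis by (simp add: B_0)
    qed
    moreover have "Ck_on (Suc 0) (UNIV \<times> coreD) G" using sG unfolding smooth_open_def by blast
    from has_derivative_param_integral[OF open_coreD this x0_coreD]
    have "(\<Psi> has_derivative (\<lambda>v. integral {0..1} (\<lambda>t. frechet_derivative G (at (t, x0)) (0, v)))) (at x0)"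
      by (simp add: \<Psi>_def[abs_def])
    ultimately show ?thesis by simp
  qed
  have "lin \<Psi>"
    unfolding lin_def
  proof (intro conjI ballI s\<Psi> der\<Psi>)
    have "G (t, x0) = 0" for t
      using a_x0[OF tS(1)] \<Phi>0 linear_0[OF linear_B[OF tS(2)]] by (simp add: G_def)
    then show "\<Psi> x0 = 0" by (simp add: \<Psi>_def)
    fix x assume x: "x \<in> coreD"
    have "proj J (\<Psi> x) = integral {0..1} (\<lambda>t. proj J (G (t, x)))" by (rule lin_int[OF x linear_proj])
    also have "\<dots> = \<Psi> x" using B_coord[OF tS(2)] by (simp add: \<Psi>_def G_def)
    finally show "\<Psi> x \<in> coord_space J" by (simp add: proj_eq_iff)
    show "\<Psi> (proj J x) = \<Psi> x" by (simp add: \<Psi>_def G_def a_proj)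
  qed
  moreover have "eqv \<Psi> (s *\<^sub>R \<xi>)" for s
    unfolding eqv_def
  proof
    fix x assume x: "x \<in> coreD"
    define q where "q u = B (s *\<^sub>R \<xi>) (G (u, x))" for u
    have BB: "B (s *\<^sub>R \<xi>) (B (u *\<^sub>R (- \<xi>)) w) = B ((s - u) *\<^sub>R \<xi>) w" for u w
      using B_add[OF tS(1)[of s] tS(2)[of u], of w] by (simp add: scaleR_diff_left)
    have q: "q u = B ((s - u) *\<^sub>R \<xi>) (\<Phi> (a (u *\<^sub>R \<xi>) x))" for u
      by (simp only: q_def G_def BB fst_conv snd_conv)
    have "integral {0..1} (\<lambda>u. q (u + s)) = integral {0..1} q"
    proof (rule integral_periodic_shift)
      have "bounded_linear (B (s *\<^sub>R \<xi>))" using linear_B[OF tS(1)] linear_conv_bounded_linear by blast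
      from bounded_linear.continuous_on[OF this contG[OF x]]
      show "continuous_on UNIV q" by (simp add: q_def[abs_def])
      fix u
      have "(s - (u + 1)) *\<^sub>R \<xi> = (s - u) *\<^sub>R \<xi> + - \<xi>" "(u + 1) *\<^sub>R \<xi> = u *\<^sub>R \<xi> + \<xi>"
        by (simp_all add: algebra_simps)
      then show "q (u + 1) = q u"
        by (simp only: q B_period[OF \<xi>'(2) tS(1)] a_period[OF \<xi>(2) x])
    qed
    moreover have "q (u + s) = G (u, a (s *\<^sub>R \<xi>) x)" for u
    proof -
      have "a ((u + s) *\<^sub>R \<xi>) x = a (u *\<^sub>R \<xi>) (a (s *\<^sub>R \<xi>) x)"
        using a_add[OF tS(1)[of u] tS(1)[of s] x] by (simp add: scaleR_add_left)
      moreover have "(s - (u + s)) *\<^sub>R \<xi> = u *\<^sub>R (- \<xi>)" by simp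
      ultimately show ?thesis by (simp only: q_def G_def BB fst_conv snd_conv)
    qed
    moreover have "integral {0..1} q = B (s *\<^sub>R \<xi>) (\<Psi> x)"
      using lin_int[OF x linear_B[OF tS(1)[of s]]] by (simp add: q_def[abs_def])
    ultimately show "\<Psi> (a (s *\<^sub>R \<xi>) x) = B (s *\<^sub>R \<xi>) (\<Psi> x)" by (simp add: \<Psi>_def)
  qed
  moreover have "eqv \<Psi> \<tau>" if \<tau>: "\<tau> \<in> stab p" and e: "eqv \<Phi> \<tau>" for \<tau>
    unfolding eqv_def
  proof
    fix x assume x: "x \<in> coreD"
    have "G (t, a \<tau> x) = B \<tau> (G (t, x))" for t
    proof -
      have "a (t *\<^sub>R \<xi>) (a \<tau> x) = a \<tau> (a (t *\<^sub>R \<xi>) x)"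
        using a_add[OF tS(1)[of t] \<tau> x] a_add[OF \<tau> tS(1)[of t] x] by (simp add: add.commute)
      moreover have "\<Phi> (a \<tau> (a (t *\<^sub>R \<xi>) x)) = B \<tau> (\<Phi> (a (t *\<^sub>R \<xi>) x))"
        using e a_coreD[OF tS(1)[of t] x] by (simp add: eqv_def)
      moreover have "B (t *\<^sub>R (- \<xi>)) (B \<tau> w) = B \<tau> (B (t *\<^sub>R (- \<xi>)) w)" for w
        using B_add[OF tS(2)[of t] \<tau>, of w] B_add[OF \<tau> tS(2)[of t], of w] by (simp add: add.commute)
      ultimately show ?thesis by (simp only: G_def fst_conv snd_conv)
    qed
    then show "\<Psi> (a \<tau> x) = B \<tau> (\<Psi> x)"
      using lin_int[OF x linear_B[OF \<tau>]] by (simp add: \<Psi>_def)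
  qed
  ultimately show thesis using that by blast
qed

text \<open>One average for each element of a basis of periods.\<close>

lemma equivariant_coordinates:
  obtains \<Phi> where "lin \<Phi>" "\<And>\<sigma>. \<sigma> \<in> lstab p \<Longrightarrow> eqv \<Phi> \<sigma>"
proof -
  have sub: "subspace (lstab p)" by (rule subspace_lstab[OF pM])
  obtain Z where Z: "Z \<subseteq> lstab p \<inter> period_lattice" "independent Z" "lstab p \<inter> period_lattice \<subseteq> span Z"
    using maximal_independent_subset by blast
  have "finite Z" using Z(2) by (rule independent_imp_finite)
  then have "Z \<subseteq> lstab p \<inter> period_lattice \<Longrightarrow> \<exists>\<Phi>. lin \<Phi> \<and> (\<forall>\<xi>\<in>Z. \<forall>s. eqv \<Phi> (s *\<^sub>R \<xi>))"
  proof (induction Z rule: finite_induct)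
    case empty then show ?case using lin_start by blast
  next
    case (insert \<xi> Z)
    then obtain \<Phi> where \<Phi>: "lin \<Phi>" "\<forall>\<xi>\<in>Z. \<forall>s. eqv \<Phi> (s *\<^sub>R \<xi>)" by blast
    obtain \<Psi> where \<Psi>: "lin \<Psi>" "\<And>s. eqv \<Psi> (s *\<^sub>R \<xi>)" "\<And>\<tau>. \<tau> \<in> stab p \<Longrightarrow> eqv \<Phi> \<tau> \<Longrightarrow> eqv \<Psi> \<tau>"
      using lin_average[OF \<Phi>(1), of \<xi>] insert.prems by blast
    have "eqv \<Psi> (s *\<^sub>R \<zeta>)" if "\<zeta> \<in> Z" for \<zeta> s
      using \<Psi>(3) lstab_stab \<Phi>(2) that insert.prems by blast
    then show ?case using \<Psi>(1,2) by blast
  qed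
  then obtain \<Phi> where \<Phi>: "lin \<Phi>" "\<forall>\<xi>\<in>Z. \<forall>s. eqv \<Phi> (s *\<^sub>R \<xi>)" using Z(1) by blast
  have span: "lstab p = span Z"
  proof
    show "span Z \<subseteq> lstab p" using Z(1) sub by (simp add: span_minimal)
    have "span (lstab p \<inter> period_lattice) \<subseteq> span Z" using Z(3) by (simp add: span_minimal)
    then show "lstab p \<subseteq> span Z" using lstab_rational[OF pM] by simp
  qed
  have "\<sigma> \<in> stab p \<and> eqv \<Phi> \<sigma>" if "\<sigma> \<in> span Z" for \<sigma>
    using that
  proof (induction rule: span_induct_alt)
    case base
    show ?case using \<Phi>(1) stab_group(1) by (simp add: eqv_def a_0 B_0 lin_def)
  next
    case (step c \<xi> \<tau>)
    have "\<xi> \<in> lstab p" using step(1) Z(1) by blast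
    then have s: "c *\<^sub>R \<xi> \<in> stab p" by (rule lstab_stab)
    have \<tau>: "\<tau> \<in> stab p" "eqv \<Phi> \<tau>" using step(2) by simp_all
    have "\<Phi> (a (c *\<^sub>R \<xi> + \<tau>) x) = B (c *\<^sub>R \<xi> + \<tau>) (\<Phi> x)" if x: "x \<in> coreD" for x
      using \<tau>(2) \<Phi>(2) step(1) a_coreD[OF \<tau>(1) x] x
      by (simp add: a_add[OF s \<tau>(1) x] B_add[OF s \<tau>(1)] eqv_def)
    then show ?case using stab_group(2)[OF s \<tau>(1)] by (simp add: eqv_def)
  qed
  then show thesis using that \<Phi>(1) span by blast
qed

text \<open>In equivariant coordinates the infinitesimal stabilizers near \<open>p\<close> are those of the linear action
  of \<open>lstab p\<close> on \<open>coord_space J\<close>. Adding the identity of the complement of \<open>coord_space J\<close> makes the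
  derivative of the coordinate map invertible, so that the coordinates are a local homeomorphism.\<close>

lemma linear_model:
  obtains r \<kappa> where "r > 0" "continuous_map (top_of_set (ball 0 r \<inter> coord_space J)) M \<kappa>"
    "openin M (\<kappa> ` (ball 0 r \<inter> coord_space J))" "\<kappa> 0 = p"
    "\<And>e. e \<in> ball 0 r \<inter> coord_space J \<Longrightarrow> \<kappa> e \<in> topspace M \<and> lstab (\<kappa> e) \<subseteq> lstab p"
    "\<And>e \<sigma>. e \<in> ball 0 r \<inter> coord_space J \<Longrightarrow> \<sigma> \<in> lstab p \<Longrightarrow>
       \<sigma> \<in> lstab (\<kappa> e) \<longleftrightarrow> (\<forall>t. B (t *\<^sub>R \<sigma>) e = e)"
proof -
  obtain \<Phi> where \<Phi>: "lin \<Phi>" "\<And>\<sigma>. \<sigma> \<in> lstab p \<Longrightarrow> eqv \<Phi> \<sigma>"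
    using equivariant_coordinates by blast
  have sm\<Phi>: "smooth_open coreD \<Phi>" and \<Phi>0: "\<Phi> x0 = 0" and der\<Phi>: "(\<Phi> has_derivative proj J) (at x0)"
    and \<Phi>c: "\<And>x. x \<in> coreD \<Longrightarrow> \<Phi> x \<in> coord_space J"
    using \<Phi>(1) unfolding lin_def by auto
  define \<Theta> where "\<Theta> x = \<Phi> x + (x + - proj J x)" for x
  have lin1: "bounded_linear (\<lambda>x. x + - proj J x)"
    by (intro bounded_linear_add bounded_linear_ident bounded_linear_minus bounded_linear_proj)
  have sm\<Theta>: "smooth_open coreD \<Theta>"
    unfolding \<Theta>_def by (rule smooth_open_add[OF sm\<Phi> smooth_open_linear[OF open_coreD lin1]])
  have "(\<Theta> has_derivative (\<lambda>v. v)) (at x0)"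
    using has_derivative_add[OF der\<Phi> bounded_linear_imp_has_derivative[OF lin1]] by (simp add: \<Theta>_def[abs_def])
  then obtain r0 where r0: "r0 > 0" "ball x0 r0 \<subseteq> coreD" "inj_on \<Theta> (ball x0 r0)"
    using smooth_open_locally_injective[OF sm\<Theta> x0_coreD] by blast
  have \<Theta>_coord: "\<Theta> x \<in> coord_space J \<longleftrightarrow> x \<in> coord_space J" if "x \<in> coreD" for x
  proof -
    have "proj J (\<Theta> x) = \<Phi> x"
      using \<Phi>c[OF that] by (simp add: \<Theta>_def linear_add[OF linear_proj] linear_diff[OF linear_proj])
    then show ?thesis by (auto simp: proj_eq_iff[symmetric] \<Theta>_def)
  qed
  have \<Theta>_eq: "\<Theta> x = \<Phi> x" if "x \<in> coord_space J" for x using that by (simp add: \<Theta>_def)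
  have cont\<Theta>: "continuous_on (ball x0 r0) \<Theta>"
    using smooth_open_continuous_on[OF sm\<Theta>] r0(2) continuous_on_subset by blast
  obtain W0 where W0: "openin M W0" "p \<in> W0" "\<And>y. y \<in> W0 \<Longrightarrow> lstab y \<subseteq> lstab p"
    using lstab_semicontinuous[OF pM] by blast
  define U1 where "U1 = {y \<in> U. \<phi> y \<in> ball x0 r0}"
  have "openin M U1" unfolding U1_def by (rule openin_chart_vimage[OF ch]) simp
  \<comment> \<open>The orbits of the stabilizer of \<open>p\<close> in \<open>D1\<close> stay where \<open>\<Theta>\<close> is injective; this makes fixed points
    recognizable in coordinates.\<close>
  define D1 where "D1 = {y \<in> topspace M. \<forall>\<sigma>\<in>stab p. act \<sigma> y \<in> U1} \<inter> W0"
  have opD1: "openin M D1"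
    unfolding D1_def by (intro openin_Int openin_stab_core[OF pM \<open>openin M U1\<close>] W0(1))
  have D1: "act \<sigma> y \<in> U1" if "y \<in> D1" "\<sigma> \<in> stab p" for y \<sigma> using that by (simp add: D1_def)
  have D1M: "y \<in> topspace M" "y \<in> W0" if "y \<in> D1" for y using that by (simp_all add: D1_def)
  have D1U: "y \<in> U1" if "y \<in> D1" for y using D1[OF that stab_group(1)] D1M(1)[OF that] by simp
  have pD1: "p \<in> D1"
    using pM W0(2) pU r0(1) by (auto simp: D1_def stab_def U1_def x0_def)
  define N where "N = ball x0 r0 \<inter> {x \<in> pdom U \<phi> J. param U \<phi> J x \<in> D1}"
  have "open N" unfolding N_def by (intro open_Int open_ball open_param_vimage[OF ch opD1])
  have injN: "inj_on \<Theta> N" "continuous_on N \<Theta>"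
    unfolding N_def by (rule inj_on_subset[OF r0(3)], simp) (rule continuous_on_subset[OF cont\<Theta>], simp)
  obtain \<iota> where \<iota>: "homeomorphism N (\<Theta> ` N) \<Theta> \<iota>"
    using invariance_of_domain_homeomorphism[OF \<open>open N\<close> injN(2) _ injN(1)] by blast
  have opN: "open (\<Theta> ` N)" using invariance_of_domain[OF injN(2) \<open>open N\<close> injN(1)] .
  have x0N: "x0 \<in> N" using r0(1) pD1 ch pU by (simp add: N_def x0_def)
  moreover have \<Theta>0: "\<Theta> x0 = 0" using \<Theta>_eq[OF x0_coord] \<Phi>0 by simp
  ultimately have "0 \<in> \<Theta> ` N" by (metis imageI)
  then obtain r where r: "r > 0" "ball 0 r \<subseteq> \<Theta> ` N" using openE[OF opN] by blast
  let ?A = "ball 0 r \<inter> coord_space J"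
  define \<kappa> where "\<kappa> e = param U \<phi> J (\<iota> e)" for e
  have \<iota>N: "\<iota> e \<in> N" "\<Theta> (\<iota> e) = e" if "e \<in> ball 0 r" for e
  proof -
    obtain x where "x \<in> N" "e = \<Theta> x" using r(2) \<open>e \<in> ball 0 r\<close> by blast
    then show "\<iota> e \<in> N" "\<Theta> (\<iota> e) = e" by (simp_all add: homeomorphism_apply1[OF \<iota>])
  qed
  have N_core: "N \<subseteq> coreD" "N \<subseteq> pdom U \<phi> J" using r0(2) by (auto simp: N_def)
  have \<iota>c: "\<iota> e \<in> coord_space J" "\<Phi> (\<iota> e) = e" if "e \<in> ?A" for e
  proof -
    show "\<iota> e \<in> coord_space J"
      using \<Theta>_coord[of "\<iota> e"] \<iota>N[of e] N_core(1) that by auto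
    then show "\<Phi> (\<iota> e) = e" using \<Theta>_eq \<iota>N(2)[of e] that by simp
  qed
  have \<kappa>D1: "\<kappa> e \<in> D1" if "e \<in> ball 0 r" for e using \<iota>N(1)[OF that] by (simp add: \<kappa>_def N_def)
  have \<phi>\<kappa>: "\<phi> (\<kappa> e) = \<iota> e" if "e \<in> ?A" for e
    using \<iota>c(1)[OF that] \<iota>N(1)[of e] N_core(2) that chart_param[OF ch, of "\<iota> e"] by (auto simp: \<kappa>_def)
  show thesis
  proof
    show "r > 0" by (rule r(1))
    have "continuous_map (top_of_set ?A) (top_of_set (pdom U \<phi> J)) \<iota>"
    proof -
      have "continuous_on (\<Theta> ` N) \<iota>" using \<iota> homeomorphism_cont2 by blast
      then have "continuous_on ?A \<iota>" by (rule continuous_on_subset) (use r(2) in blast)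
      then show ?thesis using \<iota>N(1) N_core(2) by (auto simp: continuous_map_in_subtopology)
    qed
    from continuous_map_compose[OF this continuous_param[OF ch]]
    show "continuous_map (top_of_set ?A) M \<kappa>" by (simp add: \<kappa>_def[abs_def] o_def)
    have "open (N \<inter> \<Theta> -` ball 0 r)"
      by (rule continuous_open_preimage[OF injN(2) \<open>open N\<close> open_ball])
    from openin_Int[OF opD1 openin_chart_vimage[OF ch this]]
    have "openin M (D1 \<inter> {y \<in> U. \<phi> y \<in> N \<inter> \<Theta> -` ball 0 r})" .
    moreover have "D1 \<inter> {y \<in> U. \<phi> y \<in> N \<inter> \<Theta> -` ball 0 r} = \<kappa> ` ?A"
    proof
      show "D1 \<inter> {y \<in> U. \<phi> y \<in> N \<inter> \<Theta> -` ball 0 r} \<subseteq> \<kappa> ` ?A"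
      proof
        fix y assume y: "y \<in> D1 \<inter> {y \<in> U. \<phi> y \<in> N \<inter> \<Theta> -` ball 0 r}"
        then have "\<phi> y \<in> coord_space J" using chart_coord[OF ch] by blast
        then have "\<Theta> (\<phi> y) \<in> ?A" using \<Theta>_coord[of "\<phi> y"] y N_core(1) by auto
        moreover have "\<iota> (\<Theta> (\<phi> y)) = \<phi> y" using homeomorphism_apply1[OF \<iota>] y by simp
        then have "\<kappa> (\<Theta> (\<phi> y)) = y" using y param_chart[OF ch] by (simp add: \<kappa>_def)
        ultimately show "y \<in> \<kappa> ` ?A" by (metis imageI)
      qed
      show "\<kappa> ` ?A \<subseteq> D1 \<inter> {y \<in> U. \<phi> y \<in> N \<inter> \<Theta> -` ball 0 r}"
        using \<kappa>D1 D1U \<phi>\<kappa> \<iota>N by (auto simp: U1_def)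
    qed
    ultimately show "openin M (\<kappa> ` ?A)" by simp
    have "\<iota> 0 = x0" using homeomorphism_apply1[OF \<iota> x0N] \<Theta>0 by simp
    then show "\<kappa> 0 = p" using ch pU by (simp add: \<kappa>_def x0_def)
    fix e assume e: "e \<in> ?A"
    then have D: "\<kappa> e \<in> D1" using \<kappa>D1 by blast
    then show "\<kappa> e \<in> topspace M \<and> lstab (\<kappa> e) \<subseteq> lstab p" using D1M W0(3) by blast
    fix \<sigma> assume \<sigma>: "\<sigma> \<in> lstab p"
    have "act (t *\<^sub>R \<sigma>) (\<kappa> e) = \<kappa> e \<longleftrightarrow> B (t *\<^sub>R \<sigma>) e = e" for t
    proof -
      let ?y = "act (t *\<^sub>R \<sigma>) (\<kappa> e)"
      have tS: "t *\<^sub>R \<sigma> \<in> lstab p" using subspace_scale[OF subspace_lstab[OF pM] \<sigma>] .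
      have y: "?y \<in> U1" "\<kappa> e \<in> U1" using D1[OF D lstab_stab[OF \<sigma>]] D1U[OF D] by blast+
      have e': "\<iota> e \<in> coreD" using \<iota>N(1)[of e] N_core(1) e by blast
      have "\<phi> ?y = a (t *\<^sub>R \<sigma>) (\<iota> e)" by (simp add: a_def \<kappa>_def)
      then have "\<Phi> (\<phi> ?y) = B (t *\<^sub>R \<sigma>) e"
        using \<Phi>(2)[OF tS] e' \<iota>c(2)[OF e] by (simp add: eqv_def)
      moreover have "\<Phi> (\<phi> (\<kappa> e)) = e" using \<phi>\<kappa>[OF e] \<iota>c(2)[OF e] by simp
      moreover have "\<Phi> (\<phi> z) = \<Theta> (\<phi> z)" if "z \<in> U1" for z
        using that chart_coord[OF ch] by (simp add: U1_def \<Theta>_eq)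
      ultimately have "B (t *\<^sub>R \<sigma>) e = e \<longleftrightarrow> \<Theta> (\<phi> ?y) = \<Theta> (\<phi> (\<kappa> e))" using y by simp
      also have "\<dots> \<longleftrightarrow> \<phi> ?y = \<phi> (\<kappa> e)"
        using y inj_on_eq_iff[OF r0(3)] by (simp add: U1_def)
      also have "\<dots> \<longleftrightarrow> ?y = \<kappa> e"
        using y inj_on_eq_iff[OF chart_inj[OF ch]] by (simp add: U1_def)
      finally show ?thesis by simp
    qed
    then show "\<sigma> \<in> lstab (\<kappa> e) \<longleftrightarrow> (\<forall>t. B (t *\<^sub>R \<sigma>) e = e)" by (simp add: lstab_iff)
  qed
qed

end

section \<open>The strata near a point\<close>

text \<open>The vectors fixed by a circle of linear maps have no complement of dimension one: on a
  one-dimensional quotient the circle would act by a nonnegative character \<open>c\<close> with \<open>c 1 = 1\<close>, so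
  \<open>c (1/n) = 1\<close> for all \<open>n\<close>. Then \<open>b (1/n)\<close> moves \<open>y\<close> by a fixed vector \<open>q\<close>, its \<open>n\<close>-th power \<open>b 1\<close> moves \<open>y\<close> by \<open>n q\<close>,
  hence \<open>q = 0\<close>. So \<open>y\<close> is fixed at rational times, and by continuity at all times.\<close>

lemma circle_fixed_space_codim:
  fixes b :: "real \<Rightarrow> 'a::euclidean_space \<Rightarrow> 'a"
  assumes F: "subspace F" and lin: "\<And>t. linear (b t)" and bF: "\<And>t e. e \<in> F \<Longrightarrow> b t e \<in> F"
    and add: "\<And>s t e. e \<in> F \<Longrightarrow> b (s + t) e = b s (b t e)" and b0: "\<And>e. e \<in> F \<Longrightarrow> b 0 e = e"
    and b1: "\<And>e. e \<in> F \<Longrightarrow> b 1 e = e" and cont: "\<And>e. continuous_on UNIV (\<lambda>t. b t e)"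
    and P: "P = {e \<in> F. \<forall>t. b t e = e}" and y: "y \<in> F - P"
  shows "span (insert y P) \<noteq> F"
proof
  assume span: "span (insert y P) = F"
  have subP: "subspace P"
    unfolding P using F lin
    by (auto simp: subspace_def linear_add linear_scale linear_0)
  have "\<exists>c. b t y - c *\<^sub>R y \<in> P" for t
  proof -
    have "b t y \<in> span (insert y P)" using bF[of y t] y span by simp
    then show ?thesis using span_breakdown_eq[of "b t y" y P] span_eq_iff[THEN iffD2, OF subP] by simp
  qed
  then obtain c where c: "\<And>t. b t y - c t *\<^sub>R y \<in> P" by metis
  have uniq: "k = 0" if "k *\<^sub>R y \<in> P" for k
    using that subspace_scale[OF subP that, of "1 / k"] y by (cases "k = 0") auto
  have fx: "b t e = e" if "e \<in> P" for t e using that P by blast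
  have c_add: "c (s + t) = c s * c t" for s t
  proof -
    have "b s (b t y) = b s ((b t y - c t *\<^sub>R y) + c t *\<^sub>R y)" by simp
    also have "\<dots> = (b t y - c t *\<^sub>R y) + c t *\<^sub>R b s y"
      by (simp only: linear_add[OF lin] linear_scale[OF lin] fx[OF c])
    finally have "b (s + t) y = (b t y - c t *\<^sub>R y) + c t *\<^sub>R b s y" using add y by simp
    then have "(c (s + t) - c s * c t) *\<^sub>R y = (b t y - c t *\<^sub>R y) + c t *\<^sub>R (b s y - c s *\<^sub>R y) - (b (s + t) y - c (s + t) *\<^sub>R y)"
      by (simp add: algebra_simps)
    also have "\<dots> \<in> P" by (intro subspace_diff subspace_add subspace_scale subP c)
    finally show ?thesis using uniq by force
  qed
  have c1: "c 1 = 1"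
  proof -
    have "(1 - c 1) *\<^sub>R y \<in> P" using c[of 1] b1 y by (simp add: algebra_simps)
    then show ?thesis using uniq by force
  qed
  have c_nonneg: "c t \<ge> 0" for t using c_add[of "t/2" "t/2"] by simp
  have c_nat: "c (real n * t) = c t ^ n" if "n > 0" for n t
    using that
  proof (induction n rule: nat_induct_non_zero)
    case (Suc n) then show ?case using c_add[of t "real n * t"] by (simp add: algebra_simps)
  qed simp
  have b_frac: "b (1 / real n) y = y" if n: "n > 0" for n
  proof -
    have "c (1 / real n) ^ n = 1" using c_nat[OF n, of "1 / real n"] n c1 by simp
    then have cn: "c (1 / real n) = 1" using c_nonneg n by (metis power_eq_1_iff real_norm_def abs_of_nonneg not_gr_zero)
    define q where "q = b (1 / real n) y - y"
    have q: "q \<in> P" using c[of "1 / real n"] cn by (simp add: q_def)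
    have "b (real m * (1 / real n)) y = y + real m *\<^sub>R q" for m
    proof (induction m)
      case 0 then show ?case using b0 y by simp
    next
      case (Suc m)
      have "b (real (Suc m) * (1 / real n)) y = b (1 / real n) (b (real m * (1 / real n)) y)"
        using add[of y "1 / real n" "real m * (1 / real n)"] y by (simp add: algebra_simps add_divide_distrib)
      also have "\<dots> = b (1 / real n) y + real m *\<^sub>R q"
        by (simp only: Suc.IH linear_add[OF lin] linear_scale[OF lin] fx[OF q])
      also have "\<dots> = y + real (Suc m) *\<^sub>R q" by (simp add: q_def algebra_simps)
      finally show ?case .
    qed
    from this[of n] have "real n *\<^sub>R q = 0" using n b1 y by simp
    then show ?thesis using n by (simp add: q_def)
  qed
  have b_nat: "b (real m * t) y = y" if "b t y = y" for m t
  proof (induction m)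
    case 0 then show ?case using b0 y by simp
  next
    case (Suc m) then show ?case using add[of y t "real m * t"] that y by (simp add: algebra_simps)
  qed
  have b_neg: "b (- t) y = y" if "b t y = y" for t
    using add[of y "- t" t] that b0 y by simp
  have b_rat: "b q y = y" if qR: "q \<in> \<rat>" for q
  proof -
    obtain i n where q: "n \<noteq> 0" "q = real_of_int i / real n" using qR unfolding Rats_eq_int_div_nat by blast
    have "b (real (nat \<bar>i\<bar>) * (1 / real n)) y = y" by (rule b_nat[OF b_frac]) (use q(1) in simp)
    then show ?thesis using q(2) b_neg[of "real_of_int (- i) / real n"] by (cases "i \<ge> 0") simp_all
  qed
  have "closed {t. b t y = y}"
    using continuous_closed_preimage_constant[OF cont[of y] closed_UNIV, of y] by simp
  then have op: "open (- {t. b t y = y})" by (simp add: closed_def)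
  have "b t y = y" for t
  proof (rule ccontr)
    assume "b t y \<noteq> y"
    then obtain e where e: "e > 0" "ball t e \<subseteq> - {t. b t y = y}" using openE[OF op, of t] by auto
    obtain q where q: "q \<in> \<rat>" "t < q" "q < t + e" using Rats_dense_in_real[of t "t + e"] e(1) by auto
    then have "q \<in> ball t e" by (simp add: dist_real_def)
    then show False using b_rat[OF q(1)] e(2) by blast
  qed
  then show False using y P by blast
qed

context torus_manifold
begin

text \<open>In the linear model, the points with infinitesimal stabilizer \<open>k\<close> are the fixed vectors of \<open>k\<close> that
  are not fixed by any of the countably many periods in \<open>lstab p - k\<close>; here the rationality of the
  infinitesimal stabilizers is used.\<close>

lemma local_strata:
  assumes p: "p \<in> topspace M"
  obtains W where "openin M W" "p \<in> W" "\<And>y. y \<in> W \<Longrightarrow> lstab y \<subseteq> lstab p"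
    "\<And>x. x \<in> W \<Longrightarrow> connectedin M {y \<in> W. lstab y = lstab x}"
    "\<And>x. x \<in> W \<Longrightarrow> {y \<in> W. lstab x \<subseteq> lstab y} \<subseteq> M closure_of {y \<in> W. lstab y = lstab x}"
proof -
  obtain U \<phi> J where c: "chart U \<phi> J" "p \<in> U" using chart_at[OF p] by blast
  interpret torus_chart_at M \<C> I \<rho> p U \<phi> J by unfold_locales (use c in auto)
  obtain r \<kappa> where r: "r > 0" and cont: "continuous_map (top_of_set (ball 0 r \<inter> coord_space J)) M \<kappa>"
    and opW: "openin M (\<kappa> ` (ball 0 r \<inter> coord_space J))" and \<kappa>0: "\<kappa> 0 = p"
    and \<kappa>: "\<And>e. e \<in> ball 0 r \<inter> coord_space J \<Longrightarrow> \<kappa> e \<in> topspace M \<and> lstab (\<kappa> e) \<subseteq> lstab p"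
    and fx: "\<And>e \<sigma>. e \<in> ball 0 r \<inter> coord_space J \<Longrightarrow> \<sigma> \<in> lstab p \<Longrightarrow>
       \<sigma> \<in> lstab (\<kappa> e) \<longleftrightarrow> (\<forall>t. B (t *\<^sub>R \<sigma>) e = e)"
    using linear_model by blast
  let ?A = "ball 0 r \<inter> coord_space J"
  have main: "connectedin M {y \<in> \<kappa> ` ?A. lstab y = lstab x} \<and>
      {y \<in> \<kappa> ` ?A. lstab x \<subseteq> lstab y} \<subseteq> M closure_of {y \<in> \<kappa> ` ?A. lstab y = lstab x}"
    if x: "x \<in> \<kappa> ` ?A" for x
  proof -
    obtain e0 where e0: "e0 \<in> ?A" "x = \<kappa> e0" using x by blast
    define k where "k = lstab x"
    have k: "k \<subseteq> lstab p" "subspace k" using \<kappa>[OF e0(1)] e0(2) subspace_lstab by (auto simp: k_def)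
    define F where "F = {e \<in> coord_space J. \<forall>\<sigma>\<in>k. \<forall>t. B (t *\<^sub>R \<sigma>) e = e}"
    define Z where "Z = (lstab p \<inter> period_lattice) - k"
    define P where "P z = {e \<in> F. \<forall>t. B (t *\<^sub>R z) e = e}" for z
    have linB: "linear (B (t *\<^sub>R \<sigma>))" if "\<sigma> \<in> lstab p" for t \<sigma> using linear_B[OF lstab_stab[OF that]] .
    have subF: "subspace F"
      unfolding F_def using subspace_coord_space[of J] linB k(1)
      by (auto simp: subspace_def linear_add linear_scale linear_0 subset_iff)
    have subP: "subspace (P z)" if "z \<in> lstab p" for z
      unfolding P_def using subF linB[OF that]
      by (auto simp: subspace_def linear_add linear_scale linear_0)
    have F_iff: "e \<in> F \<longleftrightarrow> k \<subseteq> lstab (\<kappa> e)" if "e \<in> ?A" for e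
      using fx[OF that] k(1) that by (auto simp: F_def)
    have k_iff: "lstab (\<kappa> e) = k \<longleftrightarrow> e \<in> F - \<Union>(P ` Z)" if e: "e \<in> ?A" for e
    proof
      assume eq: "lstab (\<kappa> e) = k"
      have "e \<notin> P z" if "z \<in> Z" for z
        using fx[OF e, of z] that eq by (auto simp: P_def Z_def)
      then show "e \<in> F - \<Union>(P ` Z)" using F_iff[OF e] eq by blast
    next
      assume R: "e \<in> F - \<Union>(P ` Z)"
      have "lstab (\<kappa> e) \<inter> period_lattice \<subseteq> k"
      proof
        fix z assume z: "z \<in> lstab (\<kappa> e) \<inter> period_lattice"
        then have zp: "z \<in> lstab p" using \<kappa>[OF e] by blast
        show "z \<in> k"
        proof (rule ccontr)
          assume "z \<notin> k"
          then have "z \<in> Z" using z zp by (simp add: Z_def)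
          moreover have "e \<in> P z" using fx[OF e zp] z R by (simp add: P_def)
          ultimately show False using R by blast
        qed
      qed
      then have "lstab (\<kappa> e) \<subseteq> k"
        using lstab_rational[of "\<kappa> e"] \<kappa>[OF e] span_minimal[OF _ k(2)] by blast
      then show "lstab (\<kappa> e) = k" using F_iff[OF e] R by blast
    qed
    have e0': "e0 \<in> F - \<Union>(P ` Z)" using k_iff[OF e0(1)] e0(2) k_def by simp
    have FJ: "F \<subseteq> coord_space J" by (auto simp: F_def)
    have cZ: "countable (P ` Z)"
      unfolding Z_def by (intro countable_image) (meson countable_Diff countable_Int2 countable_period_lattice)
    have PF: "subspace Q \<and> Q \<subset> F" if Q: "Q \<in> P ` Z" for Q
    proof -
      obtain z where z: "z \<in> Z" "Q = P z" using Q by blast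
      have "e0 \<in> F - P z" using e0' z by blast
      then show ?thesis using subP[of z] z by (auto simp: P_def Z_def)
    qed
    have codim: "span (insert y Q) \<noteq> F" if Q: "Q \<in> P ` Z" and y: "y \<in> F - Q" for Q y
    proof -
      obtain z where z: "z \<in> lstab p" "z \<in> period_lattice" "Q = P z" using Q by (auto simp: Z_def)
      show ?thesis
      proof (rule circle_fixed_space_codim[where b = "\<lambda>t. B (t *\<^sub>R z)"])
        show "subspace F" by (rule subF)
        show "linear (B (t *\<^sub>R z))" for t by (rule linB[OF z(1)])
        note S = lstab_stab[OF z(1)]
        show "B (t *\<^sub>R z) e \<in> F" if e: "e \<in> F" for t e
          unfolding F_def
        proof (intro CollectI conjI ballI allI)
          show "B (t *\<^sub>R z) e \<in> coord_space J" by (rule B_coord[OF S])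
          fix \<sigma> s assume "\<sigma> \<in> k"
          then have s: "s *\<^sub>R \<sigma> \<in> stab p" "B (s *\<^sub>R \<sigma>) e = e" using k(1) lstab_stab e by (auto simp: F_def)
          show "B (s *\<^sub>R \<sigma>) (B (t *\<^sub>R z) e) = B (t *\<^sub>R z) e"
            using B_add[OF s(1) S[of t], of e] B_add[OF S[of t] s(1), of e] s(2) by (simp add: add.commute)
        qed
        show "B ((s + t) *\<^sub>R z) e = B (s *\<^sub>R z) (B (t *\<^sub>R z) e)" for s t e
          using B_add[OF S S] by (simp add: scaleR_add_left)
        show "B (0 *\<^sub>R z) e = e" if "e \<in> F" for e using that FJ by (auto simp: B_0)
        show "B (1 *\<^sub>R z) e = e" if "e \<in> F" for e
          using B_period[OF z(2) stab_group(1)] that FJ by (auto simp: B_0)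
        show "continuous_on UNIV (\<lambda>t. B (t *\<^sub>R z) e)" for e
          by (rule smooth_open_continuous_on[OF smooth_B_line[OF z(1)]])
        show "Q = {e \<in> F. \<forall>t. B (t *\<^sub>R z) e = e}" using z(3) by (simp add: P_def)
      qed (rule y)
    qed
    let ?S = "ball 0 r \<inter> F - \<Union>(P ` Z)"
    have conn: "connected ?S" by (rule connected_complement_codim2[OF subF cZ PF codim])
    have dense: "ball 0 r \<inter> F \<subseteq> closure ?S" by (rule subspaces_complement_dense[OF subF cZ PF])
    have SA: "?S \<subseteq> ?A" using FJ by blast
    have imS: "\<kappa> ` ?S = {y \<in> \<kappa> ` ?A. lstab y = k}" 
    proof (rule subset_antisym; rule subsetI)
      fix y assume "y \<in> \<kappa> ` ?S"
      then obtain e where e: "e \<in> ?S" "y = \<kappa> e" by blast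
      then have "e \<in> ?A" using FJ by blast
      then show "y \<in> {y \<in> \<kappa> ` ?A. lstab y = k}" using k_iff[of e] e by blast
    next
      fix y assume "y \<in> {y \<in> \<kappa> ` ?A. lstab y = k}"
      then obtain e where e: "e \<in> ?A" "y = \<kappa> e" "lstab y = k" by blast
      then have "e \<in> F - \<Union>(P ` Z)" using k_iff[of e] by simp
      then show "y \<in> \<kappa> ` ?S" using e by blast
    qed
    have imF: "{y \<in> \<kappa> ` ?A. k \<subseteq> lstab y} \<subseteq> \<kappa> ` (ball 0 r \<inter> F)" using F_iff by auto
    have "connectedin (top_of_set ?A) ?S" using conn SA by (simp add: connectedin_subtopology)
    from connectedin_continuous_map_image[OF cont this]
    have 1: "connectedin M (\<kappa> ` ?S)" .
    have "ball 0 r \<inter> F \<subseteq> (top_of_set ?A) closure_of ?S"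
      using dense SA FJ by (auto simp: closure_of_subtopology Int_absorb1)
    then have "\<kappa> ` (ball 0 r \<inter> F) \<subseteq> \<kappa> ` ((top_of_set ?A) closure_of ?S)" by blast
    also have "\<dots> \<subseteq> M closure_of (\<kappa> ` ?S)" by (rule continuous_map_image_closure_subset[OF cont])
    finally show ?thesis using 1 imF unfolding imS k_def by blast
  qed
  show thesis
  proof (rule that[OF opW])
    have "0 \<in> ?A" using r subspace_0[OF subspace_coord_space] by simp
    then show "p \<in> \<kappa> ` ?A" using \<kappa>0 by (metis imageI)
    show "lstab y \<subseteq> lstab p" if "y \<in> \<kappa> ` ?A" for y using \<kappa> that by blast
  qed (use main in blast)+
qed

end

section \<open>Strata and assignments\<close>

text \<open>Prescribing the value at one vector outside \<open>V\<close> is what makes the polarization possible.\<close>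

lemma linear_functional_extension:
  fixes V :: "'a::euclidean_space set"
  assumes V: "subspace V" and f: "f \<in> dual_space V" and \<eta>: "\<eta> \<notin> V"
  obtains g where "linear g" "\<And>x. x \<in> V \<Longrightarrow> g x = f x" "g \<eta> = c"
proof -
  obtain B where B: "B \<subseteq> V" "independent B" "V \<subseteq> span B"
    using maximal_independent_subset by blast
  have VB: "span B = V" using B V span_minimal by blast
  then have ind: "independent (insert \<eta> B)"
    using B(2) \<eta> by (simp add: independent_insertI)
  obtain g where g: "linear g" "\<forall>x\<in>insert \<eta> B. g x = (if x \<in> V then f x else c)"
    using linear_independent_extend[OF ind, of "\<lambda>x. if x \<in> V then f x else c"] by blast
  have add: "f (x + y) = f x + f y" if "x \<in> V" "y \<in> V" for x y
    using f that by (simp add: dual_space_def)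
  have scale: "f (k *\<^sub>R x) = k * f x" if "x \<in> V" for x k
    using f that by (simp add: dual_space_def)
  have f0: "f 0 = 0" using scale[OF subspace_0[OF V], of 0] by simp
  have "x \<in> V \<and> g x = f x" if "x \<in> span B" for x
    using that
  proof (induction rule: span_induct_alt)
    case base show ?case using f0 linear_0[OF g(1)] subspace_0[OF V] by simp
  next
    case (step k x y)
    have x: "x \<in> V" "g x = f x" using step(1) B(1) g(2) by auto
    have "f (k *\<^sub>R x + y) = f (k *\<^sub>R x) + f y" "f (k *\<^sub>R x) = k * f x"
      using add[OF subspace_scale[OF V x(1)]] step(2) scale[OF x(1)] by simp_all
    then show ?case
      using x step(2) subspace_add[OF V subspace_scale[OF V x(1)]]
      by (simp add: linear_add[OF g(1)] linear_scale[OF g(1)])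
  qed
  then have "g x = f x" if "x \<in> V" for x using that VB by blast
  moreover have "g \<eta> = c" using g(2) \<eta> by simp
  ultimately show thesis by (rule that[OF g(1)])
qed

context torus_manifold
begin

text \<open>A condition on \<open>lstab\<close> instead of the infinitesimal stabilizer cuts out the same sets.\<close>

definition stratum :: "'m \<Rightarrow> 'm set" where
  "stratum y = connected_component_of_set (subtopology M {z \<in> topspace M. lstab z = lstab y}) y"

lemma inf_stabilizer_eq_iff:
  assumes "x \<in> topspace M" "y \<in> topspace M"
  shows "inf_stabilizer \<C> I \<rho> x = inf_stabilizer \<C> I \<rho> y \<longleftrightarrow> lstab x = lstab y"
  unfolding set_eq_subset lstab_subset_iff[OF assms] lstab_subset_iff[OF assms(2,1)] ..

lemma subspace_inf_stabilizer: "y \<in> topspace M \<Longrightarrow> subspace (inf_stabilizer \<C> I \<rho> y)"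
  unfolding inf_stabilizer_eq by (intro subspace_inter subspace_coord_space subspace_lstab)

lemma inf_stabilizer_subset: "inf_stabilizer \<C> I \<rho> y \<subseteq> coord_space I"
  by (auto simp: inf_stabilizer_def)

lemma stratum_self: "y \<in> topspace M \<Longrightarrow> y \<in> stratum y"
  by (simp add: stratum_def connected_component_of_refl)

lemma stratum_subset: "stratum y \<subseteq> {z \<in> topspace M. lstab z = lstab y}"
  unfolding stratum_def by (rule order_trans[OF connected_component_of_subset_topspace]) auto

lemma connectedin_stratum: "connectedin M (stratum y)"
  using connectedin_connected_component_of[of "subtopology M {z \<in> topspace M. lstab z = lstab y}" y]
  by (simp add: stratum_def connectedin_subtopology)

lemma stratum_maximal:
  assumes "connectedin M S" "y \<in> S" "\<And>z. z \<in> S \<Longrightarrow> lstab z = lstab y" shows "S \<subseteq> stratum y"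
  unfolding stratum_def
proof (rule connected_component_of_maximal)
  have "S \<subseteq> {z \<in> topspace M. lstab z = lstab y}"
    using connectedin_subset_topspace[OF assms(1)] assms(3) by blast
  then show "connectedin (subtopology M {z \<in> topspace M. lstab z = lstab y}) S"
    using assms(1) by (simp add: connectedin_subtopology)
qed (rule assms(2))

lemma stratum_eq: "z \<in> stratum y \<Longrightarrow> stratum z = stratum y"
proof -
  assume z: "z \<in> stratum y"
  then have "lstab z = lstab y" using stratum_subset by blast
  let ?X = "subtopology M {z \<in> topspace M. lstab z = lstab y}"
  have "connected_component_of ?X y z" using z by (simp add: stratum_def)
  then have "connected_component_of ?X y = connected_component_of ?X z"
    using connected_component_of_equiv[of ?X y z] by blast
  then show ?thesis
    by (simp only: stratum_def \<open>lstab z = lstab y\<close>)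
qed

lemma inf_strata_eq: "inf_strata M \<C> I \<rho> = stratum ` topspace M"
proof -
  have eq: "{z \<in> topspace M. inf_stabilizer \<C> I \<rho> z = inf_stabilizer \<C> I \<rho> y} = {z \<in> topspace M. lstab z = lstab y}"
    if "y \<in> topspace M" for y
    using inf_stabilizer_eq_iff[OF _ that] by blast
  show ?thesis
  proof
    show "inf_strata M \<C> I \<rho> \<subseteq> stratum ` topspace M"
    proof
      fix X assume "X \<in> inf_strata M \<C> I \<rho>"
      then obtain h where X: "X \<in> connected_components_of (subtopology M {z \<in> topspace M. inf_stabilizer \<C> I \<rho> z = h})"
        unfolding inf_strata_def by (elim UN_E)
      then obtain y where y: "y \<in> topspace M" "inf_stabilizer \<C> I \<rho> y = h"
        "X = connected_component_of_set (subtopology M {z \<in> topspace M. inf_stabilizer \<C> I \<rho> z = h}) y"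
        unfolding connected_components_of_def by auto
      then have "X = stratum y" using eq[OF y(1)] by (simp add: stratum_def)
      then show "X \<in> stratum ` topspace M" using y(1) by blast
    qed
    show "stratum ` topspace M \<subseteq> inf_strata M \<C> I \<rho>"
    proof clarify
      fix y assume y: "y \<in> topspace M"
      have "stratum y \<in> connected_components_of (subtopology M {z \<in> topspace M. inf_stabilizer \<C> I \<rho> z = inf_stabilizer \<C> I \<rho> y})"
        unfolding eq[OF y] stratum_def connected_component_in_connected_components_of using y by simp
      then show "stratum y \<in> inf_strata M \<C> I \<rho>"
        unfolding inf_strata_def
        by (rule UN_I[rotated]) (simp add: subspace_inf_stabilizer[OF y] inf_stabilizer_subset)
    qed
  qed
qed

lemma stratum_stabilizer_stratum:
  assumes y: "y \<in> topspace M" shows "stratum_stabilizer \<C> I \<rho> (stratum y) = inf_stabilizer \<C> I \<rho> y"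
  unfolding stratum_stabilizer_def
proof (rule the_equality)
  show "\<forall>m\<in>stratum y. inf_stabilizer \<C> I \<rho> m = inf_stabilizer \<C> I \<rho> y"
  proof
    fix m assume "m \<in> stratum y"
    then have "m \<in> topspace M" "lstab m = lstab y" using stratum_subset by blast+
    then show "inf_stabilizer \<C> I \<rho> m = inf_stabilizer \<C> I \<rho> y" using inf_stabilizer_eq_iff y by blast
  qed
  show "h = inf_stabilizer \<C> I \<rho> y" if "\<forall>m\<in>stratum y. inf_stabilizer \<C> I \<rho> m = h" for h
    using that stratum_self[OF y] by blast
qed

lemma stratum_of_eq:
  assumes y: "y \<in> topspace M" shows "stratum_of M \<C> I \<rho> y = stratum y"
  unfolding stratum_of_def
proof (rule the_equality)
  show "stratum y \<in> inf_strata M \<C> I \<rho> \<and> y \<in> stratum y"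
    using y stratum_self by (simp add: inf_strata_eq)
  show "X = stratum y" if "X \<in> inf_strata M \<C> I \<rho> \<and> y \<in> X" for X
    using that stratum_eq by (auto simp: inf_strata_eq)
qed

lemma stratum_act:
  assumes y: "y \<in> topspace M" shows "stratum (act \<sigma> y) = stratum y"
proof -
  have "connectedin M ((\<lambda>\<tau>. act \<tau> y) ` UNIV)"
    by (rule connectedin_continuous_map_image[OF continuous_act_left[OF y]])
      (simp add: convex_connected)
  then have "range (\<lambda>\<tau>. act \<tau> y) \<subseteq> stratum y"
  proof (rule stratum_maximal)
    show "y \<in> range (\<lambda>\<tau>. act \<tau> y)" by (rule range_eqI[of _ _ 0]) (simp add: y)
    show "lstab z = lstab y" if "z \<in> range (\<lambda>\<tau>. act \<tau> y)" for z
      using that lstab_act[OF y] by (elim rangeE) simp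
  qed
  then have "act \<sigma> y \<in> stratum y" by (rule subsetD) (rule rangeI)
  then show ?thesis by (rule stratum_eq)
qed

text \<open>The stratum of a point \<open>x\<close> near \<open>p\<close> accumulates at the whole stratum of \<open>p\<close>: the set where it does
  contains \<open>p\<close>, is closed in the stratum of \<open>p\<close>, and is open in it by the local description of the
  strata around its points.\<close>

lemma stratum_closure:
  assumes p: "p \<in> topspace M"
  obtains W where "openin M W" "p \<in> W" "\<And>x. x \<in> W \<Longrightarrow> lstab x \<subseteq> lstab p"
    "\<And>x. x \<in> W \<Longrightarrow> stratum p \<subseteq> M closure_of (stratum x)"
proof -
  obtain W where W: "openin M W" "p \<in> W" "\<And>y. y \<in> W \<Longrightarrow> lstab y \<subseteq> lstab p"
    "\<And>x. x \<in> W \<Longrightarrow> connectedin M {y \<in> W. lstab y = lstab x}"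
    "\<And>x. x \<in> W \<Longrightarrow> {y \<in> W. lstab x \<subseteq> lstab y} \<subseteq> M closure_of {y \<in> W. lstab y = lstab x}"
    by (rule local_strata[OF p]) (rule that; assumption)
  have "stratum p \<subseteq> M closure_of (stratum x)" if x: "x \<in> W" for x
  proof -
    have xM: "x \<in> topspace M" using x W(1) openin_subset by blast
    let ?Y = "stratum x" and ?X = "stratum p"
    let ?S = "?X \<inter> M closure_of ?Y"
    have XM: "?X \<subseteq> topspace M" using stratum_subset by blast
    have Xl: "lstab q = lstab p" if "q \<in> ?X" for q using that stratum_subset by blast
    have pS: "p \<in> ?S"
    proof -
      have "{y \<in> W. lstab y = lstab x} \<subseteq> ?Y"
        by (rule stratum_maximal[OF W(4)[OF x]]) (use x in auto)
      then have "M closure_of {y \<in> W. lstab y = lstab x} \<subseteq> M closure_of ?Y" by (rule closure_of_mono)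
      moreover have "p \<in> {y \<in> W. lstab x \<subseteq> lstab y}" using W(2) W(3)[OF x] by blast
      ultimately show ?thesis using W(5)[OF x] stratum_self[OF p] by blast
    qed
    have "closedin (subtopology M ?X) ?S"
      by (rule closedin_subtopology_Int_closed) simp
    moreover have "openin (subtopology M ?X) ?S"
    proof (subst openin_subopen, intro ballI)
      fix q assume q: "q \<in> ?S"
      then have qM: "q \<in> topspace M" and ql: "lstab q = lstab p" using XM Xl by auto
      obtain V where V: "openin M V" "q \<in> V" "\<And>y. y \<in> V \<Longrightarrow> lstab y \<subseteq> lstab q"
        "\<And>x. x \<in> V \<Longrightarrow> connectedin M {y \<in> V. lstab y = lstab x}"
        "\<And>x. x \<in> V \<Longrightarrow> {y \<in> V. lstab x \<subseteq> lstab y} \<subseteq> M closure_of {y \<in> V. lstab y = lstab x}"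
        by (rule local_strata[OF qM]) (rule that; assumption)
      have "q \<in> M closure_of ?Y" using q by simp
      then obtain z where z: "z \<in> V" "z \<in> ?Y" using V(1,2) by (auto simp only: in_closure_of)
      have zx: "stratum z = ?Y" by (rule stratum_eq[OF z(2)])
      have zl: "lstab z = lstab x" using z(2) stratum_subset[of x] by blast
      have "{y \<in> V. lstab y = lstab z} \<subseteq> stratum z"
        by (rule stratum_maximal[OF V(4)[OF z(1)]]) (use z in auto)
      then have "M closure_of {y \<in> V. lstab y = lstab z} \<subseteq> M closure_of ?Y"
        unfolding zx by (rule closure_of_mono)
      then have cl: "{y \<in> V. lstab z \<subseteq> lstab y} \<subseteq> M closure_of ?Y"
        by (rule order_trans[OF V(5)[OF z(1)]])
      have "?X \<inter> V \<subseteq> ?S"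
      proof
        fix y assume y: "y \<in> ?X \<inter> V"
        then have "lstab y = lstab p" using Xl by blast
        then have "lstab z \<subseteq> lstab y" using W(3)[OF x] zl by metis
        then have "y \<in> M closure_of ?Y" using y by (intro subsetD[OF cl]) simp
        then show "y \<in> ?S" using y by simp
      qed
      moreover have "openin (subtopology M ?X) (?X \<inter> V)"
        using V(1) by (rule openin_subtopology_Int2)
      ultimately show "\<exists>T. openin (subtopology M ?X) T \<and> q \<in> T \<and> T \<subseteq> ?S"
        using q V(2) by (intro exI[of _ "?X \<inter> V"]) blast
    qed
    moreover have "connected_space (subtopology M ?X)"
      using connectedin_stratum by (simp add: connectedin_def)
    ultimately have "?S = {} \<or> ?S = topspace (subtopology M ?X)"
      unfolding connected_space_clopen_in by blast
    then show ?thesis using pS XM by auto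
  qed
  note closure = this
  show thesis by (rule that[OF W(1,2)]; (rule W(3) closure; assumption))
qed

lemma assignment_dual:
  assumes A: "assignment M \<C> I \<rho> A" and y: "y \<in> topspace M"
  shows "A (stratum y) \<in> dual_space (inf_stabilizer \<C> I \<rho> y)"
proof -
  have "stratum y \<in> inf_strata M \<C> I \<rho>" using y by (simp only: inf_strata_eq imageI)
  then have "A (stratum y) \<in> dual_space (stratum_stabilizer \<C> I \<rho> (stratum y))"
    using A[unfolded assignment_def] by blast
  then show ?thesis by (simp only: stratum_stabilizer_stratum[OF y])
qed

text \<open>The stratum of \<open>p\<close> is contained in the closures of the strata of the points near \<open>p\<close>, so that the
  compatibility condition applies. Strata and infinitesimal stabilizers are constant along orbits,
  which extends the conclusion to the saturation of a neighbourhood.\<close>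

lemma assignment_local:
  assumes A: "assignment M \<C> I \<rho> A" and p: "p \<in> topspace M"
  obtains W where "openin M W" "invariant W" "p \<in> W"
    "\<And>x. x \<in> W \<Longrightarrow> inf_stabilizer \<C> I \<rho> x \<subseteq> inf_stabilizer \<C> I \<rho> p"
    "\<And>x \<xi>. x \<in> W \<Longrightarrow> \<xi> \<in> inf_stabilizer \<C> I \<rho> x \<Longrightarrow> A (stratum x) \<xi> = A (stratum p) \<xi>"
proof -
  obtain W where W: "openin M W" "p \<in> W" "\<And>x. x \<in> W \<Longrightarrow> lstab x \<subseteq> lstab p"
    "\<And>x. x \<in> W \<Longrightarrow> stratum p \<subseteq> M closure_of (stratum x)"
    by (rule stratum_closure[OF p]) (rule that; assumption)
  have WM: "W \<subseteq> topspace M" using W(1) openin_subset by blast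
  have sub: "inf_stabilizer \<C> I \<rho> x \<subseteq> inf_stabilizer \<C> I \<rho> p" if "x \<in> W" for x
    using lstab_subset_iff[of x p] W(3)[OF that] that WM p by blast
  have val: "A (stratum x) \<xi> = A (stratum p) \<xi>" if x: "x \<in> W" and \<xi>: "\<xi> \<in> inf_stabilizer \<C> I \<rho> x" for x \<xi>
  proof -
    have xM: "x \<in> topspace M" using x WM by blast
    have "A (stratum x) = restrict (A (stratum p)) (stratum_stabilizer \<C> I \<rho> (stratum x))"
      using A W(4)[OF x] xM p unfolding assignment_def inf_strata_eq by blast
    then show ?thesis using \<xi> stratum_stabilizer_stratum[OF xM] by simp
  qed
  show thesis
  proof (rule that[OF openin_saturation[OF W(1)] invariant_saturation[OF WM]])
    show "p \<in> saturation W" using subset_saturation[OF WM] W(2) by blast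
    fix x assume "x \<in> saturation W"
    then obtain \<sigma> y where y: "y \<in> W" "x = act \<sigma> y" by (auto simp: saturation_def)
    have yM: "y \<in> topspace M" using y(1) WM by blast
    have st: "inf_stabilizer \<C> I \<rho> x = inf_stabilizer \<C> I \<rho> y" "stratum x = stratum y"
      using y(2) yM by (simp_all add: inf_stabilizer_eq_iff lstab_act stratum_act)
    show "inf_stabilizer \<C> I \<rho> x \<subseteq> inf_stabilizer \<C> I \<rho> p" using sub[OF y(1)] st by simp
    show "A (stratum x) \<xi> = A (stratum p) \<xi>" if "\<xi> \<in> inf_stabilizer \<C> I \<rho> x" for \<xi>
      using val[OF y(1)] st that by simp
  qed
qed

lemma fixed_points_inf_stabilizer:
  assumes y: "y \<in> fixed_points M \<rho> H" and \<xi>: "\<xi> \<in> lie_algebra I H"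
  shows "\<xi> \<in> inf_stabilizer \<C> I \<rho> y"
proof -
  have yM: "y \<in> topspace M" and yH: "\<And>g. g \<in> H \<Longrightarrow> \<rho> g y = y"
    using y unfolding fixed_points_def by blast+
  have \<xi>I: "\<xi> \<in> coord_space I" and \<xi>H: "\<And>t. torus_exp (t *\<^sub>R \<xi>) \<in> H"
    using \<xi> unfolding lie_algebra_def by blast+
  have "act (t *\<^sub>R \<xi>) y = y" for t
    using yH[OF \<xi>H] act_scaled_coord[OF \<xi>I] by simp
  then show ?thesis
    using \<xi>I by (simp add: inf_stabilizer_eq[OF yM] lstab_iff)
qed

text \<open>The Lie algebra of a subgroup \<open>H\<close> is contained in the infinitesimal stabilizer of every point that
  \<open>H\<close> fixes, so on these points the component of \<open>\<Psi>\<close> in question is given by \<open>A\<close>, and it is locally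
  constant by \<open>assignment_local\<close>.\<close>

lemma abstract_moment_mapI:
  assumes A: "assignment M \<C> I \<rho> A"
    and dual: "\<And>y. y \<in> topspace M \<Longrightarrow> \<Psi> y \<in> dual_space (coord_space I)"
    and smooth: "\<And>\<xi>. \<xi> \<in> coord_space I \<Longrightarrow> smooth_function \<C> (\<lambda>y. \<Psi> y \<xi>)"
    and inv: "\<And>\<sigma> y. y \<in> topspace M \<Longrightarrow> \<Psi> (act \<sigma> y) = \<Psi> y"
    and val: "\<And>y \<xi>. y \<in> topspace M \<Longrightarrow> \<xi> \<in> inf_stabilizer \<C> I \<rho> y \<Longrightarrow> \<Psi> y \<xi> = A (stratum y) \<xi>"
  shows "abstract_moment_map M \<C> I \<rho> \<Psi>" "has_assignment M \<C> I \<rho> \<Psi> A"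
proof -
  show "has_assignment M \<C> I \<rho> \<Psi> A"
    unfolding has_assignment_def inf_strata_eq
  proof (intro ballI)
    fix X m assume X: "X \<in> stratum ` topspace M" and m: "m \<in> X"
    then have mM: "m \<in> topspace M" using stratum_subset by blast
    have Xm: "X = stratum m" using X m stratum_eq by blast
    have "A (stratum m) \<in> extensional (inf_stabilizer \<C> I \<rho> m)"
      using assignment_dual[OF A mM] by (simp add: dual_space_def)
    then show "restrict (\<Psi> m) (stratum_stabilizer \<C> I \<rho> X) = A X"
      unfolding Xm stratum_stabilizer_stratum[OF mM]
      using val[OF mM] by (intro extensionalityI[of _ "inf_stabilizer \<C> I \<rho> m"]) auto
  qed
  have lc: "locally_constant (subtopology M (fixed_points M \<rho> H)) (\<lambda>m. restrict (\<Psi> m) (lie_algebra I H))" for H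
    unfolding locally_constant_def
  proof
    fix y assume "y \<in> topspace (subtopology M (fixed_points M \<rho> H))"
    then have y: "y \<in> topspace M" "y \<in> fixed_points M \<rho> H" by auto
    obtain W where W: "openin M W" "y \<in> W"
      "\<And>x \<xi>. x \<in> W \<Longrightarrow> \<xi> \<in> inf_stabilizer \<C> I \<rho> x \<Longrightarrow> A (stratum x) \<xi> = A (stratum y) \<xi>"
      by (rule assignment_local[OF A y(1)]) (rule that; assumption)
    let ?U = "fixed_points M \<rho> H \<inter> W"
    have "openin (subtopology M (fixed_points M \<rho> H)) ?U" using W(1) by (rule openin_subtopology_Int2)
    moreover have "restrict (\<Psi> x) (lie_algebra I H) = restrict (A (stratum y)) (lie_algebra I H)" if x: "x \<in> ?U" for x
    proof (rule restrict_ext)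
      fix \<xi> assume \<xi>: "\<xi> \<in> lie_algebra I H"
      have xM: "x \<in> topspace M" using x by (simp add: fixed_points_def)
      have "\<xi> \<in> inf_stabilizer \<C> I \<rho> x" using fixed_points_inf_stabilizer x \<xi> by blast
      then show "\<Psi> x \<xi> = A (stratum y) \<xi>" using val[OF xM] W(3) x by simp
    qed
    then have "(\<lambda>m. restrict (\<Psi> m) (lie_algebra I H)) constant_on ?U"
      unfolding constant_on_def by blast
    ultimately show "\<exists>U. openin (subtopology M (fixed_points M \<rho> H)) U \<and> y \<in> U \<and>
        (\<lambda>m. restrict (\<Psi> m) (lie_algebra I H)) constant_on U"
      using y(2) W(2) by (intro exI[of _ ?U]) blast
  qed
  have invg: "\<Psi> (\<rho> g m) = \<Psi> m" if "g \<in> carrier (torus I)" "m \<in> topspace M" for g m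
    using torus_exp_proj_surj[OF that(1)] inv[OF that(2)] unfolding act_def by metis
  show "abstract_moment_map M \<C> I \<rho> \<Psi>"
    unfolding abstract_moment_map_def using dual smooth invg lc by blast
qed

lemma proper_bounded_belowI:
  assumes cont: "continuous_map M euclideanreal f" and bdd: "\<And>y. y \<in> topspace M \<Longrightarrow> b \<le> f y"
    and comp: "\<And>r. compactin M {y \<in> topspace M. f y \<le> r}"
  shows "proper_bounded_below M f"
proof -
  have "proper_map M euclideanreal f"
  proof (rule compact_imp_proper_map)
    show "compactin M {x \<in> topspace M. f x \<in> K}" if K: "compactin euclideanreal K" for K
    proof -
      have cK: "compact K" using K by simp
      then obtain r where r: "\<And>x. x \<in> K \<Longrightarrow> x \<le> r" using compact_imp_bounded bounded_imp_bdd_above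
        unfolding bdd_above_def by metis
      have "closedin M {x \<in> topspace M. f x \<in> K}"
        using closedin_continuous_map_preimage[OF cont, of K] compact_imp_closed[OF cK] by simp
      then show ?thesis by (rule closed_compactin[OF comp[of r], rotated]) (use r in auto)
    qed
  qed (use cont in \<open>simp_all add: k_space_euclideanreal Hausdorff_imp_kc_space\<close>)
  moreover have "bdd_below (f ` topspace M)" using bdd by (rule bdd_belowI2)
  ultimately show ?thesis by (simp add: proper_bounded_below_def)
qed

lemma polarized_moment_map_exists:
  assumes \<eta>: "\<eta> \<in> coord_space I" and pol: "polarized_assignment M \<C> I \<rho> \<eta> A"
  shows "\<exists>\<Psi>. abstract_moment_map M \<C> I \<rho> \<Psi> \<and> polarized_map M \<eta> \<Psi> \<and> has_assignment M \<C> I \<rho> \<Psi> A"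
proof -
  let ?Z = "zero_set M \<C> I \<rho> \<eta>" and ?g = "inf_stabilizer \<C> I \<rho>"
  have A: "assignment M \<C> I \<rho> A" using pol by (simp add: polarized_assignment_def)
  obtain f where contf: "continuous_map M euclideanreal f" and f0: "\<And>y. y \<in> topspace M \<Longrightarrow> 0 \<le> f y"
    and finv: "\<And>y \<sigma>. y \<in> topspace M \<Longrightarrow> f (act \<sigma> y) = f y"
    and fcomp: "\<And>b. compactin M {y \<in> topspace M. f y \<le> b}"
    using invariant_exhaustion by blast
  have Z: "y \<in> ?Z \<longleftrightarrow> y \<in> topspace M \<and> \<eta> \<in> ?g y" for y by (simp add: zero_set_def)
  let ?a = "\<lambda>m. A (stratum_of M \<C> I \<rho> m) \<eta>"
  have pbZ: "proper_map (subtopology M ?Z) euclideanreal ?a" "bdd_below (?a ` topspace (subtopology M ?Z))"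
    using pol by (simp_all add: polarized_assignment_def proper_bounded_below_def)
  obtain b where b: "\<And>m. m \<in> ?Z \<Longrightarrow> b \<le> A (stratum m) \<eta>"
  proof -
    obtain b where "\<And>m. m \<in> topspace (subtopology M ?Z) \<Longrightarrow> b \<le> ?a m"
      using pbZ(2) unfolding bdd_below_def by blast
    then show thesis using that[of b] Z stratum_of_eq by auto
  qed
  \<comment> \<open>The exhaustion is bounded on the compact sublevel sets of \<open>A\<^sup>\<eta>\<close>.\<close>
  have boundZ: "\<exists>C. \<forall>m\<in>?Z. A (stratum m) \<eta> \<le> r \<longrightarrow> f m \<le> C" for r
  proof -
    have "compactin (subtopology M ?Z) {m \<in> topspace (subtopology M ?Z). ?a m \<in> {b..r}}"
      by (rule compactin_proper_map_preimage[OF pbZ(1)]) simp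
    then have K: "compactin M {m \<in> topspace (subtopology M ?Z). ?a m \<in> {b..r}}"
      by (simp add: compactin_subtopology)
    have "compact (f ` {m \<in> topspace (subtopology M ?Z). ?a m \<in> {b..r}})"
      using image_compactin[OF K contf] by simp
    then obtain C where C: "\<And>x. x \<in> f ` {m \<in> topspace (subtopology M ?Z). ?a m \<in> {b..r}} \<Longrightarrow> x \<le> C"
      using compact_imp_bounded bounded_imp_bdd_above unfolding bdd_above_def by metis
    have "f m \<le> C" if m: "m \<in> ?Z" "A (stratum m) \<eta> \<le> r" for m
    proof -
      have "m \<in> topspace M" using m(1) Z by blast
      then have "m \<in> {m \<in> topspace (subtopology M ?Z). ?a m \<in> {b..r}}"
        using m b[OF m(1)] by (simp add: stratum_of_eq)
      then show ?thesis using C by blast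
    qed
    then show ?thesis by blast
  qed
  have "\<exists>U. openin M U \<and> invariant U \<and> m \<in> U \<and> (\<forall>x\<in>U. f x < f m + 1 \<and> ?g x \<subseteq> ?g m \<and>
      (\<forall>\<xi>\<in>?g x. A (stratum x) \<xi> = A (stratum m) \<xi>))" if m: "m \<in> topspace M" for m
  proof -
    obtain W where W: "openin M W" "invariant W" "m \<in> W" "\<And>x. x \<in> W \<Longrightarrow> ?g x \<subseteq> ?g m"
      "\<And>x \<xi>. x \<in> W \<Longrightarrow> \<xi> \<in> ?g x \<Longrightarrow> A (stratum x) \<xi> = A (stratum m) \<xi>"
      by (rule assignment_local[OF A m]) (rule that; assumption)
    have WM: "W \<subseteq> topspace M" using W(1) openin_subset by blast
    let ?U = "W \<inter> {x \<in> topspace M. f x \<in> {..<f m + 1}}"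
    have "openin M ?U"
      by (rule openin_Int[OF W(1) openin_continuous_map_preimage[OF contf]]) simp
    moreover have "invariant ?U" using W(2) WM finv by (auto simp: invariant_def)
    ultimately show ?thesis using W m by (intro exI[of _ ?U]) auto
  qed
  then obtain U where U: "\<And>m. m \<in> topspace M \<Longrightarrow> openin M (U m) \<and> invariant (U m) \<and> m \<in> U m \<and>
      (\<forall>x\<in>U m. f x < f m + 1 \<and> ?g x \<subseteq> ?g m \<and> (\<forall>\<xi>\<in>?g x. A (stratum x) \<xi> = A (stratum m) \<xi>))" by metis
  \<comment> \<open>Off the zero set of \<open>\<eta>\<close> the value at \<open>\<eta>\<close> is free; taking it from the exhaustion gives properness.\<close>
  have "\<exists>l. linear l \<and> (\<forall>\<xi>\<in>?g m. l \<xi> = A (stratum m) \<xi>) \<and> (m \<notin> ?Z \<longrightarrow> l \<eta> = f m)" if m: "m \<in> topspace M" for m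
  proof (cases "m \<in> ?Z")
    case True
    show ?thesis
    proof (cases "?g m = UNIV")
      case True
      have "linear (A (stratum m))"
        using assignment_dual[OF A m] True by (auto simp: dual_space_def intro!: linearI)
      then show ?thesis using \<open>m \<in> ?Z\<close> by blast
    next
      case False
      then obtain \<zeta> where "\<zeta> \<notin> ?g m" by blast
      from linear_functional_extension[OF subspace_inf_stabilizer[OF m] assignment_dual[OF A m] this]
      show ?thesis using \<open>m \<in> ?Z\<close> by metis
    qed
  next
    case False
    then have "\<eta> \<notin> ?g m" using Z m by blast
    from linear_functional_extension[OF subspace_inf_stabilizer[OF m] assignment_dual[OF A m] this]
    show ?thesis by metis
  qed
  then obtain l where l: "\<And>m. m \<in> topspace M \<Longrightarrow> linear (l m) \<and> (\<forall>\<xi>\<in>?g m. l m \<xi> = A (stratum m) \<xi>) \<and>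
      (m \<notin> ?Z \<longrightarrow> l m \<eta> = f m)" by metis
  obtain c R where P: "partition_of_unity U c R"
    using partition_of_unity_exists[of U] U by blast
  define v where "v \<xi> i = (if c i \<in> topspace M then l (c i) \<xi> else 0)" for \<xi> i
  have v_lin: "v (x + y) i = v x i + v y i" "v (k *\<^sub>R x) i = k * v x i" for x y k i
    using l[of "c i"] by (simp_all add: v_def linear_add linear_scale)
  define \<Psi> where "\<Psi> y = restrict (\<lambda>\<xi>. glue R (v \<xi>) y) (coord_space I)" for y
  have \<Psi>\<eta>: "\<Psi> y \<eta> = glue R (v \<eta>) y" for y using \<eta> by (simp add: \<Psi>_def)
  have dual: "\<Psi> y \<in> dual_space (coord_space I)" if y: "y \<in> topspace M" for y
  proof -
    obtain n where n: "\<And>a. glue R a y = (\<Sum>i<n. R i y * a i)"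
      using glue_local[OF P y] by metis
    have "glue R (v (x + z)) y = glue R (v x) y + glue R (v z) y" "glue R (v (k *\<^sub>R x)) y = k * glue R (v x) y" for x z k
      by (simp_all add: n v_lin distrib_left sum.distrib sum_distrib_left mult.left_commute)
    then show ?thesis
      by (simp add: \<Psi>_def dual_space_def subspace_add[OF subspace_coord_space]
          subspace_scale[OF subspace_coord_space])
  qed
  have val: "\<Psi> y \<xi> = A (stratum y) \<xi>" if y: "y \<in> topspace M" and \<xi>: "\<xi> \<in> ?g y" for y \<xi>
  proof -
    have "glue R (v \<xi>) y = A (stratum y) \<xi>"
    proof (rule glue_eq[OF P y])
      fix i assume i: "c i \<in> topspace M" "y \<in> U (c i)"
      then have "?g y \<subseteq> ?g (c i)" "\<forall>\<xi>\<in>?g y. A (stratum y) \<xi> = A (stratum (c i)) \<xi>" using U[OF i(1)] by simp_all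
      then have "\<xi> \<in> ?g (c i)" "A (stratum y) \<xi> = A (stratum (c i)) \<xi>" using \<xi> by blast+
      then show "v \<xi> i = A (stratum y) \<xi>" using l[OF i(1)] i(1) by (simp add: v_def)
    qed
    then show ?thesis using \<xi> inf_stabilizer_subset by (auto simp: \<Psi>_def)
  qed
  have "smooth_function \<C> (\<lambda>y. \<Psi> y \<xi>)" if "\<xi> \<in> coord_space I" for \<xi>
    using smooth_glue[OF P, of "v \<xi>"] that by (simp add: \<Psi>_def)
  moreover have "\<Psi> (act \<sigma> y) = \<Psi> y" if "y \<in> topspace M" for \<sigma> y
    using glue_act[OF P that] by (simp add: \<Psi>_def)
  ultimately have M1: "abstract_moment_map M \<C> I \<rho> \<Psi>" "has_assignment M \<C> I \<rho> \<Psi> A"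
    using abstract_moment_mapI[OF A dual _ _ val] by simp_all
  have v\<eta>: "v \<eta> i = (if c i \<in> ?Z then A (stratum (c i)) \<eta> else f (c i))" if "c i \<in> topspace M" for i
    using l[OF that] that Z by (auto simp: v_def)
  have "proper_bounded_below M (\<lambda>y. \<Psi> y \<eta>)"
  proof (rule proper_bounded_belowI[where b = "min b 0"])
    show cont: "continuous_map M euclideanreal (\<lambda>y. \<Psi> y \<eta>)"
      unfolding \<Psi>\<eta> by (rule smooth_function_continuous[OF smooth_glue[OF P]])
    show "min b 0 \<le> \<Psi> y \<eta>" if "y \<in> topspace M" for y
      unfolding \<Psi>\<eta>
    proof (rule glue_mono[OF P that])
      show "min b 0 \<le> v \<eta> i" if "c i \<in> topspace M" for i
        using v\<eta>[OF that] b[of "c i"] f0[OF that] by auto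
    qed
    fix r
    \<comment> \<open>A point where \<open>\<Psi>\<^sup>\<eta>\<close> is at most \<open>r\<close> is in the domain of a constant that is at most \<open>r\<close>.\<close>
    obtain C where C: "\<forall>m\<in>?Z. A (stratum m) \<eta> \<le> r \<longrightarrow> f m \<le> C" using boundZ by blast
    have "{y \<in> topspace M. \<Psi> y \<eta> \<le> r} \<subseteq> {y \<in> topspace M. f y \<le> max r C + 1}"
    proof clarify
      fix y assume y: "y \<in> topspace M" "\<Psi> y \<eta> \<le> r"
      then obtain i where i: "c i \<in> topspace M" "y \<in> U (c i)" "v \<eta> i \<le> r"
        using glue_le_imp_ex[OF P y(1), of "v \<eta>" r] \<Psi>\<eta> by metis
      have "f (c i) \<le> max r C"
        using i(3) v\<eta>[OF i(1)] C by (cases "c i \<in> ?Z") auto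
      moreover have "f y < f (c i) + 1" using U[OF i(1)] i(2) by simp
      ultimately show "f y \<le> max r C + 1" by simp
    qed
    moreover have "closedin M {y \<in> topspace M. \<Psi> y \<eta> \<le> r}"
      using closedin_continuous_map_preimage[OF cont, of "{..r}"] by simp
    ultimately show "compactin M {y \<in> topspace M. \<Psi> y \<eta> \<le> r}"
      using closed_compactin[OF fcomp] by blast
  qed
  then show ?thesis using M1 by (auto simp: polarized_map_def)
qed

end

theorem theorem3p21:
  fixes M :: "'m topology"
    and \<C> :: "('m, 'd::finite) chart set"
    and I :: "'n::finite set"
    and \<rho> :: "complex ^ 'n \<Rightarrow> 'm \<Rightarrow> 'm"
    and \<eta> :: "real ^ 'n"
    and A :: "'m set \<Rightarrow> real ^ 'n \<Rightarrow> real"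
  assumes "smooth_manifold M \<C>"
    and "smooth_torus_action M \<C> I \<rho>"
    and "\<eta> \<in> coord_space I"
    and "polarized_assignment M \<C> I \<rho> \<eta> A"
  shows "\<exists>\<Psi>. abstract_moment_map M \<C> I \<rho> \<Psi> \<and> polarized_map M \<eta> \<Psi> \<and> has_assignment M \<C> I \<rho> \<Psi> A"
proof -
  interpret torus_manifold M \<C> I \<rho>
    by unfold_locales (fact assms(1,2))+
  show ?thesis by (rule polarized_moment_map_exists[OF assms(3,4)])
qed

end
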